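(* Let $N\ge 1$ and $\eta\ge 1$ be integers, let $\lambda\in\mathbf C$ (in particular $\lambda\in\mathbf R$ is allowed), and let $q$ be an integer with $q>\frac N2$ and $q\ge\eta$. Let $\psi_0\in H^q(\mathbf R^N)$, and suppose that the nonlinearity $\mathcal F_\eta(\psi)=\lambda|\psi|^{2\eta}\psi$ satisfies the following two hypotheses. (H1) There is a constant $C^{\mathrm L}=C(\lambda,\eta)$ such that for all $f,g\in\mathbf R$, $|\mathcal F_\eta(f)-\mathcal F_\eta(g)|\le C^{\mathrm L}|f-g|\,(|f|^{2\eta}+|g|^{2\eta})$. (H2) There exists an integer $\sigma$ such that the $\sigma$-th derivative $\mathcal F_\eta^{(\sigma)}$ satisfies, for all $f,g\in\mathbf R$, $|\mathcal F_\eta^{(\sigma)}(f)-\mathcal F_\eta^{(\sigma)}(g)|\le C^{\mathrm L}|f-g|\,(|f|^{2\eta-\sigma}+|g|^{2\eta-\sigma})$. Then, for the Cauchy problem $$\Big(\mathrm i\frac{\partial}{\partial t}+\Delta\Big)\psi=\lambda|\psi|^{2\eta}\psi\quad (x\in\mathbf R^N,\ t>0),\qquad \psi(\cdot,0)=\psi_0,$$ the following hold. (I) There exists $T>0$, depending only on $\psi_0$, such that the problem admits a unique mild solution in $L^\infty((0,T);H^q(\mathbf R^N))$. (II) The unique mild solution on $[0,T]$ can be extended to an interval $[0,T_+]$ for some $T_+>T$, in such a way that the extension is also the unique mild solution of the problem on $[0,T_+]$ (in $L^\infty((0,T_+);H^q(\mathbf R^N))$).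
   Context: Mild solution: for a Banach space $X$, a mild $X$-valued solution on $[0,T]$ is a function $\psi\in C([0,T];X)$ satisfying $$\psi(t)=e^{\mathrm i t\Delta}\psi_0-\mathrm i\lambda\int_0^t e^{\mathrm i(t-\nu)\Delta}\big\{|\psi(\nu)|^{2\eta}\psi(\nu)\big\}\,d\nu,\qquad t\in[0,T].$$ Here $X=H^q(\mathbf R^N)$ is the $L^2$-based Sobolev space of complex-valued functions. Continuation: given a mild solution $\psi\in L^\infty((0,T);H^q(\mathbf R^N))$, a continuation of $\psi$ is a function $\psi_{cont}\in L^\infty((0,T_+);H^q(\mathbf R^N))$, for some $T_+>T$, which is also a mild solution (on $[0,T_+]$) and satisfies $\psi_{cont}(t)=\psi(t)$ for all $t\in[0,T]$. *)

theory Defs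
  imports "HOL-Analysis.Analysis" "HOL-Library.Type_Length"
begin

section \<open>Square-integrable functions and the Fourier transform on \<open>L\<^sup>2\<close>\<close>

definition square_integrable :: "('a::euclidean_space \<Rightarrow> complex) \<Rightarrow> bool" where
  "square_integrable f \<longleftrightarrow>
     f \<in> borel_measurable lborel \<and> integrable lborel (\<lambda>x. (cmod (f x))\<^sup>2)"

definition L2_norm :: "('a::euclidean_space \<Rightarrow> complex) \<Rightarrow> real" where
  "L2_norm f = sqrt (LINT x|lborel. (cmod (f x))\<^sup>2)"

text \<open>Unitary normalisation: the Laplacian becomes multiplication by \<open>-\<bar>\<xi>\<bar>\<^sup>2\<close>.\<close>

definition fourier_L1 :: "('a::euclidean_space \<Rightarrow> complex) \<Rightarrow> 'a \<Rightarrow> complex" where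
  "fourier_L1 f \<xi> =
     complex_of_real ((2 * pi) powr (- real DIM('a) / 2)) *
       (LINT x|lborel. cis (- (x \<bullet> \<xi>)) * f x)"

definition truncate_ball :: "real \<Rightarrow> ('a::euclidean_space \<Rightarrow> complex) \<Rightarrow> 'a \<Rightarrow> complex" where
  "truncate_ball R f x = indicator (cball 0 R) x *\<^sub>R f x"

text \<open>The \<open>L\<^sup>2\<close> Fourier transform \<open>g\<close> of \<open>f\<close> is the \<open>L\<^sup>2\<close> limit of the (absolutely convergent)
  Fourier integrals over growing balls. It is determined up to null sets.\<close>

definition has_fourier :: "('a::euclidean_space \<Rightarrow> complex) \<Rightarrow> ('a \<Rightarrow> complex) \<Rightarrow> bool" where
  "has_fourier f g \<longleftrightarrow> square_integrable f \<and> square_integrable g \<and>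
     ((\<lambda>R. \<integral>\<^sup>+ \<xi>. ennreal ((cmod (fourier_L1 (truncate_ball R f) \<xi> - g \<xi>))\<^sup>2) \<partial>lborel)
        \<longlongrightarrow> 0) at_top"

definition fourier_L2 :: "('a::euclidean_space \<Rightarrow> complex) \<Rightarrow> 'a \<Rightarrow> complex" where
  "fourier_L2 f = (SOME g. has_fourier f g)"


section \<open>The Sobolev space \<open>H\<^sup>q(\<real>\<^sup>N)\<close>\<close>

definition bessel_weight :: "nat \<Rightarrow> ('a::euclidean_space \<Rightarrow> complex) \<Rightarrow> 'a \<Rightarrow> complex" where
  "bessel_weight q g \<xi> = complex_of_real (sqrt (1 + (norm \<xi>)\<^sup>2) ^ q) * g \<xi>"

definition in_sobolev :: "nat \<Rightarrow> ('a::euclidean_space \<Rightarrow> complex) \<Rightarrow> bool" where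
  "in_sobolev q f \<longleftrightarrow> (\<exists>g. has_fourier f g \<and> square_integrable (bessel_weight q g))"

lemma square_integrableD:
  assumes "square_integrable f"
  shows "f \<in> borel_measurable borel" "integrable lborel (\<lambda>x. (cmod (f x))\<^sup>2)"
  using assms by (auto simp: square_integrable_def)

lemma square_integrable_zero: "square_integrable (\<lambda>_. 0)"
  by (simp add: square_integrable_def)

lemma cmod_add_sq_le: "(cmod (a + b))\<^sup>2 \<le> 2 * (cmod a)\<^sup>2 + 2 * (cmod b)\<^sup>2"
proof -
  have "(cmod (a + b))\<^sup>2 \<le> (cmod a + cmod b)\<^sup>2"
    by (intro power_mono norm_triangle_ineq) auto
  also have "\<dots> \<le> 2 * (cmod a)\<^sup>2 + 2 * (cmod b)\<^sup>2"
    using sum_squares_bound[of "cmod a" "cmod b"] by (simp add: power2_sum)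
  finally show ?thesis .
qed

lemma square_integrable_add:
  assumes f: "square_integrable f" and g: "square_integrable g"
  shows "square_integrable (\<lambda>x. f x + g x)"
proof -
  note [measurable] = square_integrableD(1)[OF f] square_integrableD(1)[OF g]
  have "integrable lborel (\<lambda>x. (cmod (f x + g x))\<^sup>2)"
  proof (rule Bochner_Integration.integrable_bound)
    show "integrable lborel (\<lambda>x. 2 * (cmod (f x))\<^sup>2 + 2 * (cmod (g x))\<^sup>2)"
      using square_integrableD(2)[OF f] square_integrableD(2)[OF g] by auto
  qed (use cmod_add_sq_le in auto)
  thus ?thesis by (simp add: square_integrable_def)
qed

lemma square_integrable_cmult:
  assumes f: "square_integrable f"
  shows "square_integrable (\<lambda>x. c * f x)"
  using square_integrableD[OF f]
  by (auto simp: square_integrable_def norm_mult power_mult_distrib)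

lemma square_integrable_cong_AE:
  assumes "f \<in> borel_measurable borel" "g \<in> borel_measurable borel"
    and "AE x in lborel. f x = g x"
  shows "square_integrable f \<longleftrightarrow> square_integrable g"
proof -
  have "integrable lborel (\<lambda>x. (cmod (f x))\<^sup>2) \<longleftrightarrow> integrable lborel (\<lambda>x. (cmod (g x))\<^sup>2)"
    using assms by (intro integrable_cong_AE) auto
  thus ?thesis using assms by (simp add: square_integrable_def)
qed

lemma L2_norm_nonneg [simp]: "0 \<le> L2_norm f"
  by (simp add: L2_norm_def)

lemma L2_norm_sq: "(L2_norm f)\<^sup>2 = (LINT x|lborel. (cmod (f x))\<^sup>2)"
  by (simp add: L2_norm_def)

lemma L2_norm_zero [simp]: "L2_norm (\<lambda>_. 0) = 0"
  by (simp add: L2_norm_def)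

lemma L2_norm_cong_AE:
  assumes "f \<in> borel_measurable borel" "g \<in> borel_measurable borel"
    and "AE x in lborel. f x = g x"
  shows "L2_norm f = L2_norm g"
  unfolding L2_norm_def using assms by (intro arg_cong[where f = sqrt] integral_cong_AE) auto

lemma L2_norm_cmult: "L2_norm (\<lambda>x. c * f x) = cmod c * L2_norm f"
  by (simp add: L2_norm_def norm_mult power_mult_distrib real_sqrt_mult)

lemma L2_norm_eq_0_iff:
  assumes f: "square_integrable f"
  shows "L2_norm f = 0 \<longleftrightarrow> (AE x in lborel. f x = 0)"
  using integral_nonneg_eq_0_iff_AE[OF square_integrableD(2)[OF f]] by (simp add: L2_norm_def)

lemma L2_norm_triangle:
  assumes f: "square_integrable f" and g: "square_integrable g"
  shows "L2_norm (\<lambda>x. f x + g x) \<le> L2_norm f + L2_norm g"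
proof -
  note [measurable] = square_integrableD(1)[OF f] square_integrableD(1)[OF g]
  define a b where "a = L2_norm f" and "b = L2_norm g"
  consider "a = 0" | "b = 0" | "a > 0" "b > 0"
    using L2_norm_nonneg[of f] L2_norm_nonneg[of g] unfolding a_def b_def by linarith
  thus ?thesis
  proof cases
    case 1
    hence "AE x in lborel. f x = 0" using L2_norm_eq_0_iff[OF f] by (simp add: a_def)
    hence "AE x in lborel. f x + g x = g x" by eventually_elim simp
    hence "L2_norm (\<lambda>x. f x + g x) = L2_norm g" by (intro L2_norm_cong_AE) auto
    thus ?thesis by simp
  next
    case 2
    hence "AE x in lborel. g x = 0" using L2_norm_eq_0_iff[OF g] by (simp add: b_def)
    hence "AE x in lborel. f x + g x = f x" by eventually_elim simp
    hence "L2_norm (\<lambda>x. f x + g x) = L2_norm f" by (intro L2_norm_cong_AE) auto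
    thus ?thesis by simp
  next
    case 3
    have pt: "(cmod (u + v))\<^sup>2 \<le> (1 + b / a) * (cmod u)\<^sup>2 + (1 + a / b) * (cmod v)\<^sup>2" for u v
    proof -
      have "(cmod (u + v))\<^sup>2 \<le> (cmod u + cmod v)\<^sup>2"
        by (intro power_mono norm_triangle_ineq) auto
      also have "\<dots> \<le> (1 + b / a) * (cmod u)\<^sup>2 + (1 + a / b) * (cmod v)\<^sup>2"
      proof -
        have "0 \<le> (b * cmod u - a * cmod v)\<^sup>2 / (a * b)"
          using 3 by simp
        also have "\<dots> = b / a * (cmod u)\<^sup>2 + a / b * (cmod v)\<^sup>2 - 2 * cmod u * cmod v"
          using 3 by (simp add: power2_eq_square field_simps)
        finally show ?thesis by (simp add: power2_sum algebra_simps)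
      qed
      finally show ?thesis .
    qed
    have "(LINT x|lborel. (cmod (f x + g x))\<^sup>2)
        \<le> (LINT x|lborel. (1 + b / a) * (cmod (f x))\<^sup>2 + (1 + a / b) * (cmod (g x))\<^sup>2)"
      using square_integrableD(2)[OF f] square_integrableD(2)[OF g]
        square_integrableD(2)[OF square_integrable_add[OF f g]] pt
      by (intro integral_mono) auto
    also have "\<dots> = (1 + b / a) * a\<^sup>2 + (1 + a / b) * b\<^sup>2"
      using square_integrableD(2)[OF f] square_integrableD(2)[OF g]
      by (simp add: a_def b_def L2_norm_sq)
    also have "\<dots> = (a + b)\<^sup>2"
      using 3 by (simp add: power2_eq_square field_simps)
    finally have "L2_norm (\<lambda>x. f x + g x) \<le> sqrt ((a + b)\<^sup>2)"
      unfolding L2_norm_def by (rule real_sqrt_le_mono)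
    thus ?thesis using 3 by (simp add: a_def b_def)
  qed
qed

lemma borel_measurable_truncate_ball [measurable]:
  assumes "f \<in> borel_measurable borel"
  shows "truncate_ball R f \<in> borel_measurable borel"
  unfolding truncate_ball_def[abs_def] using assms
  by (intro borel_measurable_scaleR borel_measurable_indicator) auto

lemma integrable_truncate_ball:
  assumes f: "square_integrable f"
  shows "integrable lborel (truncate_ball R f)"
proof -
  note [measurable] = square_integrableD(1)[OF f]
  show ?thesis
  proof (rule Bochner_Integration.integrable_bound)
    show "integrable lborel (\<lambda>x. indicator (cball 0 R) x + (cmod (f x))\<^sup>2)"
      using square_integrableD(2)[OF f]
      by (intro Bochner_Integration.integrable_add integrable_real_indicator
            emeasure_bounded_finite bounded_cball) auto
    show "truncate_ball R f \<in> borel_measurable lborel"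
      by simp
    have *: "cmod (f x) \<le> 1 + (cmod (f x))\<^sup>2" for x
      using sum_squares_bound[of 1 "cmod (f x)"] norm_ge_zero[of "f x"]
      unfolding power_one mult_1_right by linarith
    show "AE x in lborel. norm (truncate_ball R f x)
            \<le> norm (indicator (cball 0 R) x + (cmod (f x))\<^sup>2)"
      using * by (intro AE_I2) (auto simp: truncate_ball_def indicator_def)
  qed
qed

lemma integrable_cis_mult:
  assumes "integrable lborel h"
  shows "integrable lborel (\<lambda>x::'a::euclidean_space. cis (- (x \<bullet> \<xi>)) * h x)"
proof (rule Bochner_Integration.integrable_bound[OF assms])
  note [measurable] = borel_measurable_integrable[OF assms]
  have [measurable]: "(\<lambda>x::'a. cis (- (x \<bullet> \<xi>))) \<in> borel_measurable borel"
    by (intro borel_measurable_continuous_onI continuous_intros)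
  show "(\<lambda>x::'a. cis (- (x \<bullet> \<xi>)) * h x) \<in> borel_measurable lborel"
    by measurable
qed (auto simp: norm_mult)

lemma borel_measurable_fourier_L1:
  assumes "integrable lborel h"
  shows "fourier_L1 h \<in> borel_measurable (borel :: 'a::euclidean_space measure)"
proof -
  have [measurable]: "h \<in> borel_measurable borel"
    using borel_measurable_integrable[OF assms] by simp
  have [measurable]: "(\<lambda>p::'a \<times> 'a. cis (- (snd p \<bullet> fst p))) \<in> borel_measurable (borel \<Otimes>\<^sub>M lborel)"
  proof -
    have "(\<lambda>p::'a \<times> 'a. cis (- (snd p \<bullet> fst p))) \<in> borel_measurable borel"
      by (intro borel_measurable_continuous_onI continuous_intros)
    thus ?thesis
      by (simp add: borel_prod[symmetric] cong: measurable_cong_sets)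
  qed
  have "(\<lambda>\<xi>. LINT x|lborel. cis (- (x \<bullet> \<xi>)) * h x) \<in> borel_measurable (borel :: 'a measure)"
  proof (rule lborel.borel_measurable_lebesgue_integral)
    have "(\<lambda>p::'a \<times> 'a. cis (- (snd p \<bullet> fst p)) * h (snd p)) \<in> borel_measurable (borel \<Otimes>\<^sub>M lborel)"
      by measurable
    thus "(\<lambda>(\<xi>, x). cis (- (x \<bullet> \<xi>)) * h x) \<in> borel_measurable (borel \<Otimes>\<^sub>M lborel)"
      by (simp add: case_prod_unfold)
  qed
  thus ?thesis unfolding fourier_L1_def[abs_def] by measurable
qed

lemma fourier_L1_add:
  assumes "integrable lborel f" "integrable lborel g"
  shows "fourier_L1 (\<lambda>x. f x + g x) \<xi> = fourier_L1 f \<xi> + fourier_L1 g \<xi>"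
  using integrable_cis_mult[OF assms(1), of \<xi>] integrable_cis_mult[OF assms(2), of \<xi>]
  by (simp add: fourier_L1_def ring_distribs)

lemma fourier_L1_cmult: "fourier_L1 (\<lambda>x. c * f x) \<xi> = c * fourier_L1 f \<xi>"
proof -
  have "(LINT x|lborel. cis (- (x \<bullet> \<xi>)) * (c * f x)) =
        (LINT x|lborel. c * (cis (- (x \<bullet> \<xi>)) * f x))"
    by (simp add: algebra_simps)
  thus ?thesis by (simp add: fourier_L1_def)
qed

lemma has_fourier_square_integrable:
  assumes "has_fourier f g"
  shows "square_integrable f" "square_integrable g"
  using assms by (auto simp: has_fourier_def)

lemma has_fourier_borel_measurable:
  assumes "has_fourier f g"
  shows "f \<in> borel_measurable borel" "g \<in> borel_measurable borel"
    "fourier_L1 (truncate_ball R f) \<in> borel_measurable borel"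
  using has_fourier_square_integrable[OF assms] square_integrableD(1)
    borel_measurable_fourier_L1[OF integrable_truncate_ball] by blast+

lemma nn_integral_sq_add_le:
  assumes [measurable]: "u \<in> borel_measurable borel" "v \<in> borel_measurable borel"
  shows "(\<integral>\<^sup>+ \<xi>. ennreal ((cmod (u \<xi> + v \<xi>))\<^sup>2) \<partial>lborel) \<le>
     2 * (\<integral>\<^sup>+ \<xi>. ennreal ((cmod (u \<xi>))\<^sup>2) \<partial>lborel) + 2 * (\<integral>\<^sup>+ \<xi>. ennreal ((cmod (v \<xi>))\<^sup>2) \<partial>lborel)"
proof -
  have "(\<integral>\<^sup>+ \<xi>. ennreal ((cmod (u \<xi> + v \<xi>))\<^sup>2) \<partial>lborel) \<le>
     (\<integral>\<^sup>+ \<xi>. 2 * ennreal ((cmod (u \<xi>))\<^sup>2) + 2 * ennreal ((cmod (v \<xi>))\<^sup>2) \<partial>lborel)"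
  proof (intro nn_integral_mono)
    fix \<xi>
    have "ennreal ((cmod (u \<xi> + v \<xi>))\<^sup>2) \<le> ennreal (2 * (cmod (u \<xi>))\<^sup>2 + 2 * (cmod (v \<xi>))\<^sup>2)"
      by (intro ennreal_leI cmod_add_sq_le)
    thus "ennreal ((cmod (u \<xi> + v \<xi>))\<^sup>2) \<le> 2 * ennreal ((cmod (u \<xi>))\<^sup>2) + 2 * ennreal ((cmod (v \<xi>))\<^sup>2)"
      by (simp add: ennreal_mult)
  qed
  also have "\<dots> = 2 * (\<integral>\<^sup>+ \<xi>. ennreal ((cmod (u \<xi>))\<^sup>2) \<partial>lborel) + 2 * (\<integral>\<^sup>+ \<xi>. ennreal ((cmod (v \<xi>))\<^sup>2) \<partial>lborel)"
    by (simp add: nn_integral_add nn_integral_cmult)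
  finally show ?thesis .
qed

lemma tendsto_two_mult_add_0:
  fixes a b :: "real \<Rightarrow> ennreal"
  assumes "(a \<longlongrightarrow> 0) F" "(b \<longlongrightarrow> 0) F"
  shows "((\<lambda>R. 2 * a R + 2 * b R) \<longlongrightarrow> 0) F"
proof -
  have "((\<lambda>R. 2 * a R + 2 * b R) \<longlongrightarrow> 2 * 0 + 2 * 0) F"
    using assms by (intro tendsto_add tendsto_mult_ennreal tendsto_const) auto
  thus ?thesis by simp
qed

lemma has_fourier_unique:
  assumes "has_fourier f g" "has_fourier f h"
  shows "AE \<xi> in lborel. g \<xi> = h \<xi>"
proof -
  note [measurable] = has_fourier_borel_measurable[OF assms(1)] has_fourier_borel_measurable[OF assms(2)]
  let ?d = "\<lambda>u R. \<integral>\<^sup>+ \<xi>. ennreal ((cmod (fourier_L1 (truncate_ball R f) \<xi> - u \<xi>))\<^sup>2) \<partial>lborel"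
  let ?I = "\<integral>\<^sup>+ \<xi>. ennreal ((cmod (g \<xi> - h \<xi>))\<^sup>2) \<partial>lborel"
  have le: "?I \<le> 2 * ?d g R + 2 * ?d h R" for R
    using nn_integral_sq_add_le[of "\<lambda>\<xi>. - (fourier_L1 (truncate_ball R f) \<xi> - g \<xi>)"
        "\<lambda>\<xi>. fourier_L1 (truncate_ball R f) \<xi> - h \<xi>"]
    by (simp add: norm_minus_commute)
  have "((\<lambda>R. 2 * ?d g R + 2 * ?d h R) \<longlongrightarrow> 0) at_top"
    using assms by (intro tendsto_two_mult_add_0) (auto simp: has_fourier_def)
  hence "?I \<le> 0"
    using le by (intro tendsto_lowerbound[of _ 0 at_top]) auto
  hence "?I = 0" by simp
  hence "AE \<xi> in lborel. ennreal ((cmod (g \<xi> - h \<xi>))\<^sup>2) = 0"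
    by (subst (asm) nn_integral_0_iff_AE) auto
  thus ?thesis by eventually_elim simp
qed

lemma has_fourier_add:
  assumes "has_fourier f g" "has_fourier f' g'"
  shows "has_fourier (\<lambda>x. f x + f' x) (\<lambda>x. g x + g' x)"
proof -
  note [measurable] = has_fourier_borel_measurable[OF assms(1)] has_fourier_borel_measurable[OF assms(2)]
  note si = has_fourier_square_integrable[OF assms(1)] has_fourier_square_integrable[OF assms(2)]
  let ?F = "\<lambda>f R \<xi>. fourier_L1 (truncate_ball R f) \<xi>"
  let ?d = "\<lambda>f g R. \<integral>\<^sup>+ \<xi>. ennreal ((cmod (?F f R \<xi> - g \<xi>))\<^sup>2) \<partial>lborel"
  have F: "?F (\<lambda>x. f x + f' x) R \<xi> = ?F f R \<xi> + ?F f' R \<xi>" for R \<xi>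
  proof -
    have "truncate_ball R (\<lambda>x. f x + f' x) = (\<lambda>x. truncate_ball R f x + truncate_ball R f' x)"
      by (auto simp: truncate_ball_def scaleR_add_right)
    thus ?thesis
      using fourier_L1_add[OF integrable_truncate_ball integrable_truncate_ball] si by metis
  qed
  have le: "?d (\<lambda>x. f x + f' x) (\<lambda>x. g x + g' x) R \<le> 2 * ?d f g R + 2 * ?d f' g' R" for R
    using nn_integral_sq_add_le[of "\<lambda>\<xi>. ?F f R \<xi> - g \<xi>" "\<lambda>\<xi>. ?F f' R \<xi> - g' \<xi>"]
    by (simp add: F algebra_simps)
  have "((\<lambda>R. 2 * ?d f g R + 2 * ?d f' g' R) \<longlongrightarrow> 0) at_top"
    using assms by (intro tendsto_two_mult_add_0) (auto simp: has_fourier_def)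
  hence "(?d (\<lambda>x. f x + f' x) (\<lambda>x. g x + g' x) \<longlongrightarrow> 0) at_top"
    by (rule tendsto_sandwich[OF _ _ tendsto_const, rotated 2]) (use le in auto)
  thus ?thesis using si by (simp add: has_fourier_def square_integrable_add)
qed

lemma has_fourier_cmult:
  assumes "has_fourier f g"
  shows "has_fourier (\<lambda>x. c * f x) (\<lambda>x. c * g x)"
proof -
  note [measurable] = has_fourier_borel_measurable[OF assms]
  note si = has_fourier_square_integrable[OF assms]
  let ?F = "\<lambda>f R \<xi>. fourier_L1 (truncate_ball R f) \<xi>"
  let ?d = "\<lambda>f g R. \<integral>\<^sup>+ \<xi>. ennreal ((cmod (?F f R \<xi> - g \<xi>))\<^sup>2) \<partial>lborel"
  have F: "?F (\<lambda>x. c * f x) R \<xi> = c * ?F f R \<xi>" for R \<xi>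
  proof -
    have "truncate_ball R (\<lambda>x. c * f x) = (\<lambda>x. c * truncate_ball R f x)"
      by (auto simp: truncate_ball_def)
    thus ?thesis using fourier_L1_cmult by metis
  qed
  have eq: "?d (\<lambda>x. c * f x) (\<lambda>x. c * g x) R = ennreal ((cmod c)\<^sup>2) * ?d f g R" for R
    by (subst nn_integral_cmult[symmetric])
       (auto simp: F ennreal_mult[symmetric] power_mult_distrib[symmetric] norm_mult[symmetric]
         right_diff_distrib)
  have "((\<lambda>R. ennreal ((cmod c)\<^sup>2) * ?d f g R) \<longlongrightarrow> ennreal ((cmod c)\<^sup>2) * 0) at_top"
    using assms by (intro tendsto_mult_ennreal tendsto_const) (auto simp: has_fourier_def)
  thus ?thesis using si by (simp add: has_fourier_def square_integrable_cmult eq)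
qed

lemma has_fourier_zero: "has_fourier (\<lambda>_. 0) (\<lambda>_. 0)"
proof -
  have "fourier_L1 (truncate_ball R (\<lambda>_. 0)) \<xi> = 0" for R and \<xi> :: 'a
    by (simp add: fourier_L1_def truncate_ball_def)
  thus ?thesis by (simp add: has_fourier_def square_integrable_zero)
qed

lemma has_fourier_cong_AE:
  assumes "square_integrable f" "square_integrable f'" "AE x in lborel. f x = f' x"
  shows "has_fourier f = has_fourier f'"
proof -
  note [measurable] = square_integrableD(1)[OF assms(1)] square_integrableD(1)[OF assms(2)]
  have "fourier_L1 (truncate_ball R f) \<xi> = fourier_L1 (truncate_ball R f') \<xi>" for R \<xi>
  proof -
    have [measurable]: "(\<lambda>x. cis (- (x \<bullet> \<xi>))) \<in> borel_measurable borel"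
      by (intro borel_measurable_continuous_onI continuous_intros)
    have "(LINT x|lborel. cis (- (x \<bullet> \<xi>)) * truncate_ball R f x) =
          (LINT x|lborel. cis (- (x \<bullet> \<xi>)) * truncate_ball R f' x)"
    proof (rule integral_cong_AE)
      show "AE x in lborel. cis (- (x \<bullet> \<xi>)) * truncate_ball R f x =
                            cis (- (x \<bullet> \<xi>)) * truncate_ball R f' x"
        using assms(3) by eventually_elim (simp add: truncate_ball_def)
    qed simp_all
    thus ?thesis by (simp add: fourier_L1_def)
  qed
  thus ?thesis using assms by (simp add: has_fourier_def fun_eq_iff)
qed

lemma in_sobolev_square_integrable: "in_sobolev q f \<Longrightarrow> square_integrable f"
  by (auto simp: in_sobolev_def has_fourier_def)

lemma fourier_L2_cong_AE:
  assumes "square_integrable f" "square_integrable f'" "AE x in lborel. f x = f' x"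
  shows "fourier_L2 f = fourier_L2 f'"
  by (simp add: fourier_L2_def has_fourier_cong_AE[OF assms])

lemma borel_measurable_bessel_weight:
  assumes [measurable]: "g \<in> borel_measurable borel"
  shows "bessel_weight q g \<in> borel_measurable borel"
  unfolding bessel_weight_def[abs_def] by measurable

lemma bessel_weight_add: "bessel_weight q (\<lambda>x. f x + g x) = (\<lambda>x. bessel_weight q f x + bessel_weight q g x)"
  by (simp add: bessel_weight_def fun_eq_iff algebra_simps)

lemma bessel_weight_cmult: "bessel_weight q (\<lambda>x. c * f x) = (\<lambda>x. c * bessel_weight q f x)"
  by (simp add: bessel_weight_def fun_eq_iff)

lemma in_sobolev_fourier_L2:
  assumes "in_sobolev q f"
  shows "has_fourier f (fourier_L2 f)" "square_integrable (bessel_weight q (fourier_L2 f))"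
proof -
  obtain g where g: "has_fourier f g" "square_integrable (bessel_weight q g)"
    using assms by (auto simp: in_sobolev_def)
  show *: "has_fourier f (fourier_L2 f)"
    unfolding fourier_L2_def using g(1) by (metis someI)
  have "AE \<xi> in lborel. bessel_weight q (fourier_L2 f) \<xi> = bessel_weight q g \<xi>"
    using has_fourier_unique[OF * g(1)] by eventually_elim (simp add: bessel_weight_def)
  with g show "square_integrable (bessel_weight q (fourier_L2 f))"
    using square_integrable_cong_AE borel_measurable_bessel_weight
      has_fourier_borel_measurable(2)[OF *] has_fourier_borel_measurable(2)[OF g(1)] by blast
qed

lemma in_sobolev_zero: "in_sobolev q (\<lambda>_. 0)"
  unfolding in_sobolev_def using has_fourier_zero
  by (intro exI[of _ "\<lambda>_. 0"]) (simp add: bessel_weight_def[abs_def] square_integrable_zero)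

lemma in_sobolev_add:
  assumes "in_sobolev q f" "in_sobolev q g"
  shows "in_sobolev q (\<lambda>x. f x + g x)"
  unfolding in_sobolev_def
  using has_fourier_add[OF in_sobolev_fourier_L2(1)[OF assms(1)] in_sobolev_fourier_L2(1)[OF assms(2)]]
    square_integrable_add[OF in_sobolev_fourier_L2(2)[OF assms(1)] in_sobolev_fourier_L2(2)[OF assms(2)]]
  by (auto simp: bessel_weight_add intro!: exI[of _ "\<lambda>x. fourier_L2 f x + fourier_L2 g x"])

lemma in_sobolev_cmult:
  assumes "in_sobolev q f"
  shows "in_sobolev q (\<lambda>x. c * f x)"
  unfolding in_sobolev_def
  using has_fourier_cmult[OF in_sobolev_fourier_L2(1)[OF assms]]
    square_integrable_cmult[OF in_sobolev_fourier_L2(2)[OF assms]]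
  by (auto simp: bessel_weight_cmult intro!: exI[of _ "\<lambda>x. c * fourier_L2 f x"])

text \<open>By Plancherel the first summand is bounded by the second, so this norm is equivalent to the
  usual one \<open>\<parallel>(1 + \<bar>\<xi>\<bar>\<^sup>2)\<^bsup>q/2\<^esup> \<hat>f\<parallel>\<close>; it is kept because it makes definiteness immediate. Only the topology
  of \<open>H\<^sup>q\<close> matters below.\<close>

definition sobolev_norm :: "nat \<Rightarrow> ('a::euclidean_space \<Rightarrow> complex) \<Rightarrow> real" where
  "sobolev_norm q f = sqrt ((L2_norm f)\<^sup>2 + (L2_norm (bessel_weight q (fourier_L2 f)))\<^sup>2)"

lemma sobolev_norm_cong_AE:
  assumes "in_sobolev q f" "in_sobolev q f'" "AE x in lborel. f x = f' x"
  shows "sobolev_norm q f = sobolev_norm q f'"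
  using L2_norm_cong_AE[OF _ _ assms(3)] fourier_L2_cong_AE[OF _ _ assms(3)]
    in_sobolev_square_integrable[OF assms(1)] in_sobolev_square_integrable[OF assms(2)]
  by (simp add: sobolev_norm_def square_integrableD(1))

lemma L2_norm_bessel_fourier:
  assumes "in_sobolev q f" "has_fourier f g"
  shows "L2_norm (bessel_weight q (fourier_L2 f)) = L2_norm (bessel_weight q g)"
proof (rule L2_norm_cong_AE)
  note * = in_sobolev_fourier_L2(1)[OF assms(1)]
  show "AE \<xi> in lborel. bessel_weight q (fourier_L2 f) \<xi> = bessel_weight q g \<xi>"
    using has_fourier_unique[OF * assms(2)] by eventually_elim (simp add: bessel_weight_def)
qed (intro borel_measurable_bessel_weight has_fourier_borel_measurable(2)[OF assms(2)]
       has_fourier_borel_measurable(2)[OF in_sobolev_fourier_L2(1)[OF assms(1)]])+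

lemma sobolev_norm_triangle:
  assumes f: "in_sobolev q f" and g: "in_sobolev q g"
  shows "sobolev_norm q (\<lambda>x. f x + g x) \<le> sobolev_norm q f + sobolev_norm q g"
proof -
  let ?F = "bessel_weight q (fourier_L2 f)" and ?G = "bessel_weight q (fourier_L2 g)"
  have eq: "L2_norm (bessel_weight q (fourier_L2 (\<lambda>x. f x + g x))) = L2_norm (\<lambda>x. ?F x + ?G x)"
    using L2_norm_bessel_fourier[OF in_sobolev_add[OF f g]
        has_fourier_add[OF in_sobolev_fourier_L2(1)[OF f] in_sobolev_fourier_L2(1)[OF g]]]
    by (simp add: bessel_weight_add)
  have "sobolev_norm q (\<lambda>x. f x + g x) \<le>
      sqrt ((L2_norm f + L2_norm g)\<^sup>2 + (L2_norm ?F + L2_norm ?G)\<^sup>2)"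
    unfolding sobolev_norm_def eq
    by (intro real_sqrt_le_mono add_mono power_mono L2_norm_triangle L2_norm_nonneg
        in_sobolev_square_integrable[OF f] in_sobolev_square_integrable[OF g]
        in_sobolev_fourier_L2(2)[OF f] in_sobolev_fourier_L2(2)[OF g])
  also have "\<dots> \<le> sobolev_norm q f + sobolev_norm q g"
    unfolding sobolev_norm_def by (rule real_sqrt_sum_squares_triangle_ineq)
  finally show ?thesis .
qed

lemma sobolev_norm_cmult:
  assumes f: "in_sobolev q f"
  shows "sobolev_norm q (\<lambda>x. c * f x) = cmod c * sobolev_norm q f"
proof -
  let ?F = "bessel_weight q (fourier_L2 f)"
  have eq: "L2_norm (bessel_weight q (fourier_L2 (\<lambda>x. c * f x))) = L2_norm (\<lambda>x. c * ?F x)"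
    using L2_norm_bessel_fourier[OF in_sobolev_cmult[OF f] has_fourier_cmult[OF in_sobolev_fourier_L2(1)[OF f]]]
    by (simp add: bessel_weight_cmult)
  show ?thesis
    unfolding sobolev_norm_def eq L2_norm_cmult
    by (simp add: power_mult_distrib distrib_left[symmetric] real_sqrt_mult)
qed

lemma sobolev_norm_zero: "sobolev_norm q (\<lambda>_::'a::euclidean_space. 0) = 0"
  using sobolev_norm_cmult[OF in_sobolev_zero[where 'a = 'a], where c = 0] by simp

lemma sobolev_norm_eq_0_iff:
  assumes f: "in_sobolev q f"
  shows "sobolev_norm q f = 0 \<longleftrightarrow> (AE x in lborel. f x = 0)"
proof
  assume "sobolev_norm q f = 0"
  hence "L2_norm f = 0" by (simp add: sobolev_norm_def sum_power2_eq_zero_iff)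
  thus "AE x in lborel. f x = 0" using L2_norm_eq_0_iff in_sobolev_square_integrable[OF f] by blast
next
  assume "AE x in lborel. f x = 0"
  thus "sobolev_norm q f = 0"
    using sobolev_norm_cong_AE[OF f in_sobolev_zero] sobolev_norm_zero by metis
qed

text \<open>\<open>('q, 'n) sobolev\<close> is \<open>H\<^sup>q(\<real>\<^sup>N)\<close> for \<open>q = LENGTH('q)\<close> and \<open>N = CARD('n)\<close>, modulo equality
  almost everywhere. Every natural number is the length of a numeral type, so \<open>'q\<close> ranges over all
  \<open>q \<ge> 0\<close>.\<close>

definition sobolev_rel ::
    "'q::len0 itself \<Rightarrow> (real^'n \<Rightarrow> complex) \<Rightarrow> (real^'n \<Rightarrow> complex) \<Rightarrow> bool" where
  "sobolev_rel _ f g \<longleftrightarrow>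
     in_sobolev LENGTH('q) f \<and> in_sobolev LENGTH('q) g \<and> (AE x in lborel. f x = g x)"

lemma sobolev_rel_sym: "sobolev_rel q f g \<Longrightarrow> sobolev_rel q g f"
  by (auto simp: sobolev_rel_def eq_commute)

lemma sobolev_rel_trans: "sobolev_rel q f g \<Longrightarrow> sobolev_rel q g h \<Longrightarrow> sobolev_rel q f h"
  by (auto simp: sobolev_rel_def elim: AE_mp)

typedef (overloaded) ('q, 'n) sobolev =
  "{{g. sobolev_rel TYPE('q::len0) f g} | f :: real^'n::finite \<Rightarrow> complex. in_sobolev LENGTH('q) f}"
  morphisms sobolev_class sobolev_of_class
  using in_sobolev_zero by blast

definition abs_sobolev :: "(real^'n \<Rightarrow> complex) \<Rightarrow> ('q::len0, 'n::finite) sobolev" where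
  "abs_sobolev f = sobolev_of_class {g. sobolev_rel TYPE('q) f g}"

text \<open>An arbitrary representative of the class.\<close>

definition rep_sobolev :: "('q::len0, 'n::finite) sobolev \<Rightarrow> real^'n \<Rightarrow> complex" where
  "rep_sobolev u = (SOME f. f \<in> sobolev_class u)"

definition cr_sobolev :: "(real^'n \<Rightarrow> complex) \<Rightarrow> ('q::len0, 'n::finite) sobolev \<Rightarrow> bool" where
  "cr_sobolev f u \<longleftrightarrow> in_sobolev LENGTH('q) f \<and> abs_sobolev f = u"

lemma sobolev_rel_refl: "sobolev_rel TYPE('q::len0) f f \<longleftrightarrow> in_sobolev LENGTH('q) f"
  by (simp add: sobolev_rel_def)

lemma sobolev_class_eqI:
  assumes "sobolev_rel q f g"
  shows "{h. sobolev_rel q f h} = {h. sobolev_rel q g h}"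
  using assms sobolev_rel_sym sobolev_rel_trans by blast

lemma sobolev_class_abs:
  fixes f :: "real^'n::finite \<Rightarrow> complex"
  assumes "in_sobolev LENGTH('q::len0) f"
  shows "sobolev_class (abs_sobolev f :: ('q, 'n) sobolev) = {g. sobolev_rel TYPE('q) f g}"
  unfolding abs_sobolev_def using assms by (intro sobolev_of_class_inverse) auto

lemma Quotient_sobolev:
  "Quotient (sobolev_rel TYPE('q::len0)) (abs_sobolev :: _ \<Rightarrow> ('q, 'n::finite) sobolev)
     rep_sobolev cr_sobolev"
proof (rule QuotientI)
  have abs_eq: "(abs_sobolev f :: ('q, 'n) sobolev) = abs_sobolev g \<longleftrightarrow> sobolev_rel TYPE('q) f g"
    if "in_sobolev LENGTH('q) f" "in_sobolev LENGTH('q) g" for f g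
  proof
    assume "(abs_sobolev f :: ('q, 'n) sobolev) = abs_sobolev g"
    hence "{h. sobolev_rel TYPE('q) f h} = {h. sobolev_rel TYPE('q) g h}"
      using sobolev_class_abs that by metis
    thus "sobolev_rel TYPE('q) f g" using sobolev_rel_refl that by blast
  qed (simp add: abs_sobolev_def sobolev_class_eqI)
  have rep: "in_sobolev LENGTH('q) (rep_sobolev u) \<and> abs_sobolev (rep_sobolev u) = u"
    for u :: "('q, 'n) sobolev"
  proof -
    obtain f where f: "in_sobolev LENGTH('q) f" "sobolev_class u = {g. sobolev_rel TYPE('q) f g}"
      using sobolev_class[of u] by auto
    have "f \<in> sobolev_class u" using f by (simp add: sobolev_rel_refl)
    hence "rep_sobolev u \<in> sobolev_class u" unfolding rep_sobolev_def by (metis someI)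
    hence r: "sobolev_rel TYPE('q) f (rep_sobolev u)" using f by simp
    hence "(abs_sobolev (rep_sobolev u) :: ('q, 'n) sobolev) = sobolev_of_class (sobolev_class u)"
      using f(2) sobolev_class_eqI[OF r] by (simp add: abs_sobolev_def)
    thus ?thesis using r by (simp add: sobolev_class_inverse sobolev_rel_def)
  qed
  show "abs_sobolev (rep_sobolev u) = u" for u :: "('q, 'n) sobolev"
    using rep by blast
  show "sobolev_rel TYPE('q) (rep_sobolev u) (rep_sobolev u)" for u :: "('q, 'n) sobolev"
    using rep by (simp add: sobolev_rel_refl)
  show "sobolev_rel TYPE('q) f g \<longleftrightarrow> sobolev_rel TYPE('q) f f \<and> sobolev_rel TYPE('q) g g \<and>
          (abs_sobolev f :: ('q, 'n) sobolev) = abs_sobolev g" for f g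
    using abs_eq[of f g] by (auto simp: sobolev_rel_refl sobolev_rel_def)
  show "(cr_sobolev :: _ \<Rightarrow> ('q, 'n) sobolev \<Rightarrow> bool) =
          (\<lambda>f u. sobolev_rel TYPE('q) f f \<and> abs_sobolev f = u)"
    by (simp add: fun_eq_iff cr_sobolev_def sobolev_rel_refl)
qed

setup_lifting Quotient_sobolev

text \<open>Multiplication by complex scalars; the type classes only provide real ones.\<close>

lift_definition scaleC :: "complex \<Rightarrow> ('q::len0, 'n::finite) sobolev \<Rightarrow> ('q, 'n) sobolev"
    (infixr \<open>*\<^sub>C\<close> 75)
  is "\<lambda>c f x. c * f x"
  by (auto simp: sobolev_rel_def in_sobolev_cmult elim: eventually_mono)

instantiation sobolev :: (len0, finite) real_normed_vector
begin

lift_definition zero_sobolev :: "('a, 'b) sobolev" is "\<lambda>_. 0"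
  by (simp add: sobolev_rel_def in_sobolev_zero)

lift_definition plus_sobolev :: "('a, 'b) sobolev \<Rightarrow> ('a, 'b) sobolev \<Rightarrow> ('a, 'b) sobolev"
  is "\<lambda>f g x. f x + g x"
  by (auto simp: sobolev_rel_def in_sobolev_add)

definition uminus_sobolev :: "('a, 'b) sobolev \<Rightarrow> ('a, 'b) sobolev" where
  "uminus_sobolev f = (- 1) *\<^sub>C f"

definition minus_sobolev :: "('a, 'b) sobolev \<Rightarrow> ('a, 'b) sobolev \<Rightarrow> ('a, 'b) sobolev" where
  "minus_sobolev f g = f + - g"

definition scaleR_sobolev :: "real \<Rightarrow> ('a, 'b) sobolev \<Rightarrow> ('a, 'b) sobolev" where
  "scaleR_sobolev r f = complex_of_real r *\<^sub>C f"

lift_definition norm_sobolev :: "('a, 'b) sobolev \<Rightarrow> real" is "sobolev_norm LENGTH('a)"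
  by (auto simp: sobolev_rel_def sobolev_norm_cong_AE)

definition sgn_sobolev :: "('a, 'b) sobolev \<Rightarrow> ('a, 'b) sobolev" where
  "sgn_sobolev f = inverse (norm f) *\<^sub>R f"

definition dist_sobolev :: "('a, 'b) sobolev \<Rightarrow> ('a, 'b) sobolev \<Rightarrow> real" where
  "dist_sobolev f g = norm (f - g)"

definition uniformity_sobolev :: "(('a, 'b) sobolev \<times> ('a, 'b) sobolev) filter" where
  "uniformity_sobolev = (INF e\<in>{0<..}. principal {(f, g). dist f g < e})"

definition open_sobolev :: "('a, 'b) sobolev set \<Rightarrow> bool" where
  "open_sobolev U \<longleftrightarrow> (\<forall>f\<in>U. eventually (\<lambda>(f', g). f' = f \<longrightarrow> g \<in> U) uniformity)"

instance
proof
  fix f g h :: "('a, 'b) sobolev" and r s :: real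
  show "f + g + h = f + (g + h)"
    by transfer (auto simp: sobolev_rel_def in_sobolev_add add.assoc)
  show "f + g = g + f"
    by transfer (auto simp: sobolev_rel_def in_sobolev_add add.commute)
  show "0 + f = f"
    by transfer (auto simp: sobolev_rel_def)
  show "- f + f = 0"
    unfolding uminus_sobolev_def by transfer (auto simp: sobolev_rel_def in_sobolev_zero)
  show "f - g = f + - g"
    by (rule minus_sobolev_def)
  show "r *\<^sub>R (f + g) = r *\<^sub>R f + r *\<^sub>R g"
    unfolding scaleR_sobolev_def
    by transfer (auto simp: sobolev_rel_def in_sobolev_add in_sobolev_cmult distrib_left)
  show "(r + s) *\<^sub>R f = r *\<^sub>R f + s *\<^sub>R f"
    unfolding scaleR_sobolev_def
    by transfer (auto simp: sobolev_rel_def in_sobolev_add in_sobolev_cmult distrib_right)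
  show "r *\<^sub>R s *\<^sub>R f = (r * s) *\<^sub>R f"
    unfolding scaleR_sobolev_def
    by transfer (auto simp: sobolev_rel_def in_sobolev_cmult mult.assoc)
  show "1 *\<^sub>R f = f"
    unfolding scaleR_sobolev_def by transfer (auto simp: sobolev_rel_def)
  show "dist f g = norm (f - g)"
    by (rule dist_sobolev_def)
  show "sgn f = inverse (norm f) *\<^sub>R f"
    by (rule sgn_sobolev_def)
  show "uniformity = (INF e\<in>{0<..}. principal {(f, g :: ('a, 'b) sobolev). dist f g < e})"
    by (rule uniformity_sobolev_def)
  show "open U \<longleftrightarrow> (\<forall>f\<in>U. eventually (\<lambda>(f', g). f' = f \<longrightarrow> g \<in> U) uniformity)"
    for U :: "('a, 'b) sobolev set"
    by (rule open_sobolev_def)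
  show "norm f = 0 \<longleftrightarrow> f = 0"
    by transfer (auto simp: sobolev_rel_def in_sobolev_zero sobolev_norm_eq_0_iff)
  show "norm (f + g) \<le> norm f + norm g"
    by transfer (auto simp: sobolev_rel_def sobolev_norm_triangle)
  show "norm (r *\<^sub>R f) = \<bar>r\<bar> * norm f"
    unfolding scaleR_sobolev_def
    by transfer (auto simp: sobolev_rel_def sobolev_norm_cmult)
qed

end


section \<open>The nonlinear Schroedinger equation\<close>

text \<open>The propagator \<open>e\<^bsup>it\<Delta>\<^esup>\<close> as the Fourier multiplier with symbol \<open>e\<^bsup>-it\<bar>\<xi>\<bar>\<^sup>2\<^esup>\<close>.\<close>

definition schroedinger_group ::
    "real \<Rightarrow> ('q::len0, 'n::finite) sobolev \<Rightarrow> ('q, 'n) sobolev" where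
  "schroedinger_group t u =
     (THE v. has_fourier (rep_sobolev v)
        (\<lambda>\<xi>. cis (- (t * (norm \<xi>)\<^sup>2)) * fourier_L2 (rep_sobolev u) \<xi>))"

definition power_nonlinearity :: "nat \<Rightarrow> complex \<Rightarrow> complex" where
  "power_nonlinearity \<eta> z = complex_of_real (cmod z ^ (2 * \<eta>)) * z"

definition nonlinearity :: "complex \<Rightarrow> nat \<Rightarrow> complex \<Rightarrow> complex" where
  "nonlinearity lam \<eta> z = lam * power_nonlinearity \<eta> z"

text \<open>Superposition \<open>u \<mapsto> \<bar>u\<bar>\<^bsup>2\<eta>\<^esup> u\<close>. The result is an element of \<open>H\<^sup>q\<close> only if
  \<open>in_sobolev\<close> holds of the composed function, which \<open>mild_solution\<close> requires explicitly.\<close>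

definition sobolev_nonlinearity ::
    "nat \<Rightarrow> ('q::len0, 'n::finite) sobolev \<Rightarrow> ('q, 'n) sobolev" where
  "sobolev_nonlinearity \<eta> u = abs_sobolev (\<lambda>x. power_nonlinearity \<eta> (rep_sobolev u x))"

text \<open>The Duhamel integrand is a continuous \<open>H\<^sup>q\<close>-valued function of \<open>\<nu>\<close>, so its Henstock-Kurzweil
  integral in \<open>H\<^sup>q\<close> is its Bochner integral; existence is part of the definition.\<close>

definition mild_solution ::
    "complex \<Rightarrow> nat \<Rightarrow> ('q::len0, 'n::finite) sobolev \<Rightarrow> real \<Rightarrow> (real \<Rightarrow> ('q, 'n) sobolev) \<Rightarrow> bool" where
  "mild_solution lam \<eta> \<psi>0 T \<psi> \<longleftrightarrow>
     continuous_on {0..T} \<psi> \<and>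
     (\<forall>t\<in>{0..T}. in_sobolev LENGTH('q) (\<lambda>x. power_nonlinearity \<eta> (rep_sobolev (\<psi> t) x))) \<and>
     (\<forall>t\<in>{0..T}. \<exists>I.
        ((\<lambda>\<nu>. schroedinger_group (t - \<nu>) (sobolev_nonlinearity \<eta> (\<psi> \<nu>))) has_integral I) {0..t} \<and>
        \<psi> t = schroedinger_group t \<psi>0 - (\<i> * lam) *\<^sub>C I)"

definition in_Linfty :: "real \<Rightarrow> (real \<Rightarrow> 'b::real_normed_vector) \<Rightarrow> bool" where
  "in_Linfty T \<psi> \<longleftrightarrow> set_borel_measurable lborel {0<..<T} \<psi> \<and>
     (\<exists>M. AE t in lborel. t \<in> {0<..<T} \<longrightarrow> norm (\<psi> t) \<le> M)"

text \<open>Functions of time are total here, so uniqueness is understood on \<open>[0,T]\<close>.\<close>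

definition unique_mild_solution ::
    "complex \<Rightarrow> nat \<Rightarrow> ('q::len0, 'n::finite) sobolev \<Rightarrow> real \<Rightarrow> (real \<Rightarrow> ('q, 'n) sobolev) \<Rightarrow> bool" where
  "unique_mild_solution lam \<eta> \<psi>0 T \<psi> \<longleftrightarrow>
     mild_solution lam \<eta> \<psi>0 T \<psi> \<and> in_Linfty T \<psi> \<and>
     (\<forall>\<phi>. mild_solution lam \<eta> \<psi>0 T \<phi> \<and> in_Linfty T \<phi> \<longrightarrow> (\<forall>t\<in>{0..T}. \<phi> t = \<psi> t))"

definition is_continuation ::
    "complex \<Rightarrow> nat \<Rightarrow> ('q::len0, 'n::finite) sobolev \<Rightarrow> real \<Rightarrow> (real \<Rightarrow> ('q, 'n) sobolev) \<Rightarrow>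
     real \<Rightarrow> (real \<Rightarrow> ('q, 'n) sobolev) \<Rightarrow> bool" where
  "is_continuation lam \<eta> \<psi>0 T \<psi> T' \<psi>' \<longleftrightarrow>
     T < T' \<and> in_Linfty T' \<psi>' \<and> mild_solution lam \<eta> \<psi>0 T' \<psi>' \<and> (\<forall>t\<in>{0..T}. \<psi>' t = \<psi> t)"

text \<open>Iterated derivative of a complex-valued function of a real variable.\<close>

definition higher_deriv_real :: "nat \<Rightarrow> (real \<Rightarrow> complex) \<Rightarrow> real \<Rightarrow> complex" where
  "higher_deriv_real k = (\<lambda>h s. vector_derivative h (at s)) ^^ k"

end

(*
  For q > N/2 the functions with weighted square-integrable Fourier transform have an integrable
  transform, and the weight (1 + |xi|^2)^(q/2) is subadditive up to a constant; by Young's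
  inequality H^q is therefore a Banach algebra, up to a constant. As
  |u|^(2 eta) u = (u cnj(u))^eta u is a polynomial in u and its conjugate, it is Lipschitz on
  every ball of H^q. The propagator S(t) is a strongly continuous group of isometries of H^q, so
  v(t) = S(-t) psi(t) turns Duhamel's formula into an ordinary integral equation in H^q with a
  continuous, locally Lipschitz right-hand side. Banach's fixed point theorem solves it on an
  interval starting at any time from any value, solutions are unique, and solving from the end
  point of a given solution continues it.
*)

theory Submission
  imports Defs "HOL-Probability.Characteristic_Functions"
begin

text \<open>The transform on L2 is given as a limit of integrals over growing balls,
  \<open>fourier_L2\<close> picks one such limit, and \<open>schroedinger_group\<close> is a
  definite description. Hence Plancherel's isometry, inversion and surjectivity must be available
  before H^q is known to be complete and the propagator to be well defined. The isometry is proved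
  first on the intersection of L1 and L2, by Gaussian regularisation, and carried over to L2 by
  truncation. Transforms are determined only almost everywhere, so most statements speak of any
  \<open>F\<close> with \<open>has_fourier f F\<close> instead of a chosen one. The condition q >
  N/2 enters through one fact, the square integrability of (1 + |xi|^2)^(-q/2). Duhamel's kernel
  depends on t - nu, so a solution on [0,T] and one started at T cannot simply be added up. In the
  interaction picture the integrand depends on nu alone, and integrals over adjacent intervals
  concatenate. The isometry of the propagator makes all Lipschitz constants independent of t. The
  propagator is only strongly continuous, and joint continuity along curves again comes from the
  isometry.\<close>

section \<open>The space \<open>L\<^sup>2\<close>\<close>

lemma nn_integral_square_le:
  fixes h A B :: "'a \<Rightarrow> ennreal"
  assumes "sigma_finite_measure M"
    and [measurable]: "h \<in> borel_measurable M" "A \<in> borel_measurable M" "B \<in> borel_measurable M"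
    and le: "\<And>x y. 2 * (h x * h y) \<le> A x * B y + A y * B x"
  shows "(\<integral>\<^sup>+x. h x \<partial>M)\<^sup>2 \<le> (\<integral>\<^sup>+x. A x \<partial>M) * (\<integral>\<^sup>+x. B x \<partial>M)"
proof -
  interpret sigma_finite_measure M by fact
  have "2 * (\<integral>\<^sup>+x. h x \<partial>M)\<^sup>2 = (\<integral>\<^sup>+x. \<integral>\<^sup>+y. 2 * (h x * h y) \<partial>M \<partial>M)"
    by (simp add: nn_integral_cmult nn_integral_multc power2_eq_square)
  also have "\<dots> \<le> (\<integral>\<^sup>+x. \<integral>\<^sup>+y. A x * B y + A y * B x \<partial>M \<partial>M)"
    by (intro nn_integral_mono le)
  also have "\<dots> = 2 * ((\<integral>\<^sup>+x. A x \<partial>M) * (\<integral>\<^sup>+x. B x \<partial>M))"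
    by (simp add: nn_integral_add nn_integral_cmult nn_integral_multc flip: mult_2)
  finally show ?thesis
    by (subst (asm) ennreal_mult_le_mult_iff) auto
qed

lemma ennreal_two_mult_le: "2 * (a * b) \<le> a\<^sup>2 + (b::ennreal)\<^sup>2"
proof (cases "a = top \<or> b = top")
  case True thus ?thesis by (auto simp: ennreal_top_mult ennreal_mult_top power2_eq_square)
next
  case False
  then obtain x y where "a = ennreal x" "x \<ge> 0" "b = ennreal y" "y \<ge> 0"
    by (metis ennreal_cases)
  moreover have "ennreal (2 * (x * y)) \<le> ennreal (x\<^sup>2 + y\<^sup>2)"
    using sum_squares_bound[of x y] by (intro ennreal_leI) simp
  ultimately show ?thesis
    by (simp add: ennreal_mult ennreal_power)
qed

text \<open>The pointwise inequality is (f x * g y - f y * g x)^2 >= 0, written without subtraction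
  because the values lie in \<open>ennreal\<close>.\<close>

lemma nn_integral_Cauchy_Schwarz:
  fixes f g :: "'a \<Rightarrow> ennreal"
  assumes "sigma_finite_measure M"
    and [measurable]: "f \<in> borel_measurable M" "g \<in> borel_measurable M"
  shows "(\<integral>\<^sup>+x. f x * g x \<partial>M)\<^sup>2 \<le> (\<integral>\<^sup>+x. (f x)\<^sup>2 \<partial>M) * (\<integral>\<^sup>+x. (g x)\<^sup>2 \<partial>M)"
proof (rule nn_integral_square_le)
  show "2 * (f x * g x * (f y * g y)) \<le> (f x)\<^sup>2 * (g y)\<^sup>2 + (f y)\<^sup>2 * (g x)\<^sup>2" for x y
    using ennreal_two_mult_le[of "f x * g y" "f y * g x"] by (simp add: power_mult_distrib ac_simps)
qed (use assms in auto)

text \<open>Cauchy-Schwarz for f against 1 in the measure with density \<open>w\<close>. Young's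
  inequality needs this form, with the L1 factor in the role of \<open>w\<close>.\<close>

lemma nn_integral_Cauchy_Schwarz_weighted:
  fixes f w :: "'a \<Rightarrow> ennreal"
  assumes "sigma_finite_measure M"
    and [measurable]: "f \<in> borel_measurable M" "w \<in> borel_measurable M"
  shows "(\<integral>\<^sup>+x. f x * w x \<partial>M)\<^sup>2 \<le> (\<integral>\<^sup>+x. (f x)\<^sup>2 * w x \<partial>M) * (\<integral>\<^sup>+x. w x \<partial>M)"
proof (rule nn_integral_square_le)
  fix x y
  have "2 * (f x * f y) * (w x * w y) \<le> ((f x)\<^sup>2 + (f y)\<^sup>2) * (w x * w y)"
    by (intro mult_right_mono ennreal_two_mult_le) simp
  thus "2 * (f x * w x * (f y * w y)) \<le> (f x)\<^sup>2 * w x * w y + (f y)\<^sup>2 * w y * w x"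
    by (simp add: distrib_right distrib_left ac_simps)
qed (use assms in auto)

lemma ennreal_power2_le_imp_le: "a\<^sup>2 \<le> b\<^sup>2 \<Longrightarrow> a \<le> (b::ennreal)"
  by (cases a; cases b)
     (auto simp: ennreal_power power_eq_top_ennreal abs_le_square_iff top_unique power_mono_iff)

text \<open>\<open>L2_norm\<close> takes the default value 0 on measurable functions that are not
  square integrable, so it cannot detect membership in L2. This \<open>ennreal\<close> version
  can.\<close>

definition L2_sq :: "('a::euclidean_space \<Rightarrow> complex) \<Rightarrow> ennreal" where
  "L2_sq f = (\<integral>\<^sup>+x. ennreal ((cmod (f x))\<^sup>2) \<partial>lborel)"

lemma square_integrable_iff:
  "square_integrable f \<longleftrightarrow> f \<in> borel_measurable borel \<and> L2_sq f < \<infinity>"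
  by (auto simp: square_integrable_def L2_sq_def integrable_iff_bounded)

lemma L2_sq_eq:
  assumes "square_integrable f"
  shows "L2_sq f = ennreal ((L2_norm f)\<^sup>2)"
  unfolding L2_sq_def L2_norm_sq
  using square_integrableD[OF assms] by (intro nn_integral_eq_integral) auto

lemma square_integrable_diff:
  assumes "square_integrable f" "square_integrable g"
  shows "square_integrable (\<lambda>x. f x - g x)"
  using square_integrable_add[OF assms(1) square_integrable_cmult[OF assms(2), of "-1"]] by simp

lemma L2_norm_minus_commute: "L2_norm (\<lambda>x. f x - g x) = L2_norm (\<lambda>x. g x - f x)"
  by (simp add: L2_norm_def norm_minus_commute)

lemma L2_norm_diff_triangle:
  assumes "square_integrable f" "square_integrable g" "square_integrable h"
  shows "L2_norm (\<lambda>x. f x - h x) \<le> L2_norm (\<lambda>x. f x - g x) + L2_norm (\<lambda>x. g x - h x)"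
  using L2_norm_triangle[OF square_integrable_diff[OF assms(1,2)] square_integrable_diff[OF assms(2,3)]]
  by simp

lemma abs_L2_norm_diff_le:
  assumes "square_integrable f" "square_integrable g"
  shows "\<bar>L2_norm f - L2_norm g\<bar> \<le> L2_norm (\<lambda>x. f x - g x)"
  using L2_norm_diff_triangle[OF assms square_integrable_zero]
    L2_norm_diff_triangle[OF assms(2,1) square_integrable_zero] L2_norm_minus_commute[of f g]
  by simp

lemma integrable_mult_square_integrable:
  assumes f: "square_integrable f" and g: "square_integrable g"
  shows "integrable lborel (\<lambda>x. f x * g x)"
    and "(LINT x|lborel. cmod (f x * g x)) \<le> L2_norm f * L2_norm g"
proof -
  note [measurable] = square_integrableD(1)[OF f] square_integrableD(1)[OF g]
  have "(\<integral>\<^sup>+x. ennreal (cmod (f x)) * ennreal (cmod (g x)) \<partial>lborel)\<^sup>2 \<le> L2_sq f * L2_sq g"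
    unfolding L2_sq_def
    using nn_integral_Cauchy_Schwarz[OF lborel.sigma_finite_measure_axioms,
        of "\<lambda>x. ennreal (cmod (f x))" "\<lambda>x. ennreal (cmod (g x))"]
    by (simp add: ennreal_power)
  also have "\<dots> = (ennreal (L2_norm f * L2_norm g))\<^sup>2"
    by (simp add: L2_sq_eq f g ennreal_mult' power_mult_distrib ennreal_power)
  also have "(\<lambda>x. ennreal (cmod (f x)) * ennreal (cmod (g x))) = (\<lambda>x. ennreal (cmod (f x * g x)))"
    by (simp add: norm_mult ennreal_mult)
  finally have **: "(\<integral>\<^sup>+x. ennreal (cmod (f x * g x)) \<partial>lborel) \<le> ennreal (L2_norm f * L2_norm g)"
    by (rule ennreal_power2_le_imp_le)
  show "integrable lborel (\<lambda>x. f x * g x)"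
    using ** by (auto simp: integrable_iff_bounded intro: le_less_trans)
  thus "(LINT x|lborel. cmod (f x * g x)) \<le> L2_norm f * L2_norm g"
    using ** by (subst integral_eq_nn_integral) (auto simp: enn2real_leI)
qed

lemma norm_integral_mult_le:
  assumes "square_integrable f" "square_integrable g"
  shows "cmod (LINT x|lborel. f x * g x) \<le> L2_norm f * L2_norm g"
  using integrable_mult_square_integrable[OF assms]
    integral_norm_bound[of lborel "\<lambda>x. f x * g x"] by linarith

lemma tendsto_L2_norm:
  assumes "\<And>n. square_integrable (f n)" "square_integrable g"
    and "((\<lambda>n. L2_norm (\<lambda>x. f n x - g x)) \<longlongrightarrow> 0) F"
  shows "((\<lambda>n. L2_norm (f n)) \<longlongrightarrow> L2_norm g) F"
proof -
  have "((\<lambda>n. L2_norm (f n) - L2_norm g) \<longlongrightarrow> 0) F"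
    using assms(3) by (rule Lim_null_comparison[rotated]) (auto simp: abs_L2_norm_diff_le assms)
  thus ?thesis by (simp add: LIM_zero_iff)
qed

text \<open>Both factors vary. Since \<open>L2_norm (g n)\<close> converges, it does no harm as the
  factor in front of the small norm of \<open>f n - f'\<close>.\<close>

lemma tendsto_integral_mult:
  assumes f: "\<And>n. square_integrable (f n)" and f': "square_integrable f'"
    and g: "\<And>n. square_integrable (g n)" and g': "square_integrable g'"
    and lim: "((\<lambda>n. L2_norm (\<lambda>x. f n x - f' x)) \<longlongrightarrow> 0) F" "((\<lambda>n. L2_norm (\<lambda>x. g n x - g' x)) \<longlongrightarrow> 0) F"
  shows "((\<lambda>n. LINT x|lborel. f n x * g n x) \<longlongrightarrow> (LINT x|lborel. f' x * g' x)) F"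
proof -
  have le: "cmod ((LINT x|lborel. f n x * g n x) - (LINT x|lborel. f' x * g' x)) \<le>
     L2_norm (\<lambda>x. f n x - f' x) * L2_norm (g n) + L2_norm f' * L2_norm (\<lambda>x. g n x - g' x)" for n
  proof -
    note d = square_integrable_diff[OF f f', of n] square_integrable_diff[OF g g', of n]
    note i = integrable_mult_square_integrable(1)
    have "(LINT x|lborel. f n x * g n x) - (LINT x|lborel. f' x * g' x) =
       (LINT x|lborel. (f n x - f' x) * g n x) + (LINT x|lborel. f' x * (g n x - g' x))"
      using i[OF f g, of n n] i[OF f' g'] i[OF f' g, of n]
      by (simp add: left_diff_distrib right_diff_distrib)
    hence "cmod ((LINT x|lborel. f n x * g n x) - (LINT x|lborel. f' x * g' x)) \<le>
       cmod (LINT x|lborel. (f n x - f' x) * g n x) + cmod (LINT x|lborel. f' x * (g n x - g' x))"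
      by (simp only: norm_triangle_ineq)
    also have "\<dots> \<le> L2_norm (\<lambda>x. f n x - f' x) * L2_norm (g n) + L2_norm f' * L2_norm (\<lambda>x. g n x - g' x)"
      by (intro add_mono norm_integral_mult_le d f' g)
    finally show ?thesis .
  qed
  have "((\<lambda>n. L2_norm (\<lambda>x. f n x - f' x) * L2_norm (g n) + L2_norm f' * L2_norm (\<lambda>x. g n x - g' x)) \<longlongrightarrow>
      0 * L2_norm g' + L2_norm f' * 0) F"
    using lim by (intro tendsto_intros tendsto_L2_norm[OF g g'])
  hence "((\<lambda>n. (LINT x|lborel. f n x * g n x) - (LINT x|lborel. f' x * g' x)) \<longlongrightarrow> 0) F"
    by (intro Lim_null_comparison[OF always_eventually[OF allI[OF le]]]) simp
  thus ?thesis by (simp add: LIM_zero_iff)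
qed

lemma L2_dominated_convergence:
  fixes d :: "nat \<Rightarrow> 'a::euclidean_space \<Rightarrow> complex"
  assumes [measurable]: "\<And>n. d n \<in> borel_measurable borel" "w \<in> borel_measurable borel"
    and w: "integrable lborel (\<lambda>x. (w x)\<^sup>2)"
    and le: "\<And>n. AE x in lborel. cmod (d n x) \<le> w x"
    and lim: "AE x in lborel. (\<lambda>n. d n x) \<longlonglongrightarrow> 0"
  shows "square_integrable (d n)" "(\<lambda>n. L2_norm (d n)) \<longlonglongrightarrow> 0"
proof -
  have le': "AE x in lborel. norm ((cmod (d n x))\<^sup>2) \<le> (w x)\<^sup>2" for n
    using le[of n] by eventually_elim (auto intro: power_mono)
  have lim': "AE x in lborel. (\<lambda>n. (cmod (d n x))\<^sup>2) \<longlonglongrightarrow> 0"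
    using lim by eventually_elim (auto intro!: tendsto_eq_intros)
  have "(\<lambda>n. LINT x|lborel. (cmod (d n x))\<^sup>2) \<longlonglongrightarrow> (LINT x|(lborel :: 'a measure). 0)"
    by (rule integral_dominated_convergence[where w = "\<lambda>x. (w x)\<^sup>2"])
       (use w le' lim' in auto)
  hence "(\<lambda>n. sqrt (LINT x|lborel. (cmod (d n x))\<^sup>2)) \<longlonglongrightarrow> sqrt 0"
    by (intro tendsto_intros) simp
  thus "(\<lambda>n. L2_norm (d n)) \<longlonglongrightarrow> 0" by (simp add: L2_norm_def)
  have "integrable lborel (\<lambda>x. (cmod (d n x))\<^sup>2)"
    by (rule Bochner_Integration.integrable_bound[OF w]) (use le' in auto)
  thus "square_integrable (d n)"
    by (simp add: square_integrable_def)
qed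

lemma square_integrable_bound:
  fixes f :: "'a::euclidean_space \<Rightarrow> complex"
  assumes [measurable]: "f \<in> borel_measurable borel" and g: "square_integrable g"
    and "AE x in lborel. cmod (f x) \<le> cmod (g x)"
  shows "square_integrable f"
proof -
  note [measurable] = square_integrableD(1)[OF g]
  have "integrable lborel (\<lambda>x. (cmod (f x))\<^sup>2)"
  proof (rule Bochner_Integration.integrable_bound[OF square_integrableD(2)[OF g]])
    show "AE x in lborel. norm ((cmod (f x))\<^sup>2) \<le> norm ((cmod (g x))\<^sup>2)"
      using assms(3) by eventually_elim (auto intro: power_mono)
  qed measurable
  thus ?thesis by (simp add: square_integrable_def)
qed

lemma L2_norm_mono:
  fixes f :: "'a::euclidean_space \<Rightarrow> complex"
  assumes [measurable]: "f \<in> borel_measurable borel" and g: "square_integrable g"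
    and le: "AE x in lborel. cmod (f x) \<le> cmod (g x)"
  shows "L2_norm f \<le> L2_norm g"
  unfolding L2_norm_def
proof (intro real_sqrt_le_mono integral_mono_AE)
  show "AE x in lborel. (cmod (f x))\<^sup>2 \<le> (cmod (g x))\<^sup>2"
    using le by eventually_elim (auto intro: power_mono)
qed (use square_integrableD square_integrable_bound[OF assms] g in auto)

lemma square_integrable_truncate_ball:
  assumes "square_integrable f"
  shows "square_integrable (truncate_ball R f)"
  by (rule square_integrable_bound[OF _ assms])
     (use square_integrableD[OF assms] in \<open>auto simp: truncate_ball_def indicator_def\<close>)

section \<open>Completeness of L2\<close>

lemma summable_of_nn_suminf_finite:
  fixes a :: "nat \<Rightarrow> real"
  assumes "\<And>k. a k \<ge> 0" "(\<Sum>k. ennreal (a k)) < \<infinity>"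
  shows "summable a"
  using assms by (intro summable_suminf_not_top) auto

text \<open>With a = 2^k this bounds |d k| by 2^k |d k|^2 + 2^(-k), which turns the square
  summability obtained from L2 norms into absolute convergence at a point.\<close>

lemma le_mult_square_add_inverse:
  fixes a c :: real
  assumes "a > 0" "c \<ge> 0"
  shows "c \<le> a * c\<^sup>2 + inverse a"
proof -
  have "0 \<le> (a * c - 1)\<^sup>2 * inverse a + c"
    using assms by simp
  also have "(a * c - 1)\<^sup>2 * inverse a + c = a * c\<^sup>2 + inverse a - c"
    using assms by (simp add: power2_eq_square field_simps)
  finally show ?thesis by simp
qed

text \<open>Along a subsequence \<open>f \<circ> r\<close> with increments \<open>d k\<close> of norm at most \<open>2 ^ (- k)\<close>, the series of
  \<open>2 ^ k * \<bar>d k\<bar>\<^sup>2\<close> converges almost everywhere, hence so does the series of \<open>d k\<close>; Fatou's lemma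
  does the rest.\<close>

theorem L2_complete:
  fixes f :: "nat \<Rightarrow> 'a::euclidean_space \<Rightarrow> complex"
  assumes f: "\<And>n. square_integrable (f n)"
    and Cauchy: "\<And>e. e > 0 \<Longrightarrow> \<exists>M. \<forall>m\<ge>M. \<forall>n\<ge>M. L2_norm (\<lambda>x. f m x - f n x) < e"
  obtains g where "square_integrable g" "(\<lambda>n. L2_norm (\<lambda>x. f n x - g x)) \<longlonglongrightarrow> 0"
proof -
  note [measurable] = square_integrableD(1)[OF f]
  note fd = square_integrable_diff[OF f f]
  have "\<exists>M. \<forall>m\<ge>M. \<forall>n\<ge>M. L2_norm (\<lambda>x. f m x - f n x) < (1/2)^k" for k :: nat
    using Cauchy[of "(1/2)^k"] by simp
  then obtain M where M: "\<And>k m n. m \<ge> M k \<Longrightarrow> n \<ge> M k \<Longrightarrow> L2_norm (\<lambda>x. f m x - f n x) < (1/2)^k"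
    by metis
  \<comment> \<open>The sum puts both \<open>r k\<close> and \<open>r (Suc k)\<close> above
    \<open>M k\<close>, so that the increment between them has norm below 2^(-k). The summand k
    makes \<open>r\<close> tend to infinity.\<close>
  define r where "r k = k + (\<Sum>j\<le>k. M j)" for k
  have r_ge: "r k \<ge> M k" "r (Suc k) \<ge> M k" "r k \<ge> k" for k
    using member_le_sum[of k "{..k}" M] member_le_sum[of k "{..Suc k}" M] by (auto simp: r_def)
  define d where "d k x = f (r (Suc k)) x - f (r k) x" for k x
  have [measurable]: "d k \<in> borel_measurable borel" for k
    unfolding d_def[abs_def] by measurable
  have "(\<integral>\<^sup>+x. (\<Sum>k. ennreal (2^k * (cmod (d k x))\<^sup>2)) \<partial>lborel) = (\<Sum>k. ennreal (2^k) * L2_sq (d k))"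
    unfolding L2_sq_def by (subst nn_integral_suminf) (auto simp: ennreal_mult nn_integral_cmult)
  also have "\<dots> \<le> (\<Sum>k. ennreal ((1/2)^k))"
  proof (intro suminf_le)
    fix k
    have "L2_norm (d k) \<le> (1/2)^k"
      using M[OF r_ge(2,1), of k] by (simp add: d_def[abs_def])
    hence "(L2_norm (d k))\<^sup>2 \<le> ((1/2)^k)\<^sup>2"
      by (intro power_mono) auto
    hence "2^k * (L2_norm (d k))\<^sup>2 \<le> 2^k * ((1/2)^k)\<^sup>2"
      by (intro mult_left_mono) auto
    also have "\<dots> = (2 * (1/2) * (1/2)::real)^k"
      unfolding power2_eq_square power_mult_distrib by (simp only: mult.assoc)
    also have "\<dots> = (1/2)^k" by simp
    finally show "ennreal (2^k) * L2_sq (d k) \<le> ennreal ((1/2)^k)"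
      using fd by (simp add: L2_sq_eq d_def[abs_def] ennreal_mult[symmetric])
  qed auto
  also have "\<dots> = ennreal (\<Sum>k. (1/2)^k)"
    by (intro suminf_ennreal2) auto
  also have "\<dots> < \<infinity>" by simp
  finally have "AE x in lborel. (\<Sum>k. ennreal (2^k * (cmod (d k x))\<^sup>2)) \<noteq> \<infinity>"
    by (intro nn_integral_PInf_AE) auto
  hence conv: "AE x in lborel. convergent (\<lambda>k. f (r k) x)"
  proof eventually_elim
    case (elim x)
    hence s: "summable (\<lambda>k. 2^k * (cmod (d k x))\<^sup>2)"
      by (intro summable_of_nn_suminf_finite) (auto simp: less_top[symmetric])
    have "summable (\<lambda>k. d k x)"
    proof (rule summable_comparison_test')
      show "summable (\<lambda>k. 2^k * (cmod (d k x))\<^sup>2 + (1/2)^k)"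
        by (intro summable_add s) auto
      show "norm (d k x) \<le> 2^k * (cmod (d k x))\<^sup>2 + (1/2)^k" for k
        using le_mult_square_add_inverse[of "2^k" "cmod (d k x)"] by (simp add: power_one_over inverse_eq_divide)
    qed
    hence "convergent (\<lambda>k. \<Sum>j<k. d j x)"
      by (simp add: summable_iff_convergent)
    hence "convergent (\<lambda>k. f (r 0) x + (\<Sum>j<k. d j x))"
      by (intro convergent_add convergent_const)
    thus ?case by (simp add: d_def sum_lessThan_telescope[of "\<lambda>k. f (r k) x"])
  qed
  define g where "g x = lim (\<lambda>k. f (r k) x)" for x
  have [measurable]: "g \<in> borel_measurable borel"
    unfolding g_def[abs_def] by measurable
  have lim: "AE x in lborel. (\<lambda>k. f (r k) x) \<longlonglongrightarrow> g x"
    using conv by eventually_elim (simp add: g_def convergent_LIMSEQ_iff)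
  \<comment> \<open>Stated for \<open>L2_sq\<close>, because at this stage the difference is not
    known to be square integrable. The case e = 1 yields that, and small e then yields convergence
    in \<open>L2_norm\<close>.\<close>
  have bd: "L2_sq (\<lambda>x. f m x - g x) \<le> ennreal (e\<^sup>2)"
    if "e > 0" "m \<ge> K" and K: "\<forall>m\<ge>K. \<forall>n\<ge>K. L2_norm (\<lambda>x. f m x - f n x) < e" for m e K
  proof -
    have "L2_sq (\<lambda>x. f m x - g x) = (\<integral>\<^sup>+x. liminf (\<lambda>k. ennreal ((cmod (f m x - f (r k) x))\<^sup>2)) \<partial>lborel)"
      unfolding L2_sq_def
    proof (rule nn_integral_cong_AE)
      show "AE x in lborel. ennreal ((cmod (f m x - g x))\<^sup>2) = liminf (\<lambda>k. ennreal ((cmod (f m x - f (r k) x))\<^sup>2))"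
        using lim
      proof eventually_elim
        case (elim x)
        hence "(\<lambda>k. ennreal ((cmod (f m x - f (r k) x))\<^sup>2)) \<longlonglongrightarrow> ennreal ((cmod (f m x - g x))\<^sup>2)"
          by (intro tendsto_intros tendsto_ennrealI)
        thus ?case by (simp only: lim_imp_Liminf[OF sequentially_bot])
      qed
    qed
    also have "\<dots> \<le> liminf (\<lambda>k. L2_sq (\<lambda>x. f m x - f (r k) x))"
      unfolding L2_sq_def by (intro nn_integral_liminf) auto
    also have "\<dots> \<le> limsup (\<lambda>k. L2_sq (\<lambda>x. f m x - f (r k) x))"
      by (intro Liminf_le_Limsup) auto
    also have "\<dots> \<le> ennreal (e\<^sup>2)"
    proof (rule Limsup_bounded)
      show "\<forall>\<^sub>F k in sequentially. L2_sq (\<lambda>x. f m x - f (r k) x) \<le> ennreal (e\<^sup>2)"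
        using eventually_ge_at_top[of K]
      proof eventually_elim
        case (elim k)
        hence "L2_norm (\<lambda>x. f m x - f (r k) x) < e"
          using K that r_ge(3)[of k] by auto
        hence "(L2_norm (\<lambda>x. f m x - f (r k) x))\<^sup>2 \<le> e\<^sup>2"
          by (intro power_mono) auto
        thus ?case by (simp add: L2_sq_eq fd ennreal_leI)
      qed
    qed
    finally show ?thesis .
  qed
  obtain K where K: "\<forall>m\<ge>K. \<forall>n\<ge>K. L2_norm (\<lambda>x. f m x - f n x) < 1"
    using Cauchy[of 1] by auto
  have "square_integrable (\<lambda>x. f K x - g x)"
  proof -
    have "L2_sq (\<lambda>x. f K x - g x) \<le> ennreal (1\<^sup>2)"
      by (rule bd[OF _ _ K]) auto
    also have "\<dots> < \<infinity>" by simp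
    finally show ?thesis by (simp add: square_integrable_iff)
  qed
  from square_integrable_diff[OF f[of K] this] have g: "square_integrable g" by simp
  have "(\<lambda>n. L2_norm (\<lambda>x. f n x - g x)) \<longlonglongrightarrow> 0"
  proof (rule LIMSEQ_I)
    fix e :: real assume e: "e > 0"
    then obtain K where K: "\<forall>m\<ge>K. \<forall>n\<ge>K. L2_norm (\<lambda>x. f m x - f n x) < e / 2"
      using Cauchy[of "e/2"] by auto
    have "L2_norm (\<lambda>x. f m x - g x) < e" if "m \<ge> K" for m
    proof -
      have "L2_sq (\<lambda>x. f m x - g x) \<le> ennreal ((e / 2)\<^sup>2)"
        by (rule bd[OF _ that K]) (use e in simp)
      hence "(L2_norm (\<lambda>x. f m x - g x))\<^sup>2 \<le> (e / 2)\<^sup>2"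
        using e by (simp add: L2_sq_eq square_integrable_diff f g)
      hence "L2_norm (\<lambda>x. f m x - g x) \<le> e / 2"
        by (rule power2_le_imp_le) (use e in simp)
      thus ?thesis using e by simp
    qed
    thus "\<exists>K. \<forall>n\<ge>K. norm (L2_norm (\<lambda>x. f n x - g x) - 0) < e"
      by (intro exI[of _ K]) simp
  qed
  with g show ?thesis by (rule that)
qed

lemma LIMSEQ_null_lessE:
  fixes X :: "nat \<Rightarrow> real"
  assumes "X \<longlonglongrightarrow> 0" "e > 0"
  obtains K where "\<And>n. n \<ge> K \<Longrightarrow> X n < e"
  using order_tendstoD(2)[OF assms] by (auto simp: eventually_sequentially)

section \<open>Translations, reflections and approximation by continuous functions\<close>

lemma integral_lborel_translate:
  fixes f :: "'a::euclidean_space \<Rightarrow> 'b::{banach, second_countable_topology}"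
  assumes "f \<in> borel_measurable borel"
  shows "(LINT x|lborel. f (x + s)) = (LINT x|lborel. f x)"
  using integral_distr[of "(+) s" lborel borel f] assms
  by (simp add: lborel_distr_plus add.commute)

lemma nn_integral_lborel_translate:
  fixes f :: "'a::euclidean_space \<Rightarrow> ennreal"
  assumes "f \<in> borel_measurable borel"
  shows "(\<integral>\<^sup>+x. f (x + s) \<partial>lborel) = (\<integral>\<^sup>+x. f x \<partial>lborel)"
  using nn_integral_distr[of "(+) s" lborel borel f] assms
  by (simp add: lborel_distr_plus add.commute)

lemma distr_lborel_uminus: "distr lborel borel uminus = (lborel :: 'a::euclidean_space measure)"
proof -
  have "(lborel :: 'a measure) = density (distr lborel borel (\<lambda>x. 0 + (-1) *\<^sub>R x)) (\<lambda>_. ennreal (\<bar>-1\<bar>^DIM('a)))"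
    by (rule lborel_affine) simp
  also have "(\<lambda>x::'a. 0 + (-1) *\<^sub>R x) = uminus" by auto
  finally show ?thesis by (simp add: density_1)
qed

lemma integral_lborel_reflect:
  fixes f :: "'a::euclidean_space \<Rightarrow> 'b::{banach, second_countable_topology}"
  assumes "f \<in> borel_measurable borel"
  shows "(LINT x|lborel. f (- x)) = (LINT x|lborel. f x)"
  using integral_distr[of uminus lborel borel f] assms by (simp add: distr_lborel_uminus)

lemma nn_integral_lborel_reflect:
  fixes f :: "'a::euclidean_space \<Rightarrow> ennreal"
  assumes "f \<in> borel_measurable borel"
  shows "(\<integral>\<^sup>+x. f (- x) \<partial>lborel) = (\<integral>\<^sup>+x. f x \<partial>lborel)"
  using nn_integral_distr[of uminus lborel borel f] assms by (simp add: distr_lborel_uminus)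

lemma L2_translate:
  assumes "square_integrable f"
  shows "square_integrable (\<lambda>x. f (x + s))" "L2_norm (\<lambda>x. f (x + s)) = L2_norm f"
proof -
  note [measurable] = square_integrableD(1)[OF assms]
  show "square_integrable (\<lambda>x. f (x + s))"
    using assms nn_integral_lborel_translate[of "\<lambda>x. ennreal ((cmod (f x))\<^sup>2)" s]
    by (simp add: square_integrable_iff L2_sq_def)
  show "L2_norm (\<lambda>x. f (x + s)) = L2_norm f"
    unfolding L2_norm_def using integral_lborel_translate[of "\<lambda>x. (cmod (f x))\<^sup>2" s] by simp
qed

lemma L2_reflect:
  assumes "square_integrable f"
  shows "square_integrable (\<lambda>x. f (- x))" "L2_norm (\<lambda>x. f (- x)) = L2_norm f"
proof -
  note [measurable] = square_integrableD(1)[OF assms]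
  show "square_integrable (\<lambda>x. f (- x))"
    using assms nn_integral_lborel_reflect[of "\<lambda>x. ennreal ((cmod (f x))\<^sup>2)"]
    by (simp add: square_integrable_iff L2_sq_def)
  show "L2_norm (\<lambda>x. f (- x)) = L2_norm f"
    unfolding L2_norm_def using integral_lborel_reflect[of "\<lambda>x. (cmod (f x))\<^sup>2"] by simp
qed

text \<open>Two dominated convergences. The first cuts off large arguments and large values of f.
  The second approximates the bounded cut-off \<open>h n\<close> by continuous functions, which
  \<open>measurable_on\<close> supplies as pointwise limits off a negligible set and which are first
  made uniformly bounded and supported in one ball.\<close>

lemma continuous_compact_support_dense:
  fixes f :: "'a::euclidean_space \<Rightarrow> complex"
  assumes f: "square_integrable f" and "e > 0"
  obtains g R B where "continuous_on UNIV g" "\<And>x. norm x > R \<Longrightarrow> g x = 0" "\<And>x. cmod (g x) \<le> B"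
    "square_integrable g" "L2_norm (\<lambda>x. f x - g x) < e"
proof -
  note [measurable] = square_integrableD(1)[OF f]
  define h where "h n x = (if norm x \<le> real n \<and> cmod (f x) \<le> real n then f x else 0)" for n x
  have [measurable]: "h n \<in> borel_measurable borel" for n
    unfolding h_def[abs_def] by measurable
  have "(\<lambda>n. L2_norm (\<lambda>x. f x - h n x)) \<longlonglongrightarrow> 0"
  proof (rule L2_dominated_convergence(2)[where w = "\<lambda>x. cmod (f x)"])
    have "\<forall>\<^sub>F n in sequentially. f x - h n x = 0" for x
      using eventually_ge_at_top[of "nat \<lceil>max (norm x) (cmod (f x))\<rceil>"]
      by eventually_elim (auto simp: h_def nat_le_iff ceiling_le_iff)
    thus "AE x in lborel. (\<lambda>n. f x - h n x) \<longlonglongrightarrow> 0"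
      by (intro AE_I2 tendsto_eventually)
  qed (use square_integrableD(2)[OF f] in \<open>auto simp: h_def\<close>)
  then obtain K where "\<And>n. n \<ge> K \<Longrightarrow> L2_norm (\<lambda>x. f x - h n x) < e / 2"
    by (rule LIMSEQ_null_lessE[where e = "e / 2"]) (use \<open>e > 0\<close> in auto)
  then obtain n where n: "L2_norm (\<lambda>x. f x - h n x) < e / 2" by blast
  have h: "square_integrable (h n)"
    by (rule square_integrable_bound[OF _ f]) (auto simp: h_def)
  have "h n \<in> borel_measurable (lebesgue_on UNIV)"
    by (intro measurable_restrict_space1 measurable_completion) simp
  hence "h n measurable_on UNIV"
    by (simp add: measurable_on_iff_borel_measurable)
  then obtain N g where N: "negligible N" and g: "\<And>k. continuous_on UNIV (g k)"
      and lim: "\<And>x. x \<notin> N \<Longrightarrow> (\<lambda>k. g k x) \<longlonglongrightarrow> h n x"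
    unfolding measurable_on_def by auto
  \<comment> \<open>The margin 1 leaves room for the cut-off \<open>\<phi>\<close> to fall from 1 on
    the ball of radius n to 0 outside the ball of radius \<open>M\<close>. The map \<open>c\<close>
    is the radial retraction onto the disc of radius \<open>M\<close> and fixes the values of
    \<open>h n\<close>, so the limit is not disturbed by either operation.\<close>
  define M where "M = real n + 1"
  have M: "M > 0" by (simp add: M_def)
  have [measurable]: "cball 0 M \<in> sets (borel :: 'a measure)" by simp
  define c where "c z = complex_of_real (M / max M (cmod z)) * z" for z
  define \<phi> where "\<phi> x = complex_of_real (max 0 (min 1 (M - norm x)))" for x :: 'a
  define k where "k j x = \<phi> x * c (g j x)" for j x
  have c: "continuous_on UNIV c"
    unfolding c_def using M by (intro continuous_intros) (auto simp: max_def)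
  have c_le: "cmod (c z) \<le> M" for z
    using M by (auto simp: c_def norm_mult norm_divide max_def field_simps)
  have \<phi>: "cmod (\<phi> x) \<le> 1" "norm x > M \<Longrightarrow> \<phi> x = 0" "norm x \<le> real n \<Longrightarrow> \<phi> x = 1" for x
    by (auto simp: \<phi>_def M_def)
  have k_cont: "continuous_on UNIV (k j)" for j
    unfolding k_def \<phi>_def
    by (intro continuous_on_mult continuous_on_of_real continuous_on_max continuous_on_min continuous_on_diff
      continuous_on_norm continuous_on_const continuous_on_id continuous_on_compose2[OF c g]) auto
  hence [measurable]: "k j \<in> borel_measurable borel" for j
    by (rule borel_measurable_continuous_onI)
  have k_le: "cmod (k j x) \<le> M * indicator (cball 0 M) x" for j x
    using mult_mono[OF \<phi>(1)[of x] c_le[of "g j x"]] \<phi>(2)[of x] M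
    by (auto simp: k_def norm_mult indicator_def)
  have h_le: "cmod (h n x) \<le> M * indicator (cball 0 M) x" for x
    by (auto simp: h_def M_def indicator_def)
  have int: "integrable lborel (\<lambda>x::'a. (2 * M * indicator (cball 0 M) x)\<^sup>2)"
  proof -
    have "integrable lborel (\<lambda>x::'a. (2 * M)\<^sup>2 * indicator (cball 0 M) x)"
      by (intro integrable_mult_right integrable_real_indicator emeasure_bounded_finite bounded_cball) auto
    also have "(\<lambda>x::'a. (2 * M)\<^sup>2 * indicator (cball 0 M) x) = (\<lambda>x. (2 * M * indicator (cball 0 M) x)\<^sup>2)"
      by (auto simp: indicator_def)
    finally show ?thesis .
  qed
  have "(\<lambda>j. L2_norm (\<lambda>x. h n x - k j x)) \<longlonglongrightarrow> 0"
  proof (rule L2_dominated_convergence(2)[OF _ _ int])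
    show "AE x in lborel. cmod (h n x - k j x) \<le> 2 * M * indicator (cball 0 M) x" for j
    proof (intro AE_I2)
      fix x
      show "cmod (h n x - k j x) \<le> 2 * M * indicator (cball 0 M) x"
        using norm_triangle_ineq4[of "h n x" "k j x"] h_le[of x] k_le[of j x] by simp
    qed
    have "N \<in> null_sets lebesgue"
      using N by (simp add: negligible_iff_null_sets)
    hence "AE x in lebesgue. x \<notin> N" by (rule AE_not_in)
    hence "AE x in lborel. x \<notin> N" by (simp add: AE_completion_iff)
    thus "AE x in lborel. (\<lambda>j. h n x - k j x) \<longlonglongrightarrow> 0"
    proof eventually_elim
      case (elim x)
      have "(\<lambda>j. c (g j x)) \<longlonglongrightarrow> c (h n x)"
        using lim[OF elim] c by (auto intro: continuous_on_tendsto_compose)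
      also have "c (h n x) = h n x"
      proof -
        have "max M (cmod (h n x)) = M" by (auto simp: h_def M_def)
        thus ?thesis using M by (simp add: c_def)
      qed
      finally have "(\<lambda>j. h n x - \<phi> x * c (g j x)) \<longlonglongrightarrow> h n x - \<phi> x * h n x"
        by (intro tendsto_intros)
      also have "h n x - \<phi> x * h n x = 0"
        using \<phi>(3)[of x] by (auto simp: h_def)
      finally show ?case by (simp add: k_def)
    qed
  qed measurable
  then obtain K where "\<And>j. j \<ge> K \<Longrightarrow> L2_norm (\<lambda>x. h n x - k j x) < e / 2"
    by (rule LIMSEQ_null_lessE[where e = "e / 2"]) (use \<open>e > 0\<close> in auto)
  then obtain j where j: "L2_norm (\<lambda>x. h n x - k j x) < e / 2" by blast
  have k: "square_integrable (k j)"
  proof (rule square_integrable_bound)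
    show "square_integrable (\<lambda>x::'a. complex_of_real (2 * M * indicator (cball 0 M) x))"
      using int M by (auto simp: square_integrable_def norm_mult power_mult_distrib)
    show "AE x in lborel. cmod (k j x) \<le> cmod (complex_of_real (2 * M * indicator (cball 0 M) x))"
    proof (intro AE_I2)
      fix x
      show "cmod (k j x) \<le> cmod (complex_of_real (2 * M * indicator (cball 0 M) x))"
        using k_le[of j x] M by (cases "norm x \<le> M") (auto simp: norm_mult)
    qed
  qed measurable
  show ?thesis
  proof (rule that[of "k j" M M])
    show "L2_norm (\<lambda>x. f x - k j x) < e"
      using L2_norm_diff_triangle[OF f h k] n j by simp
    show "cmod (k j x) \<le> M" for x
      using k_le[of j x] M by (cases "norm x \<le> M") auto
    show "k j x = 0" if "norm x > M" for x
      using that \<phi>(2)[of x] by (simp add: k_def)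
  qed (use k_cont k in auto)
qed

text \<open>Translations are isometric, so a dense class suffices. For a continuous function of
  compact support the translates converge pointwise, and they vanish outside one common ball because
  the sequence of shifts is bounded.\<close>

lemma translate_tendsto_L2:
  fixes f :: "'a::euclidean_space \<Rightarrow> complex"
  assumes f: "square_integrable f" and s: "s \<longlonglongrightarrow> 0"
  shows "(\<lambda>n. L2_norm (\<lambda>x. f (x + s n) - f x)) \<longlonglongrightarrow> 0"
proof (rule LIMSEQ_I)
  fix e :: real assume e: "e > 0"
  obtain g R B where g: "continuous_on UNIV g" "\<And>x. norm x > R \<Longrightarrow> g x = 0" "\<And>x. cmod (g x) \<le> B"
      "square_integrable g" and fg: "L2_norm (\<lambda>x. f x - g x) < e / 3"
    using continuous_compact_support_dense[OF f, of "e / 3"] e by auto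
  have [measurable]: "g \<in> borel_measurable borel" by (rule square_integrableD(1)[OF g(4)])
  obtain K where K: "\<And>n. norm (s n) \<le> K" "K > 0"
    using convergent_imp_Bseq[OF convergentI[OF s]] by (auto simp: Bseq_def)
  have B: "B \<ge> 0" using order_trans[OF norm_ge_zero g(3)] by blast
  have "(\<lambda>n. L2_norm (\<lambda>x. g (x + s n) - g x)) \<longlonglongrightarrow> 0"
  proof (rule L2_dominated_convergence(2)[where w = "\<lambda>x. 2 * B * indicator (cball 0 (R + K)) x"])
    have "integrable lborel (\<lambda>x::'a. (2 * B)\<^sup>2 * indicator (cball 0 (R + K)) x)"
      by (intro integrable_mult_right integrable_real_indicator emeasure_bounded_finite bounded_cball) auto
    also have "(\<lambda>x::'a. (2 * B)\<^sup>2 * indicator (cball 0 (R + K)) x) = (\<lambda>x. (2 * B * indicator (cball 0 (R + K)) x)\<^sup>2)"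
      by (auto simp: indicator_def)
    finally show "integrable lborel (\<lambda>x::'a. (2 * B * indicator (cball 0 (R + K)) x)\<^sup>2)" .
    show "AE x in lborel. cmod (g (x + s n) - g x) \<le> 2 * B * indicator (cball 0 (R + K)) x" for n
    proof (intro AE_I2)
      fix x
      show "cmod (g (x + s n) - g x) \<le> 2 * B * indicator (cball 0 (R + K)) x"
      proof (cases "norm x \<le> R + K")
        case True
        thus ?thesis using norm_triangle_ineq4[of "g (x + s n)" "g x"] g(3)[of "x + s n"] g(3)[of x] by simp
      next
        case False
        hence "norm (x + s n) > R" "norm x > R"
          using norm_triangle_ineq4[of "x + s n" "s n"] K(1)[of n] K(2) by simp_all
        thus ?thesis using g(2) B by simp
      qed
    qed
    have "(\<lambda>n. g (x + s n) - g x) \<longlonglongrightarrow> g (x + 0) - g x" for x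
      by (intro tendsto_diff tendsto_const continuous_on_tendsto_compose[OF g(1)] tendsto_add s) auto
    thus "AE x in lborel. (\<lambda>n. g (x + s n) - g x) \<longlonglongrightarrow> 0" by simp
    show "(\<lambda>x. 2 * B * indicator (cball 0 (R + K)) x) \<in> borel_measurable (borel :: 'a measure)"
      by (intro borel_measurable_times borel_measurable_const borel_measurable_indicator) auto
  qed measurable
  then obtain K where K: "\<And>n. n \<ge> K \<Longrightarrow> L2_norm (\<lambda>x. g (x + s n) - g x) < e / 3"
    by (rule LIMSEQ_null_lessE[where e = "e / 3"]) (use e in auto)
  have "L2_norm (\<lambda>x. f (x + s n) - f x) < e" if n: "n \<ge> K" for n
  proof -
    note t = L2_translate(1)[OF f, of "s n"] L2_translate(1)[OF g(4), of "s n"]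
    have "L2_norm (\<lambda>x. f (x + s n) - g (x + s n)) < e / 3"
      using L2_translate(2)[OF square_integrable_diff[OF f g(4)], of "s n"] fg by simp
    moreover have "L2_norm (\<lambda>x. g x - f x) < e / 3"
      using fg L2_norm_minus_commute[of f g] by simp
    ultimately show ?thesis
      using L2_norm_diff_triangle[OF t f] L2_norm_diff_triangle[OF t(2) g(4) f] K[OF n] by linarith
  qed
  thus "\<exists>K. \<forall>n\<ge>K. norm (L2_norm (\<lambda>x. f (x + s n) - f x) - 0) < e"
    by (intro exI[of _ K]) auto
qed


section \<open>The Fourier transform on \<open>L\<^sup>1\<close>\<close>

lemma integrable_pair_mult:
  fixes f g :: "'a::euclidean_space \<Rightarrow> complex"
  assumes f: "integrable lborel f" and g: "integrable lborel g"
  shows "integrable (lborel \<Otimes>\<^sub>M lborel) (\<lambda>(x, y). f x * g y)"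
proof -
  note [measurable] = borel_measurable_integrable[OF f] borel_measurable_integrable[OF g]
  have "(\<integral>\<^sup>+p. ennreal (norm (case p of (x, y) \<Rightarrow> f x * g y)) \<partial>(lborel \<Otimes>\<^sub>M lborel)) =
      (\<integral>\<^sup>+x. \<integral>\<^sup>+y. ennreal (cmod (f x)) * ennreal (cmod (g y)) \<partial>lborel \<partial>lborel)"
    by (subst lborel.nn_integral_fst[symmetric]) (auto simp: norm_mult ennreal_mult)
  also have "\<dots> = (\<integral>\<^sup>+x. ennreal (cmod (f x)) \<partial>lborel) * (\<integral>\<^sup>+y. ennreal (cmod (g y)) \<partial>lborel)"
    by (simp add: nn_integral_cmult nn_integral_multc)
  also have "\<dots> < \<infinity>"
    using f g by (auto simp: integrable_iff_bounded ennreal_mult_less_top)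
  finally show ?thesis by (simp add: integrable_iff_bounded)
qed

section \<open>Convolutions and the transform of a product or a convolution\<close>

definition convolution :: "('a::euclidean_space \<Rightarrow> complex) \<Rightarrow> ('a \<Rightarrow> complex) \<Rightarrow> 'a \<Rightarrow> complex" where
  "convolution f g x = (LINT y|lborel. f (x - y) * g y)"

lemma nn_integral_convolution:
  fixes a b :: "'a::euclidean_space \<Rightarrow> ennreal"
  assumes [measurable]: "a \<in> borel_measurable borel" "b \<in> borel_measurable borel"
  shows "(\<integral>\<^sup>+x. \<integral>\<^sup>+y. a (x - y) * b y \<partial>lborel \<partial>lborel) = (\<integral>\<^sup>+x. a x \<partial>lborel) * (\<integral>\<^sup>+y. b y \<partial>lborel)"
proof -
  have "(\<integral>\<^sup>+x. \<integral>\<^sup>+y. a (x - y) * b y \<partial>lborel \<partial>lborel) = (\<integral>\<^sup>+y. \<integral>\<^sup>+x. a (x - y) * b y \<partial>lborel \<partial>lborel)"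
    by (rule lborel_pair.Fubini'[symmetric]) measurable
  also have "\<dots> = (\<integral>\<^sup>+y. (\<integral>\<^sup>+x. a x \<partial>lborel) * b y \<partial>lborel)"
  proof (rule nn_integral_cong)
    fix y
    show "(\<integral>\<^sup>+x. a (x - y) * b y \<partial>lborel) = (\<integral>\<^sup>+x. a x \<partial>lborel) * b y"
      using nn_integral_lborel_translate[of a "- y"] by (simp add: nn_integral_multc)
  qed
  also have "\<dots> = (\<integral>\<^sup>+x. a x \<partial>lborel) * (\<integral>\<^sup>+y. b y \<partial>lborel)"
    by (simp add: nn_integral_cmult)
  finally show ?thesis .
qed

lemma integrable_convolution_kernel:
  fixes f g :: "'a::euclidean_space \<Rightarrow> complex"
  assumes f: "integrable lborel f" and g: "integrable lborel g"
  shows "integrable (lborel \<Otimes>\<^sub>M lborel) (\<lambda>(x, y). f (x - y) * g y)"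
proof -
  have [measurable]: "f \<in> borel_measurable borel" "g \<in> borel_measurable borel"
    using borel_measurable_integrable[OF f] borel_measurable_integrable[OF g] by auto
  have "(\<integral>\<^sup>+p. ennreal (norm (case p of (x, y) \<Rightarrow> f (x - y) * g y)) \<partial>(lborel \<Otimes>\<^sub>M lborel)) =
      (\<integral>\<^sup>+x. \<integral>\<^sup>+y. ennreal (cmod (f (x - y))) * ennreal (cmod (g y)) \<partial>lborel \<partial>lborel)"
    by (subst lborel.nn_integral_fst[symmetric]) (auto simp: norm_mult ennreal_mult)
  also have "\<dots> = (\<integral>\<^sup>+x. ennreal (cmod (f x)) \<partial>lborel) * (\<integral>\<^sup>+y. ennreal (cmod (g y)) \<partial>lborel)"
    by (rule nn_integral_convolution[of "\<lambda>x. ennreal (cmod (f x))" "\<lambda>x. ennreal (cmod (g x))"]) auto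
  also have "\<dots> < \<infinity>"
    using f g by (auto simp: integrable_iff_bounded ennreal_mult_less_top)
  finally show ?thesis by (simp add: integrable_iff_bounded)
qed

lemma integrable_convolution:
  assumes "integrable lborel f" "integrable lborel g"
  shows "integrable lborel (convolution f g)"
  unfolding convolution_def[abs_def]
  using lborel_pair.integrable_fst'[OF integrable_convolution_kernel[OF assms]] by simp

lemma borel_measurable_cis_inner [measurable]:
  "(\<lambda>x. cis (- (x \<bullet> \<xi>))) \<in> borel_measurable (borel :: 'a::euclidean_space measure)"
  by (intro borel_measurable_continuous_onI continuous_intros)

lemma borel_measurable_cis_inner_pair [measurable]:
  "(\<lambda>p::'a \<times> 'a::euclidean_space. cis (- (fst p \<bullet> snd p))) \<in> borel_measurable (lborel \<Otimes>\<^sub>M lborel)"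
proof -
  have "(\<lambda>p::'a \<times> 'a. cis (- (fst p \<bullet> snd p))) \<in> borel_measurable borel"
    by (intro borel_measurable_continuous_onI continuous_intros)
  thus ?thesis by (simp add: lborel_prod)
qed

text \<open>Fubini for the kernel cis (-(x, y)) f(x) g(y): the character is symmetric in x and y and
  of modulus one, so the kernel is as integrable as the product of f and g.\<close>

lemma fourier_L1_multiplication_formula:
  fixes f g :: "'a::euclidean_space \<Rightarrow> complex"
  assumes f: "integrable lborel f" and g: "integrable lborel g"
  shows "(LINT x|lborel. fourier_L1 f x * g x) = (LINT x|lborel. f x * fourier_L1 g x)"
proof -
  have [measurable]: "f \<in> borel_measurable borel" "g \<in> borel_measurable borel"
    using borel_measurable_integrable[OF f] borel_measurable_integrable[OF g] by auto
  define K where "K = (\<lambda>(x, y). cis (- (fst (x, y) \<bullet> snd (x, y :: 'a))) * (f x * g y))"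
  have K: "integrable (lborel \<Otimes>\<^sub>M lborel) K"
  proof (rule Bochner_Integration.integrable_bound[OF integrable_pair_mult[OF f g]])
    show "K \<in> borel_measurable (lborel \<Otimes>\<^sub>M lborel)"
      unfolding K_def case_prod_unfold prod.collapse by measurable
  qed (auto simp: K_def norm_mult)
  let ?c = "complex_of_real ((2 * pi) powr (- real DIM('a) / 2))"
  have "(LINT y|lborel. fourier_L1 f y * g y) = ?c * (LINT y|lborel. LINT x|lborel. K (x, y))"
  proof -
    have "(LINT x|lborel. K (x, y)) = (LINT x|lborel. (cis (- (x \<bullet> y)) * f x) * g y)" for y
      by (simp add: K_def mult.assoc)
    hence "fourier_L1 f y * g y = ?c * (LINT x|lborel. K (x, y))" for y
      by (simp add: fourier_L1_def)
    thus ?thesis by simp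
  qed
  also have "(LINT y|lborel. LINT x|lborel. K (x, y)) = (LINT x|lborel. LINT y|lborel. K (x, y))"
    using lborel_pair.Fubini_integral[of "\<lambda>x y. K (x, y)"] K by simp
  also have "?c * \<dots> = (LINT x|lborel. ?c * (LINT y|lborel. f x * (cis (- (y \<bullet> x)) * g y)))"
  proof -
    have "K (x, y) = f x * (cis (- (y \<bullet> x)) * g y)" for x y
      by (simp add: K_def inner_commute[of x y])
    thus ?thesis by (simp only: integral_mult_right_zero)
  qed
  also have "\<dots> = (LINT x|lborel. f x * fourier_L1 g x)"
    by (intro Bochner_Integration.integral_cong refl) (simp add: fourier_L1_def mult.left_commute)
  finally show ?thesis .
qed

text \<open>Fubini and the shift from x to x + y split the character. The constant is left over
  because the unitary normalisation contributes one factor (2 pi)^(-N/2) on the left but two on the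
  right.\<close>

lemma fourier_L1_convolution:
  fixes f g :: "'a::euclidean_space \<Rightarrow> complex"
  assumes f: "integrable lborel f" and g: "integrable lborel g"
  shows "fourier_L1 (convolution f g) \<xi> =
    complex_of_real ((2 * pi) powr (real DIM('a) / 2)) * (fourier_L1 f \<xi> * fourier_L1 g \<xi>)"
proof -
  have [measurable]: "f \<in> borel_measurable borel" "g \<in> borel_measurable borel"
    using borel_measurable_integrable[OF f] borel_measurable_integrable[OF g] by auto
  define K where "K = (\<lambda>p. cis (- (fst p \<bullet> \<xi>)) * (case p of (x, y) \<Rightarrow> f (x - y) * g y))"
  have K: "integrable (lborel \<Otimes>\<^sub>M lborel) K"
  proof (rule Bochner_Integration.integrable_bound[OF integrable_convolution_kernel[OF f g]])
    show "K \<in> borel_measurable (lborel \<Otimes>\<^sub>M lborel)"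
      unfolding K_def by measurable
  qed (auto simp: K_def norm_mult)
  have "(LINT x|lborel. cis (- (x \<bullet> \<xi>)) * convolution f g x) = (LINT x|lborel. LINT y|lborel. K (x, y))"
    by (simp add: convolution_def K_def)
  also have "\<dots> = (LINT y|lborel. LINT x|lborel. K (x, y))"
    using lborel_pair.Fubini_integral[of "\<lambda>x y. K (x, y)"] K by simp
  also have "\<dots> = (LINT y|lborel. (LINT x|lborel. cis (- (x \<bullet> \<xi>)) * f x) * (cis (- (y \<bullet> \<xi>)) * g y))"
  proof (rule Bochner_Integration.integral_cong[OF refl])
    fix y
    have "(LINT x|lborel. K (x, y)) = (LINT x|lborel. K (x + y, y))"
      by (rule integral_lborel_translate[symmetric]) (simp add: K_def)
    also have "\<dots> = (LINT x|lborel. (cis (- (x \<bullet> \<xi>)) * f x) * (cis (- (y \<bullet> \<xi>)) * g y))"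
    proof -
      have "cis (- ((x + y) \<bullet> \<xi>)) = cis (- (x \<bullet> \<xi>)) * cis (- (y \<bullet> \<xi>))" for x
        by (simp add: inner_add_left cis_mult)
      thus ?thesis
        by (intro Bochner_Integration.integral_cong refl) (simp add: K_def ac_simps)
    qed
    also have "\<dots> = (LINT x|lborel. cis (- (x \<bullet> \<xi>)) * f x) * (cis (- (y \<bullet> \<xi>)) * g y)"
      by simp
    finally show "(LINT x|lborel. K (x, y)) = (LINT x|lborel. cis (- (x \<bullet> \<xi>)) * f x) * (cis (- (y \<bullet> \<xi>)) * g y)" .
  qed
  also have "\<dots> = (LINT x|lborel. cis (- (x \<bullet> \<xi>)) * f x) * (LINT y|lborel. cis (- (y \<bullet> \<xi>)) * g y)"
    by simp
  finally have *: "(LINT x|lborel. cis (- (x \<bullet> \<xi>)) * convolution f g x) = \<dots>" .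
  have c: "(2 * pi) powr (real DIM('a) / 2) * (2 * pi) powr (- real DIM('a) / 2) = 1"
    by (simp add: powr_add[symmetric])
  have distr: "Q * (A * B) = P * ((Q * A) * (Q * B))" if "P * Q = 1" for P Q A B :: complex
  proof -
    have "P * ((Q * A) * (Q * B)) = (P * Q) * (Q * (A * B))" by (simp only: ac_simps)
    thus ?thesis using that by simp
  qed
  show ?thesis
    unfolding fourier_L1_def * by (rule distr) (metis c of_real_mult of_real_1)
qed

lemma borel_measurable_cnj' [measurable (raw)]:
  "f \<in> borel_measurable M \<Longrightarrow> (\<lambda>x. cnj (f x)) \<in> borel_measurable M"
  by (rule borel_measurable_continuous_on[of cnj]) (auto intro: continuous_intros)

text \<open>The first equation makes the transform of an autocorrelation a squared modulus. The
  second, extended to L2, describes conjugation on H^q.\<close>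

lemma fourier_L1_cnj:
  fixes f :: "'a::euclidean_space \<Rightarrow> complex"
  assumes "f \<in> borel_measurable borel"
  shows "fourier_L1 (\<lambda>x. cnj (f (- x))) \<xi> = cnj (fourier_L1 f \<xi>)"
    and "fourier_L1 (\<lambda>x. cnj (f x)) \<xi> = cnj (fourier_L1 f (- \<xi>))"
proof -
  note [measurable] = assms
  have "(LINT x|lborel. cis (- (x \<bullet> \<xi>)) * cnj (f (- x))) = (LINT x|lborel. cis (- ((- x) \<bullet> \<xi>)) * cnj (f (- (- x))))"
    by (rule integral_lborel_reflect[symmetric]) measurable
  also have "\<dots> = (LINT x|lborel. cnj (cis (- (x \<bullet> \<xi>)) * f x))"
    by (simp add: cis_cnj)
  also have "\<dots> = cnj (LINT x|lborel. cis (- (x \<bullet> \<xi>)) * f x)"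
    by (rule Bochner_Integration.integral_cnj)
  finally show "fourier_L1 (\<lambda>x. cnj (f (- x))) \<xi> = cnj (fourier_L1 f \<xi>)"
    by (simp add: fourier_L1_def)
  have "(LINT x|lborel. cis (- (x \<bullet> \<xi>)) * cnj (f x)) = (LINT x|lborel. cnj (cis (- (x \<bullet> (- \<xi>))) * f x))"
    by (simp add: cis_cnj)
  also have "\<dots> = cnj (LINT x|lborel. cis (- (x \<bullet> (- \<xi>))) * f x)"
    by (rule Bochner_Integration.integral_cnj)
  finally show "fourier_L1 (\<lambda>x. cnj (f x)) \<xi> = cnj (fourier_L1 f (- \<xi>))"
    by (simp add: fourier_L1_def)
qed

section \<open>Gaussian integrals\<close>

lemma integral_lborel_prod:
  fixes f :: "'a::euclidean_space \<Rightarrow> real \<Rightarrow> complex"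
  assumes f: "\<And>b. b \<in> Basis \<Longrightarrow> integrable lborel (f b)"
  shows "integrable lborel (\<lambda>x. \<Prod>b\<in>Basis. f b (x \<bullet> b))"
    and "(LINT x|lborel. (\<Prod>b\<in>Basis. f b (x \<bullet> b))) = (\<Prod>b\<in>Basis. (LINT t|lborel. f b t))"
proof -
  interpret product_sigma_finite "\<lambda>_::'a. lborel :: real measure"
    by standard
  have [measurable]: "f b \<in> borel_measurable borel" if "b \<in> Basis" for b
    using borel_measurable_integrable[OF f[OF that]] by simp
  have m: "(\<lambda>x. \<Prod>b\<in>Basis. f b (x \<bullet> b)) \<in> borel_measurable borel"
    by measurable
  have eq: "(\<Prod>b\<in>Basis. f b ((\<Sum>i\<in>Basis. y i *\<^sub>R i) \<bullet> b)) = (\<Prod>b\<in>Basis. f b (y b))" for y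
    by (intro prod.cong refl) simp
  have mm: "(\<lambda>y. \<Sum>i\<in>Basis. y i *\<^sub>R i) \<in> (\<Pi>\<^sub>M b\<in>Basis. lborel) \<rightarrow>\<^sub>M borel"
    by measurable
  show "integrable lborel (\<lambda>x. \<Prod>b\<in>Basis. f b (x \<bullet> b))"
    unfolding lborel_eq[where 'a = 'a] integrable_distr_eq[OF mm m] eq
    by (rule product_integrable_prod) (auto intro: f)
  show "(LINT x|lborel. (\<Prod>b\<in>Basis. f b (x \<bullet> b))) = (\<Prod>b\<in>Basis. (LINT t|lborel. f b t))"
    unfolding lborel_eq[where 'a = 'a] integral_distr[OF mm m] eq
    by (rule product_integral_prod) (auto intro: f)
qed

text \<open>This is the characteristic function of the standard normal law, rescaled by sqrt (2 pi).
  It is evaluated at -t because \<open>char\<close> uses the opposite sign in the exponent.\<close>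

lemma gaussian_integral_cis:
  "integrable lborel (\<lambda>x::real. cis (- (t * x)) * complex_of_real (exp (- x\<^sup>2 / 2)))"
  "(LINT x|lborel. cis (- (t * x)) * complex_of_real (exp (- x\<^sup>2 / 2))) =
     complex_of_real (sqrt (2 * pi) * exp (- t\<^sup>2 / 2))"
proof -
  have eq: "exp (- x\<^sup>2 / 2) = sqrt (2 * pi) * std_normal_density x" for x
    by (simp add: std_normal_density_def)
  have "integrable lborel (\<lambda>x. complex_of_real (exp (- x\<^sup>2 / 2)))"
    unfolding eq by (intro integrable_of_real integrable_mult_right integrable_normal_density) simp
  from integrable_cis_mult[OF this, of t]
  show "integrable lborel (\<lambda>x::real. cis (- (t * x)) * complex_of_real (exp (- x\<^sup>2 / 2)))"
    by (simp add: mult.commute)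
  have "complex_of_real (exp (- (- t)\<^sup>2 / 2)) = char std_normal_distribution (- t)"
    by (simp add: char_std_normal_distribution)
  also have "\<dots> = (LINT x|lborel. std_normal_density x *\<^sub>R iexp (- t * x))"
    unfolding char_def by (subst integral_density) auto
  finally have *: "complex_of_real (exp (- t\<^sup>2 / 2)) = (LINT x|lborel. std_normal_density x *\<^sub>R cis (- (t * x)))"
    by (simp add: cis_conv_exp)
  have "(LINT x|lborel. cis (- (t * x)) * complex_of_real (exp (- x\<^sup>2 / 2))) =
      (LINT x|lborel. complex_of_real (sqrt (2 * pi)) * (std_normal_density x *\<^sub>R cis (- (t * x))))"
    unfolding eq by (intro Bochner_Integration.integral_cong refl) (simp add: scaleR_conv_of_real)
  also have "\<dots> = complex_of_real (sqrt (2 * pi) * exp (- t\<^sup>2 / 2))"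
    by (simp only: integral_mult_right_zero *[symmetric] of_real_mult)
  finally show "(LINT x|lborel. cis (- (t * x)) * complex_of_real (exp (- x\<^sup>2 / 2))) =
     complex_of_real (sqrt (2 * pi) * exp (- t\<^sup>2 / 2))" .
qed

text \<open>The width is the one that the unitary Fourier transform leaves fixed.\<close>

definition gaussian :: "'a::euclidean_space \<Rightarrow> complex" where
  "gaussian x = complex_of_real (exp (- (norm x)\<^sup>2 / 2))"

lemma cis_sum: "cis (sum f A) = (\<Prod>a\<in>A. cis (f a))"
  by (induction A rule: infinite_finite_induct) (simp_all add: cis_mult[symmetric] del: cis_mult)

lemma gaussian_prod: "cis (- (x \<bullet> \<xi>)) * gaussian x =
  (\<Prod>b\<in>Basis. cis (- ((\<xi> \<bullet> b) * (x \<bullet> b))) * complex_of_real (exp (- (x \<bullet> b)\<^sup>2 / 2)))"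
proof -
  have "cis (- (x \<bullet> \<xi>)) = (\<Prod>b\<in>Basis. cis (- ((\<xi> \<bullet> b) * (x \<bullet> b))))"
    by (simp add: euclidean_inner[of x \<xi>] cis_sum sum_negf[symmetric] mult.commute)
  moreover have "exp (- (norm x)\<^sup>2 / 2) = (\<Prod>b\<in>Basis. exp (- (x \<bullet> b)\<^sup>2 / 2))"
  proof -
    have "(norm x)\<^sup>2 = (\<Sum>b\<in>Basis. (x \<bullet> b)\<^sup>2)"
      unfolding power2_norm_eq_inner by (subst euclidean_inner) (simp add: power2_eq_square)
    thus ?thesis
      by (simp add: exp_sum[symmetric] sum_divide_distrib sum_negf)
  qed
  ultimately show ?thesis
    by (simp add: gaussian_def prod.distrib)
qed

lemma integrable_gaussian: "integrable lborel (gaussian :: 'a::euclidean_space \<Rightarrow> complex)"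
proof -
  have "integrable lborel (\<lambda>x::'a. cis (- (x \<bullet> 0)) * gaussian x)"
    unfolding gaussian_prod by (intro integral_lborel_prod gaussian_integral_cis)
  thus ?thesis by simp
qed

lemma fourier_L1_gaussian: "fourier_L1 gaussian = (gaussian :: 'a::euclidean_space \<Rightarrow> complex)"
proof
  fix \<xi> :: 'a
  have "(LINT x|lborel. cis (- (x \<bullet> \<xi>)) * gaussian x) =
      (\<Prod>b\<in>(Basis :: 'a set). complex_of_real (sqrt (2 * pi) * exp (- (\<xi> \<bullet> b)\<^sup>2 / 2)))"
    unfolding gaussian_prod
    by (subst integral_lborel_prod(2)[OF gaussian_integral_cis(1)]) (simp only: gaussian_integral_cis(2))
  \<comment> \<open>The product formula at frequency 0 is used backwards, to reassemble the
    one-dimensional Gaussians.\<close>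
  also have "\<dots> = complex_of_real (sqrt (2 * pi) ^ DIM('a)) * gaussian \<xi>"
    using gaussian_prod[of 0 \<xi>] by (simp add: prod.distrib gaussian_prod[of \<xi> 0, simplified])
  also have "sqrt (2 * pi) ^ DIM('a) = (2 * pi) powr (real DIM('a) / 2)"
    by (simp add: powr_half_sqrt[symmetric] powr_realpow[symmetric] powr_powr)
  finally show "fourier_L1 gaussian \<xi> = gaussian \<xi>"
    by (simp add: fourier_L1_def powr_add[symmetric] flip: of_real_mult mult.assoc)
qed

section \<open>Dilations, Gaussian regularisation and the isometry on the intersection of L1 and
  L2\<close>

lemma integral_lborel_scale:
  fixes f :: "'a::euclidean_space \<Rightarrow> 'b::{banach, second_countable_topology}"
  assumes [measurable]: "f \<in> borel_measurable borel" and "a > 0"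
  shows "(LINT x|lborel. f x) = a ^ DIM('a) *\<^sub>R (LINT x|lborel. f (a *\<^sub>R x))"
proof -
  have "(LINT x|lborel. f x) = (LINT x|density (distr lborel borel (\<lambda>x. 0 + a *\<^sub>R x)) (\<lambda>_. \<bar>a\<bar>^DIM('a)). f x)"
    using lborel_affine[of a "0 :: 'a"] assms by simp
  also have "\<dots> = (LINT x|distr lborel borel (\<lambda>x. 0 + a *\<^sub>R x). (\<bar>a\<bar>^DIM('a)) *\<^sub>R f x)"
    by (rule integral_density) auto
  also have "\<dots> = (LINT x|lborel. (\<bar>a\<bar>^DIM('a)) *\<^sub>R f (0 + a *\<^sub>R x))"
    by (rule integral_distr) auto
  finally show ?thesis using assms by simp
qed

lemma integrable_lborel_scale:
  fixes f :: "'a::euclidean_space \<Rightarrow> 'b::{banach, second_countable_topology}"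
  assumes f: "integrable lborel f" and "a > 0"
  shows "integrable lborel (\<lambda>x. f (a *\<^sub>R x))"
proof -
  have [measurable]: "f \<in> borel_measurable borel"
    using borel_measurable_integrable[OF f] by simp
  have "integrable (density (distr lborel borel (\<lambda>x. 0 + a *\<^sub>R x)) (\<lambda>_. ennreal (\<bar>a\<bar>^DIM('a)))) f"
    using lborel_affine[of a "0 :: 'a"] assms by simp
  hence "integrable (distr lborel borel (\<lambda>x. 0 + a *\<^sub>R x)) (\<lambda>x. (\<bar>a\<bar>^DIM('a)) *\<^sub>R f x)"
    by (subst (asm) integrable_density) auto
  hence "integrable lborel (\<lambda>x. (\<bar>a\<bar>^DIM('a)) *\<^sub>R f (0 + a *\<^sub>R x))"
    by (subst (asm) integrable_distr_eq) auto
  hence "integrable lborel (\<lambda>x. inverse (\<bar>a\<bar>^DIM('a)) *\<^sub>R ((\<bar>a\<bar>^DIM('a)) *\<^sub>R f (0 + a *\<^sub>R x)))"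
    by (rule integrable_scaleR_right)
  thus ?thesis using assms by simp
qed

lemma fourier_L1_scale:
  fixes f :: "'a::euclidean_space \<Rightarrow> complex"
  assumes [measurable]: "f \<in> borel_measurable borel" and a: "a > 0"
  shows "fourier_L1 (\<lambda>x. f (a *\<^sub>R x)) \<xi> = complex_of_real (inverse a ^ DIM('a)) * fourier_L1 f (inverse a *\<^sub>R \<xi>)"
proof -
  have "(LINT x|lborel. cis (- (x \<bullet> \<xi>)) * f (a *\<^sub>R x)) =
      inverse a ^ DIM('a) *\<^sub>R (LINT x|lborel. cis (- ((inverse a *\<^sub>R x) \<bullet> \<xi>)) * f (a *\<^sub>R (inverse a *\<^sub>R x)))"
    by (rule integral_lborel_scale) (use a in \<open>auto\<close>)
  also have "\<dots> = inverse a ^ DIM('a) *\<^sub>R (LINT x|lborel. cis (- (x \<bullet> (inverse a *\<^sub>R \<xi>))) * f x)"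
    using a by simp
  finally show ?thesis
    by (simp add: fourier_L1_def scaleR_conv_of_real)
qed

lemma norm_fourier_L1_le:
  fixes h :: "'a::euclidean_space \<Rightarrow> complex"
  shows "cmod (fourier_L1 h \<xi>) \<le> (2 * pi) powr (- real DIM('a) / 2) * (LINT x|lborel. cmod (h x))"
proof -
  have "cmod (LINT x|lborel. cis (- (x \<bullet> \<xi>)) * h x) \<le> (LINT x|lborel. cmod (h x))"
    using integral_norm_bound[of lborel "\<lambda>x. cis (- (x \<bullet> \<xi>)) * h x"] by (simp add: norm_mult)
  thus ?thesis by (simp add: fourier_L1_def norm_mult mult_left_mono)
qed

text \<open>A regularised inversion formula at the origin: for a tending to 0 the left side formally
  becomes the integral of the transform, and the right side A(0) times the mass of the Gaussian. The
  multiplication formula moves the transform onto the Gaussian, which becomes a peak of width a and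
  is rescaled to width 1.\<close>

lemma gaussian_regularized_integral:
  fixes A :: "'a::euclidean_space \<Rightarrow> complex"
  assumes A: "integrable lborel A" and a: "a > 0"
  shows "(LINT \<xi>|lborel. fourier_L1 A \<xi> * gaussian (a *\<^sub>R \<xi>)) = (LINT z|lborel. A (a *\<^sub>R z) * gaussian z)"
proof -
  have [measurable]: "A \<in> borel_measurable borel" "gaussian \<in> borel_measurable (borel :: 'a measure)"
    using borel_measurable_integrable[OF A] borel_measurable_integrable[OF integrable_gaussian] by auto
  have "(LINT \<xi>|lborel. fourier_L1 A \<xi> * gaussian (a *\<^sub>R \<xi>)) =
      (LINT w|lborel. A w * fourier_L1 (\<lambda>x. gaussian (a *\<^sub>R x)) w)"
    by (rule fourier_L1_multiplication_formula[OF A integrable_lborel_scale[OF integrable_gaussian a]])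
  also have "\<dots> = (LINT w|lborel. A w * (complex_of_real (inverse a ^ DIM('a)) * gaussian (inverse a *\<^sub>R w)))"
    using a by (subst fourier_L1_scale) (auto simp: fourier_L1_gaussian)
  also have "\<dots> = a ^ DIM('a) *\<^sub>R (LINT z|lborel. A (a *\<^sub>R z) *
      (complex_of_real (inverse a ^ DIM('a)) * gaussian (inverse a *\<^sub>R (a *\<^sub>R z))))"
    by (rule integral_lborel_scale) (use a in auto)
  also have "\<dots> = (LINT z|lborel. a ^ DIM('a) *\<^sub>R (A (a *\<^sub>R z) *
      (complex_of_real (inverse a ^ DIM('a)) * gaussian (inverse a *\<^sub>R (a *\<^sub>R z)))))"
    by (rule integral_scaleR_right[symmetric])
  also have "\<dots> = (LINT z|lborel. A (a *\<^sub>R z) * gaussian z)"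
    using a by (intro Bochner_Integration.integral_cong refl)
      (simp add: scaleR_conv_of_real power_inverse field_simps)
  finally show ?thesis .
qed

text \<open>The autocorrelation \<open>A\<close> of \<open>h\<close> is continuous with \<open>A 0 = \<parallel>h\<parallel>\<^sup>2\<close>, and its transform is a multiple of
  the squared modulus of that of \<open>h\<close>. Damping by Gaussians of growing width and passing to the limit
  (dominated on one side, monotone on the other) gives the isometry.\<close>

theorem Plancherel_L1_L2:
  fixes h :: "'a::euclidean_space \<Rightarrow> complex"
  assumes h: "integrable lborel h" and h2: "square_integrable h"
  shows "square_integrable (fourier_L1 h)" "L2_norm (fourier_L1 h) = L2_norm h"
proof -
  have [measurable]: "h \<in> borel_measurable borel" "gaussian \<in> borel_measurable (borel :: 'a measure)"
      "fourier_L1 h \<in> borel_measurable borel"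
    using borel_measurable_integrable[OF h] borel_measurable_integrable[OF integrable_gaussian]
      borel_measurable_fourier_L1[OF h] by auto
  \<comment> \<open>\<open>C\<close> is the constant of the convolution theorem and also the
    integral of the Gaussian, so it cancels at the end.\<close>
  define C where "C = (2 * pi) powr (real DIM('a) / 2)"
  have C: "C > 0" by (simp add: C_def)
  define h' where "h' x = cnj (h (- x))" for x
  have h': "integrable lborel h'"
  proof -
    have "integrable (distr lborel borel uminus) (\<lambda>x. cnj (h x))"
      using h by (simp add: distr_lborel_uminus)
    thus ?thesis
      unfolding h'_def[abs_def] by (subst (asm) integrable_distr_eq) auto
  qed
  define A where "A = convolution h h'"
  have A: "integrable lborel A"
    unfolding A_def by (rule integrable_convolution[OF h h'])
  hence [measurable]: "A \<in> borel_measurable borel"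
    using borel_measurable_integrable by auto
  have A_eq: "A s = (LINT y|lborel. h (y + s) * cnj (h y))" for s
  proof -
    have "(LINT y|lborel. h (y + s) * cnj (h y)) = (LINT y|lborel. h (- y + s) * cnj (h (- y)))"
      by (rule integral_lborel_reflect[symmetric]) measurable
    thus ?thesis by (simp add: A_def convolution_def h'_def)
  qed
  have FA: "fourier_L1 A \<xi> = complex_of_real (C * (cmod (fourier_L1 h \<xi>))\<^sup>2)" for \<xi>
  proof -
    have "fourier_L1 h' \<xi> = cnj (fourier_L1 h \<xi>)"
      unfolding h'_def[abs_def] by (rule fourier_L1_cnj) measurable
    thus ?thesis
      unfolding A_def fourier_L1_convolution[OF h h'] by (simp add: C_def complex_norm_square del: of_real_power)
  qed
  have cnj_h: "square_integrable (\<lambda>x. cnj (h x))" "L2_norm (\<lambda>x. cnj (h x)) = L2_norm h"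
    using h2 by (auto simp: square_integrable_def L2_norm_def)
  have A_le: "cmod (A s) \<le> (L2_norm h)\<^sup>2" for s
    using norm_integral_mult_le[OF L2_translate(1)[OF h2, of s] cnj_h(1)] L2_translate(2)[OF h2, of s]
    by (simp add: A_eq cnj_h(2) power2_eq_square)
  have A_0: "A 0 = complex_of_real ((L2_norm h)\<^sup>2)"
    unfolding A_eq L2_norm_sq by (simp add: complex_norm_square[symmetric] del: of_real_power)
  have A_lim: "(\<lambda>n. A (s n)) \<longlonglongrightarrow> A 0" if "s \<longlonglongrightarrow> 0" for s
    unfolding A_eq using translate_tendsto_L2[OF h2 that]
    by (intro tendsto_integral_mult) (auto simp: h2 cnj_h L2_translate)
  define a where "a n = inverse (real (Suc n))" for n
  have a: "a n > 0" for n by (simp add: a_def)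
  have a_lim: "a \<longlonglongrightarrow> 0"
    unfolding a_def by (rule LIMSEQ_inverse_real_of_nat)
  define F where "F n \<xi> = (cmod (fourier_L1 h \<xi>))\<^sup>2 * exp (- (norm (a n *\<^sub>R \<xi>))\<^sup>2 / 2)" for n \<xi>
  \<comment> \<open>The transform of an integrable function is bounded, here by \<open>B\<close>, so
    the Gaussian factor alone provides integrability.\<close>
  have F_int: "integrable lborel (F n)" for n
  proof (rule Bochner_Integration.integrable_bound)
    define B where "B = (2 * pi) powr (- real DIM('a) / 2) * (LINT x|lborel. cmod (h x))"
    show "integrable lborel (\<lambda>\<xi>. complex_of_real (B\<^sup>2) * gaussian (a n *\<^sub>R \<xi>))"
      by (intro integrable_mult_right integrable_lborel_scale integrable_gaussian a)
    have "norm (F n \<xi>) \<le> norm (complex_of_real (B\<^sup>2) * gaussian (a n *\<^sub>R \<xi>))" for \<xi>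
    proof -
      have "(cmod (fourier_L1 h \<xi>))\<^sup>2 \<le> B\<^sup>2"
        unfolding B_def by (intro power_mono norm_fourier_L1_le) simp
      thus ?thesis
        by (simp add: F_def gaussian_def norm_mult norm_power mult_right_mono)
    qed
    thus "AE \<xi> in lborel. norm (F n \<xi>) \<le> norm (complex_of_real (B\<^sup>2) * gaussian (a n *\<^sub>R \<xi>))" by simp
    show "F n \<in> borel_measurable lborel"
      unfolding F_def[abs_def] by measurable
  qed
  have F_eq: "complex_of_real (C * (LINT \<xi>|lborel. F n \<xi>)) = (LINT z|lborel. A (a n *\<^sub>R z) * gaussian z)" for n
  proof -
    have "complex_of_real (C * (LINT \<xi>|lborel. F n \<xi>)) = (LINT \<xi>|lborel. complex_of_real (C * F n \<xi>))"
      by (simp only: integral_complex_of_real integral_mult_right_zero)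
    also have "\<dots> = (LINT \<xi>|lborel. fourier_L1 A \<xi> * gaussian (a n *\<^sub>R \<xi>))"
      by (simp add: FA F_def gaussian_def mult.assoc)
    finally show ?thesis
      using gaussian_regularized_integral[OF A a] by simp
  qed
  have "(\<lambda>n. LINT z|lborel. A (a n *\<^sub>R z) * gaussian z) \<longlonglongrightarrow> (LINT z|(lborel :: 'a measure). A 0 * gaussian z)"
  proof (rule integral_dominated_convergence)
    show "integrable lborel (\<lambda>z::'a. (L2_norm h)\<^sup>2 * cmod (gaussian z))"
      using integrable_gaussian by (intro integrable_mult_right integrable_norm)
    show "AE z in lborel. cmod (A (a n *\<^sub>R z) * gaussian z) \<le> (L2_norm h)\<^sup>2 * cmod (gaussian z)" for n
      using A_le by (intro AE_I2) (auto simp: norm_mult intro: mult_right_mono)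
    have "(\<lambda>n. A (a n *\<^sub>R z)) \<longlonglongrightarrow> A 0" for z
      using tendsto_scaleR[OF a_lim tendsto_const[of z]] by (intro A_lim) simp
    thus "AE z in lborel. (\<lambda>n. A (a n *\<^sub>R z) * gaussian z) \<longlonglongrightarrow> A 0 * gaussian z"
      by (intro AE_I2 tendsto_mult tendsto_const)
  qed measurable
  also have "(LINT z|(lborel :: 'a measure). A 0 * gaussian z) = complex_of_real (C * (L2_norm h)\<^sup>2)"
  proof -
    have "fourier_L1 gaussian (0::'a) = 1"
      by (simp only: fourier_L1_gaussian) (simp add: gaussian_def)
    hence "complex_of_real ((2 * pi) powr (- real DIM('a) / 2)) * (LINT z|(lborel :: 'a measure). gaussian z) = 1"
      by (simp add: fourier_L1_def)
    hence "complex_of_real C * (complex_of_real ((2 * pi) powr (- real DIM('a) / 2)) *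
        (LINT z|(lborel :: 'a measure). gaussian z)) = complex_of_real C"
      by simp
    moreover have "complex_of_real C * complex_of_real ((2 * pi) powr (- real DIM('a) / 2)) = 1"
      unfolding C_def of_real_mult[symmetric] powr_add[symmetric] by simp
    ultimately have "(LINT z|(lborel :: 'a measure). gaussian z) = complex_of_real C"
      by (simp only: mult.assoc[symmetric] mult_1)
    thus ?thesis by (simp add: A_0)
  qed
  finally have "(\<lambda>n. complex_of_real (C * (LINT \<xi>|lborel. F n \<xi>))) \<longlonglongrightarrow> complex_of_real (C * (L2_norm h)\<^sup>2)"
    by (simp only: F_eq)
  hence "(\<lambda>n. C * (LINT \<xi>|lborel. F n \<xi>)) \<longlonglongrightarrow> C * (L2_norm h)\<^sup>2"
    by (simp only: tendsto_of_real_iff)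
  from tendsto_divide[OF this tendsto_const[of C]]
  have F_lim: "(\<lambda>n. LINT \<xi>|lborel. F n \<xi>) \<longlonglongrightarrow> (L2_norm h)\<^sup>2"
    using C by simp
  \<comment> \<open>The damping factors increase to 1. Monotone convergence is essential here, since
    it also yields the integrability of the limit.\<close>
  have mono: "AE \<xi> in lborel. mono (\<lambda>n. F n \<xi>)"
    by (intro AE_I2 monoI) (auto simp: F_def a_def power_mult_distrib intro!: mult_left_mono mult_right_mono power_mono)
  have lim: "AE \<xi> in lborel. (\<lambda>n. F n \<xi>) \<longlonglongrightarrow> (cmod (fourier_L1 h \<xi>))\<^sup>2"
  proof (intro AE_I2)
    fix \<xi>
    have "(\<lambda>n. F n \<xi>) \<longlonglongrightarrow> (cmod (fourier_L1 h \<xi>))\<^sup>2 * exp (- (norm (0 *\<^sub>R \<xi>))\<^sup>2 / 2)"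
      unfolding F_def by (intro tendsto_intros a_lim) auto
    thus "(\<lambda>n. F n \<xi>) \<longlonglongrightarrow> (cmod (fourier_L1 h \<xi>))\<^sup>2" by simp
  qed
  have m: "(\<lambda>\<xi>. (cmod (fourier_L1 h \<xi>))\<^sup>2) \<in> borel_measurable lborel" by measurable
  show "square_integrable (fourier_L1 h)"
    using integrable_monotone_convergence[OF F_int mono lim F_lim m] by (simp add: square_integrable_def)
  show "L2_norm (fourier_L1 h) = L2_norm h"
    using integral_monotone_convergence[OF F_int mono lim F_lim m] by (simp add: L2_norm_def[of "fourier_L1 h"])
qed

section \<open>The Fourier transform on \<open>L\<^sup>2\<close>\<close>

lemma tendsto_truncate_ball_L2:
  assumes f: "square_integrable f"
  shows "((\<lambda>R. L2_norm (\<lambda>x. truncate_ball R f x - f x)) \<longlongrightarrow> 0) at_top"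
proof (rule tendsto_at_topI_sequentially)
  fix X :: "nat \<Rightarrow> real" assume X: "filterlim X at_top sequentially"
  show "(\<lambda>n. L2_norm (\<lambda>x. truncate_ball (X n) f x - f x)) \<longlonglongrightarrow> 0"
  proof (rule L2_dominated_convergence(2)[where w = "\<lambda>x. cmod (f x)"])
    note [measurable] = square_integrableD(1)[OF f]
    show "(\<lambda>x. cmod (f x)) \<in> borel_measurable borel" by measurable
    show "integrable lborel (\<lambda>x. (cmod (f x))\<^sup>2)" by (rule square_integrableD(2)[OF f])
    show "(\<lambda>x. truncate_ball (X n) f x - f x) \<in> borel_measurable borel" for n by measurable
    show "AE x in lborel. cmod (truncate_ball (X n) f x - f x) \<le> cmod (f x)" for n
      by (intro AE_I2) (auto simp: truncate_ball_def indicator_def)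
    have "\<forall>\<^sub>F n in sequentially. truncate_ball (X n) f x - f x = 0" for x
      using filterlim_at_top[THEN iffD1, OF X, rule_format, of "norm x"]
      by eventually_elim (auto simp: truncate_ball_def indicator_def)
    thus "AE x in lborel. (\<lambda>n. truncate_ball (X n) f x - f x) \<longlonglongrightarrow> 0"
      by (intro AE_I2 tendsto_eventually)
  qed
qed

lemma fourier_L1_diff:
  assumes "integrable lborel f" "integrable lborel g"
  shows "fourier_L1 (\<lambda>x. f x - g x) \<xi> = fourier_L1 f \<xi> - fourier_L1 g \<xi>"
  using fourier_L1_add[OF assms(1), of "\<lambda>x. - 1 * g x"] fourier_L1_cmult[of "-1" g] assms(2) by simp

lemma L2_norm_fourier_L1_diff:
  assumes "integrable lborel f" "integrable lborel g" "square_integrable f" "square_integrable g"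
  shows "L2_norm (\<lambda>\<xi>. fourier_L1 f \<xi> - fourier_L1 g \<xi>) = L2_norm (\<lambda>x. f x - g x)"
proof -
  have "fourier_L1 (\<lambda>x. f x - g x) = (\<lambda>\<xi>. fourier_L1 f \<xi> - fourier_L1 g \<xi>)"
    by (rule ext) (simp add: fourier_L1_diff assms)
  thus ?thesis
    using Plancherel_L1_L2(2)[of "\<lambda>x. f x - g x"] assms by (simp add: square_integrable_diff)
qed

lemma square_integrable_fourier_truncate:
  "square_integrable f \<Longrightarrow> square_integrable (fourier_L1 (truncate_ball R f))"
  by (intro Plancherel_L1_L2 integrable_truncate_ball square_integrable_truncate_ball)

text \<open>By the isometry the transforms of the truncations lie in L2, so the
  \<open>ennreal\<close> integrals of the definition are squares of finite norms.\<close>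

lemma has_fourier_iff:
  assumes "square_integrable f" "square_integrable g"
  shows "has_fourier f g \<longleftrightarrow>
    ((\<lambda>R. L2_norm (\<lambda>\<xi>. fourier_L1 (truncate_ball R f) \<xi> - g \<xi>)) \<longlongrightarrow> 0) at_top"
proof -
  let ?d = "\<lambda>R. L2_norm (\<lambda>\<xi>. fourier_L1 (truncate_ball R f) \<xi> - g \<xi>)"
  have "(\<integral>\<^sup>+ \<xi>. ennreal ((cmod (fourier_L1 (truncate_ball R f) \<xi> - g \<xi>))\<^sup>2) \<partial>lborel) = ennreal ((?d R)\<^sup>2)" for R
    using L2_sq_eq[OF square_integrable_diff[OF square_integrable_fourier_truncate[OF assms(1)] assms(2)]]
    by (simp add: L2_sq_def)
  hence "has_fourier f g \<longleftrightarrow> ((\<lambda>R. ennreal ((?d R)\<^sup>2)) \<longlongrightarrow> ennreal 0) at_top"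
    by (simp add: has_fourier_def assms)
  also have "\<dots> \<longleftrightarrow> ((\<lambda>R. (?d R)\<^sup>2) \<longlongrightarrow> 0) at_top"
    by (rule tendsto_ennreal_iff) auto
  also have "\<dots> \<longleftrightarrow> (?d \<longlongrightarrow> 0) at_top"
    using tendsto_null_power[of ?d at_top 2] tendsto_real_sqrt[of "\<lambda>R. (?d R)\<^sup>2" 0 at_top] by auto
  finally show ?thesis .
qed

text \<open>By the isometry the error of the truncated transforms equals the error of the
  truncations themselves.\<close>

lemma has_fourier_fourier_L1:
  assumes "integrable lborel f" "square_integrable f"
  shows "has_fourier f (fourier_L1 f)"
  using tendsto_truncate_ball_L2[OF assms(2)] assms Plancherel_L1_L2(1)[OF assms]
  by (simp add: has_fourier_iff L2_norm_fourier_L1_diff integrable_truncate_ball square_integrable_truncate_ball)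

text \<open>By the isometry the transforms of the truncations form a Cauchy family, and L2 is
  complete.\<close>

lemma has_fourier_exists:
  assumes f: "square_integrable f"
  obtains g where "has_fourier f g"
proof -
  let ?T = "\<lambda>R. truncate_ball R f" and ?F = "\<lambda>R. fourier_L1 (truncate_ball R f)"
  note T = integrable_truncate_ball[OF f] square_integrable_truncate_ball[OF f]
  note F = square_integrable_fourier_truncate[OF f]
  let ?e = "\<lambda>R. L2_norm (\<lambda>x. ?T R x - f x)"
  have le: "L2_norm (\<lambda>\<xi>. ?F R \<xi> - ?F S \<xi>) \<le> ?e R + ?e S" for R S
    using L2_norm_diff_triangle[OF T(2)[of R] f T(2)[of S]] L2_norm_minus_commute[of f "?T S"]
    by (simp add: L2_norm_fourier_L1_diff T)
  have e_lim: "(\<lambda>n. ?e (real n)) \<longlonglongrightarrow> 0"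
    using filterlim_compose[OF tendsto_truncate_ball_L2[OF f] filterlim_real_sequentially] by simp
  have "\<exists>M. \<forall>m\<ge>M. \<forall>n\<ge>M. L2_norm (\<lambda>\<xi>. ?F (real m) \<xi> - ?F (real n) \<xi>) < e" if e: "e > 0" for e
  proof -
    obtain M where M: "\<And>n. n \<ge> M \<Longrightarrow> ?e (real n) < e / 2"
      using e_lim by (rule LIMSEQ_null_lessE[where e = "e / 2"]) (use e in auto)
    have "L2_norm (\<lambda>\<xi>. ?F (real m) \<xi> - ?F (real n) \<xi>) < e" if "m \<ge> M" "n \<ge> M" for m n
      using le[of m n] M[OF that(1)] M[OF that(2)] by linarith
    thus ?thesis by blast
  qed
  from L2_complete[OF F this] obtain g where
    g: "square_integrable g" "(\<lambda>n. L2_norm (\<lambda>\<xi>. ?F (real n) \<xi> - g \<xi>)) \<longlonglongrightarrow> 0" by blast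
  \<comment> \<open>Completeness provides \<open>g\<close> along integer radii only. Letting n tend
    to infinity in the triangle inequality bounds the error at every real radius by the truncation
    error, as the limit in \<open>has_fourier\<close> demands.\<close>
  have "L2_norm (\<lambda>\<xi>. ?F R \<xi> - g \<xi>) \<le> ?e R" for R
  proof (rule LIMSEQ_le_const)
    show "(\<lambda>n. ?e R + (?e (real n) + L2_norm (\<lambda>\<xi>. ?F (real n) \<xi> - g \<xi>))) \<longlonglongrightarrow> ?e R"
      using tendsto_add[OF tendsto_const tendsto_add[OF e_lim g(2)], of "?e R"] by simp
    have "L2_norm (\<lambda>\<xi>. ?F R \<xi> - g \<xi>) \<le> ?e R + (?e (real n) + L2_norm (\<lambda>\<xi>. ?F (real n) \<xi> - g \<xi>))" for n
      using L2_norm_diff_triangle[OF F F g(1), of R "real n"] le[of R "real n"] by linarith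
    thus "\<exists>N. \<forall>n\<ge>N. L2_norm (\<lambda>\<xi>. ?F R \<xi> - g \<xi>) \<le>
        ?e R + (?e (real n) + L2_norm (\<lambda>\<xi>. ?F (real n) \<xi> - g \<xi>))" by blast
  qed
  hence "((\<lambda>R. L2_norm (\<lambda>\<xi>. ?F R \<xi> - g \<xi>)) \<longlongrightarrow> 0) at_top"
    by (intro tendsto_sandwich[OF _ _ tendsto_const tendsto_truncate_ball_L2[OF f]]) auto
  hence "has_fourier f g" by (simp add: has_fourier_iff f g)
  thus ?thesis by (rule that)
qed

lemma has_fourier_tendsto:
  assumes "has_fourier f g"
  shows "((\<lambda>R. L2_norm (\<lambda>\<xi>. fourier_L1 (truncate_ball R f) \<xi> - g \<xi>)) \<longlongrightarrow> 0) at_top"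
  using assms has_fourier_iff has_fourier_square_integrable by blast

theorem Plancherel:
  assumes "has_fourier f g"
  shows "L2_norm g = L2_norm f"
proof -
  note si = has_fourier_square_integrable[OF assms]
  have "((\<lambda>R. L2_norm (fourier_L1 (truncate_ball R f))) \<longlongrightarrow> L2_norm g) at_top"
    by (intro tendsto_L2_norm square_integrable_fourier_truncate si has_fourier_tendsto assms)
  moreover have "((\<lambda>R. L2_norm (truncate_ball R f)) \<longlongrightarrow> L2_norm f) at_top"
    by (intro tendsto_L2_norm square_integrable_truncate_ball tendsto_truncate_ball_L2 si)
  moreover have "L2_norm (fourier_L1 (truncate_ball R f)) = L2_norm (truncate_ball R f)" for R
    by (intro Plancherel_L1_L2 integrable_truncate_ball square_integrable_truncate_ball si)
  ultimately show ?thesis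
    using tendsto_unique[OF trivial_limit_at_top_linorder] by fastforce
qed

lemma fourier_multiplication_formula:
  assumes fg: "has_fourier f g" and fg': "has_fourier f' g'"
  shows "(LINT x|lborel. g x * f' x) = (LINT x|lborel. f x * g' x)"
proof (rule tendsto_unique[OF trivial_limit_at_top_linorder])
  note si = has_fourier_square_integrable[OF fg] has_fourier_square_integrable[OF fg']
  show "((\<lambda>R. LINT x|lborel. fourier_L1 (truncate_ball R f) x * truncate_ball R f' x) \<longlongrightarrow>
      (LINT x|lborel. g x * f' x)) at_top"
    by (intro tendsto_integral_mult square_integrable_fourier_truncate square_integrable_truncate_ball
        has_fourier_tendsto fg tendsto_truncate_ball_L2 si)
  have "((\<lambda>R. LINT x|lborel. truncate_ball R f x * fourier_L1 (truncate_ball R f') x) \<longlongrightarrow>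
      (LINT x|lborel. f x * g' x)) at_top"
    by (intro tendsto_integral_mult square_integrable_fourier_truncate square_integrable_truncate_ball
        has_fourier_tendsto fg' tendsto_truncate_ball_L2 si)
  thus "((\<lambda>R. LINT x|lborel. fourier_L1 (truncate_ball R f) x * truncate_ball R f' x) \<longlongrightarrow>
      (LINT x|lborel. f x * g' x)) at_top"
    by (simp add: fourier_L1_multiplication_formula integrable_truncate_ball si)
qed

lemma square_integrable_cnj: "square_integrable f \<Longrightarrow> square_integrable (\<lambda>x. cnj (f x))"
  by (auto simp: square_integrable_def)

lemma L2_norm_cnj: "L2_norm (\<lambda>x. cnj (f x)) = L2_norm f"
  by (simp add: L2_norm_def)

lemma has_fourier_cnj:
  assumes "has_fourier f g"
  shows "has_fourier (\<lambda>x. cnj (f x)) (\<lambda>x. cnj (g (- x)))"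
proof -
  note si = has_fourier_square_integrable[OF assms]
  note [measurable] = has_fourier_borel_measurable(1)[OF assms]
  have "truncate_ball R (\<lambda>x. cnj (f x)) = (\<lambda>x. cnj (truncate_ball R f x))" for R
    by (auto simp: truncate_ball_def indicator_def)
  hence *: "fourier_L1 (truncate_ball R (\<lambda>x. cnj (f x))) \<xi> = cnj (fourier_L1 (truncate_ball R f) (- \<xi>))" for R \<xi>
    by (simp add: fourier_L1_cnj(2))
  have "L2_norm (\<lambda>\<xi>. fourier_L1 (truncate_ball R (\<lambda>x. cnj (f x))) \<xi> - cnj (g (- \<xi>))) =
      L2_norm (\<lambda>\<xi>. fourier_L1 (truncate_ball R f) \<xi> - g \<xi>)" for R
    using L2_reflect(2)[OF square_integrable_diff[OF square_integrable_fourier_truncate[OF si(1), of R] si(2)]]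
      L2_norm_cnj[of "\<lambda>\<xi>. fourier_L1 (truncate_ball R f) (- \<xi>) - g (- \<xi>)"]
    by (simp add: *)
  thus ?thesis
    using has_fourier_tendsto[OF assms] by (simp add: has_fourier_iff L2_reflect(1) si square_integrable_cnj)
qed

lemma has_fourier_cong_AE_right:
  assumes "has_fourier f g" "square_integrable h" "AE \<xi> in lborel. g \<xi> = h \<xi>"
  shows "has_fourier f h"
proof -
  note si = has_fourier_square_integrable[OF assms(1)]
  have "L2_norm (\<lambda>\<xi>. fourier_L1 (truncate_ball R f) \<xi> - g \<xi>) =
      L2_norm (\<lambda>\<xi>. fourier_L1 (truncate_ball R f) \<xi> - h \<xi>)" for R
  proof (rule L2_norm_cong_AE)
    show "AE \<xi> in lborel. fourier_L1 (truncate_ball R f) \<xi> - g \<xi> = fourier_L1 (truncate_ball R f) \<xi> - h \<xi>"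
      using assms(3) by eventually_elim simp
  qed (intro borel_measurable_diff square_integrableD(1)[OF si(2)] square_integrableD(1)[OF assms(2)]
        square_integrableD(1)[OF square_integrable_fourier_truncate[OF si(1)]])+
  thus ?thesis
    using has_fourier_tendsto[OF assms(1)] by (simp add: has_fourier_iff si(1) assms(2))
qed

text \<open>Writing \<open>g\<close> for the transform of \<open>x \<mapsto> f (- x)\<close>, the multiplication formula gives
  \<open>\<langle>g, G\<rangle> = \<parallel>f\<parallel>\<^sup>2\<close>, and \<open>g\<close>, \<open>G\<close> and \<open>f\<close> have the same norm, so that \<open>\<parallel>g - G\<parallel>\<^sup>2 = 0\<close>.\<close>

theorem fourier_inversion:
  assumes Gf: "has_fourier G f"
  shows "has_fourier (\<lambda>x. f (- x)) G"
proof -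
  note si = has_fourier_square_integrable[OF Gf]
  obtain g where g: "has_fourier (\<lambda>x. f (- x)) g"
    by (rule has_fourier_exists[OF L2_reflect(1)[OF si(2)]])
  note sig = has_fourier_square_integrable[OF g]
  have norms: "L2_norm g = L2_norm f" "L2_norm G = L2_norm f"
    using Plancherel[OF g] Plancherel[OF Gf] L2_reflect(2)[OF si(2)] by simp_all
  have inner: "(LINT x|lborel. g x * cnj (G x)) = complex_of_real ((L2_norm f)\<^sup>2)"
  proof -
    have "(LINT x|lborel. g x * cnj (G x)) = (LINT x|lborel. f (- x) * cnj (f (- x)))"
      by (rule fourier_multiplication_formula[OF g has_fourier_cnj[OF Gf]])
    also have "\<dots> = complex_of_real (LINT x|lborel. (cmod (f (- x)))\<^sup>2)"
      by (simp add: complex_norm_square[symmetric] del: of_real_power)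
    finally show ?thesis
      using L2_reflect(2)[OF si(2)] by (simp add: L2_norm_sq[symmetric])
  qed
  have int: "integrable lborel (\<lambda>x. g x * cnj (G x))"
    by (rule integrable_mult_square_integrable(1)[OF sig(2) square_integrable_cnj[OF si(1)]])
  have pt: "(cmod (u - v))\<^sup>2 = (cmod u)\<^sup>2 + (cmod v)\<^sup>2 - 2 * Re (u * cnj v)" for u v
    by (simp only: cmod_power2) (simp add: power2_eq_square algebra_simps)
  have "(L2_norm (\<lambda>x. g x - G x))\<^sup>2 = (L2_norm g)\<^sup>2 + (L2_norm G)\<^sup>2 - 2 * Re (LINT x|lborel. g x * cnj (G x))"
  proof -
    define r where "r x = Re (g x * cnj (G x))" for x
    have "integrable lborel r" "(LINT x|lborel. r x) = Re (LINT x|lborel. g x * cnj (G x))"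
      unfolding r_def[abs_def]
      by (rule integrable_bounded_linear[OF bounded_linear_Re int])
        (rule integral_bounded_linear[OF bounded_linear_Re int])
    thus ?thesis
      unfolding L2_norm_sq pt r_def[symmetric]
      using square_integrableD(2)[OF sig(2)] square_integrableD(2)[OF si(1)] by simp
  qed
  also have "\<dots> = 0" by (simp add: inner norms)
  finally have "L2_norm (\<lambda>x. g x - G x) = 0" by simp
  hence "AE x in lborel. g x = G x"
    using L2_norm_eq_0_iff[OF square_integrable_diff[OF sig(2) si(1)]] by simp
  thus ?thesis by (rule has_fourier_cong_AE_right[OF g si(1)])
qed

text \<open>The preimage is the reflected transform of \<open>G\<close>.\<close>

lemma has_fourier_surj:
  assumes "square_integrable G"
  obtains f where "has_fourier f G"
  using has_fourier_exists[OF assms] fourier_inversion by metis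

lemma has_fourier_diff:
  assumes "has_fourier f g" "has_fourier f' g'"
  shows "has_fourier (\<lambda>x. f x - f' x) (\<lambda>x. g x - g' x)"
  using has_fourier_add[OF assms(1) has_fourier_cmult[OF assms(2), of "-1"]] by simp

lemma has_fourier_inj:
  assumes "has_fourier f g" "has_fourier f' g"
  shows "AE x in lborel. f x = f' x"
proof -
  have "L2_norm (\<lambda>x. f x - f' x) = 0"
    using Plancherel[OF has_fourier_diff[OF assms]] by simp
  thus ?thesis
    using L2_norm_eq_0_iff[OF has_fourier_square_integrable(1)[OF has_fourier_diff[OF assms]]] by simp
qed

text \<open>For an integrable transform this gives a representative of the inverse transform by an
  explicit integral, to which the convolution theorem applies.\<close>

lemma has_fourier_inverse_L1:
  assumes "integrable lborel G" "square_integrable G"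
  shows "has_fourier (\<lambda>x. fourier_L1 G (- x)) G"
  by (rule fourier_inversion[OF has_fourier_fourier_L1[OF assms]])

section \<open>\<open>H\<^sup>q\<close> is an algebra for \<open>q > N / 2\<close>\<close>

abbreviation (input) japanese_bracket :: "'a::euclidean_space \<Rightarrow> real" where
  "japanese_bracket \<xi> \<equiv> sqrt (1 + (norm \<xi>)\<^sup>2)"

text \<open>Triangle inequality in the plane for the vectors (1, |xi|) and (0, |zeta|).\<close>

lemma japanese_bracket_add: "japanese_bracket (\<xi> + \<zeta>) \<le> japanese_bracket \<xi> + japanese_bracket \<zeta>"
proof -
  have "japanese_bracket (\<xi> + \<zeta>) \<le> sqrt ((1 + 0)\<^sup>2 + (norm \<xi> + norm \<zeta>)\<^sup>2)"
    by (intro real_sqrt_le_mono) (simp add: power_mono norm_triangle_ineq)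
  also have "\<dots> \<le> sqrt (1\<^sup>2 + (norm \<xi>)\<^sup>2) + sqrt (0\<^sup>2 + (norm \<zeta>)\<^sup>2)"
    by (rule real_sqrt_sum_squares_triangle_ineq)
  also have "\<dots> \<le> japanese_bracket \<xi> + japanese_bracket \<zeta>"
    by (intro add_mono real_sqrt_le_mono) auto
  finally show ?thesis .
qed

lemma power_add_le_two_power:
  fixes a b :: real
  assumes "a \<ge> 0" "b \<ge> 0"
  shows "(a + b) ^ q \<le> 2 ^ q * (a ^ q + b ^ q)"
proof -
  have "(a + b) ^ q \<le> (2 * max a b) ^ q"
    using assms by (intro power_mono) auto
  also have "\<dots> \<le> 2 ^ q * (a ^ q + b ^ q)"
    using assms by (auto simp: power_mult_distrib max_def)
  finally show ?thesis .
qed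

lemma norm_bessel_weight: "cmod (bessel_weight q g \<xi>) = japanese_bracket \<xi> ^ q * cmod (g \<xi>)"
  by (simp add: bessel_weight_def norm_mult norm_power)

lemma norm_le_norm_bessel_weight: "cmod (g \<xi>) \<le> cmod (bessel_weight q g \<xi>)"
proof -
  have "1 * cmod (g \<xi>) \<le> japanese_bracket \<xi> ^ q * cmod (g \<xi>)"
    by (intro mult_right_mono one_le_power) auto
  thus ?thesis by (simp add: norm_bessel_weight)
qed

text \<open>The weight is dominated by a series of multiples of indicators of the dyadic balls of radius
  \<open>2 ^ k\<close>, which sums up to a geometric series of ratio \<open>2 ^ (N - 2 * q)\<close>.\<close>

lemma square_integrable_inverse_bracket:
  assumes q: "real q > real DIM('a) / 2"
  shows "square_integrable (\<lambda>\<xi>::'a::euclidean_space. complex_of_real (inverse (japanese_bracket \<xi> ^ q)))"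
proof -
  \<comment> \<open>If k > 0 is least with |xi| <= 2^k, then |xi| > 2^(k-1), and the squared weight
    is at most 4^(-q (k-1)). The prefactor 4^q pays for this shift by one, and it also covers the
    unit ball, k = 0.\<close>
  define c where "c k = (4::real) ^ q * inverse (4 ^ q) ^ k" for k :: nat
  have c: "c k \<ge> 0" for k by (simp add: c_def)
  define V where "V = unit_ball_vol (real DIM('a))"
  have V: "V \<ge> 0" by (simp add: V_def)
  have [measurable]: "cball 0 r \<in> sets (borel :: 'a measure)" for r by simp
  have pt: "ennreal ((cmod (complex_of_real (inverse (japanese_bracket \<xi> ^ q))))\<^sup>2) \<le>
      (\<Sum>k. ennreal (c k) * indicator (cball 0 (2 ^ k)) \<xi>)" for \<xi> :: 'a
  proof -
    have sq: "(cmod (complex_of_real (inverse (japanese_bracket \<xi> ^ q))))\<^sup>2 = inverse ((1 + (norm \<xi>)\<^sup>2) ^ q)"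
    proof -
      have "(japanese_bracket \<xi> ^ q)\<^sup>2 = ((japanese_bracket \<xi>)\<^sup>2) ^ q"
        by (simp only: power_mult[symmetric] mult.commute)
      also have "(japanese_bracket \<xi>)\<^sup>2 = 1 + (norm \<xi>)\<^sup>2"
        by simp
      finally have "(inverse (japanese_bracket \<xi> ^ q))\<^sup>2 = inverse ((1 + (norm \<xi>)\<^sup>2) ^ q)"
        by (simp only: power_inverse)
      thus ?thesis by (simp only: norm_of_real power2_abs)
    qed
    define k where "k = (LEAST k::nat. norm \<xi> \<le> 2 ^ k)"
    obtain n where "norm \<xi> < 2 ^ n"
      using real_arch_pow[of 2 "norm \<xi>"] by auto
    hence k: "norm \<xi> \<le> 2 ^ k"
      using LeastI[of "\<lambda>k. norm \<xi> \<le> 2 ^ k" n] by (simp add: k_def)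
    have "inverse ((1 + (norm \<xi>)\<^sup>2) ^ q) \<le> c k"
    proof (cases k)
      case 0
      have "inverse ((1 + (norm \<xi>)\<^sup>2) ^ q) \<le> inverse 1"
        by (rule le_imp_inverse_le) (auto intro: one_le_power)
      also have "inverse 1 \<le> (4::real) ^ q"
        by (simp add: one_le_power)
      finally show ?thesis using 0 by (simp add: c_def)
    next
      case (Suc j)
      hence "\<not> norm \<xi> \<le> 2 ^ j"
        unfolding k_def using not_less_Least[of j "\<lambda>k. norm \<xi> \<le> 2 ^ k"] by (metis lessI)
      hence "((2::real) ^ j)\<^sup>2 \<le> (norm \<xi>)\<^sup>2" by (intro power_mono) auto
      moreover have "((2::real) ^ j)\<^sup>2 = (2\<^sup>2) ^ j"
        by (simp only: power_mult[symmetric] mult.commute)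
      ultimately have "(4::real) ^ j \<le> 1 + (norm \<xi>)\<^sup>2"
        by simp
      hence "((4::real) ^ j) ^ q \<le> (1 + (norm \<xi>)\<^sup>2) ^ q" by (intro power_mono) auto
      hence "inverse ((1 + (norm \<xi>)\<^sup>2) ^ q) \<le> inverse (((4::real) ^ j) ^ q)"
        by (intro le_imp_inverse_le) auto
      also have "((4::real) ^ j) ^ q = (4 ^ q) ^ j"
        by (simp only: power_mult[symmetric] mult.commute)
      also have "inverse (((4::real) ^ q) ^ j) = c k"
        by (simp add: c_def Suc power_inverse)
      finally show ?thesis .
    qed
    hence "ennreal (inverse ((1 + (norm \<xi>)\<^sup>2) ^ q)) \<le> ennreal (c k) * indicator (cball 0 (2 ^ k)) \<xi>"
      using k by (simp add: ennreal_leI)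
    also have "\<dots> = (\<Sum>i\<in>{k}. ennreal (c i) * indicator (cball 0 (2 ^ i)) \<xi>)"
      by (simp only: sum.insert finite.emptyI empty_iff not_False_eq_True sum.empty add_0_right)
    also have "\<dots> \<le> (\<Sum>k. ennreal (c k) * indicator (cball 0 (2 ^ k)) \<xi>)"
      by (rule sum_le_suminf) auto
    finally show ?thesis by (simp only: sq)
  qed
  have "L2_sq (\<lambda>\<xi>::'a. complex_of_real (inverse (japanese_bracket \<xi> ^ q))) \<le>
      (\<integral>\<^sup>+\<xi>. (\<Sum>k. ennreal (c k) * indicator (cball 0 (2 ^ k)) \<xi>) \<partial>(lborel :: 'a measure))"
    unfolding L2_sq_def by (intro nn_integral_mono pt)
  also have "\<dots> = (\<Sum>k. ennreal (c k) * emeasure lborel (cball (0::'a) (2 ^ k)))"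
    by (subst nn_integral_suminf) (auto simp: nn_integral_cmult)
  also have "\<dots> = (\<Sum>k. ennreal (4 ^ q * V * (2 ^ DIM('a) / 4 ^ q) ^ k))"
  proof (intro suminf_cong)
    fix k
    have "c k * (V * (2 ^ k) ^ DIM('a)) = 4 ^ q * V * (2 ^ DIM('a) / 4 ^ q) ^ k"
    proof -
      have "((2::real) ^ k) ^ DIM('a) = (2 ^ DIM('a)) ^ k"
        by (metis power_mult mult.commute)
      hence "inverse (4 ^ q) ^ k * ((2::real) ^ k) ^ DIM('a) = (2 ^ DIM('a) / 4 ^ q) ^ k"
        by (metis power_mult_distrib mult.commute divide_inverse)
      moreover have "x * y * (V * z) = x * V * (y * z)" for x y z
        by (simp add: algebra_simps)
      ultimately show ?thesis unfolding c_def by metis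
    qed
    thus "ennreal (c k) * emeasure lborel (cball (0::'a) (2 ^ k)) = ennreal (4 ^ q * V * (2 ^ DIM('a) / 4 ^ q) ^ k)"
      by (simp add: emeasure_cball V_def[symmetric] ennreal_mult[symmetric] c V)
  qed
  also have "\<dots> = ennreal (\<Sum>k. 4 ^ q * V * (2 ^ DIM('a) / 4 ^ q) ^ k)"
  proof (intro suminf_ennreal2 summable_mult summable_geometric)
    \<comment> \<open>Here q > N/2 enters: it brings the ratio of the geometric series below
      1.\<close>
    have "DIM('a) < 2 * q" using q by linarith
    hence "(2::real) ^ DIM('a) < 2 ^ (2 * q)" by simp
    thus "norm ((2::real) ^ DIM('a) / 4 ^ q) < 1"
      by (simp add: power_mult)
  qed (use V in auto)
  also have "\<dots> < \<infinity>" by simp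
  finally show ?thesis by (simp add: square_integrable_iff)
qed

definition weight_const :: "nat \<Rightarrow> 'a::euclidean_space itself \<Rightarrow> real" where
  "weight_const q _ = L2_norm (\<lambda>\<xi>::'a. complex_of_real (inverse (japanese_bracket \<xi> ^ q)))"

text \<open>Cauchy-Schwarz for the product of the inverse weight with the weighted function. On the
  Fourier side this is the Sobolev embedding of H^q into the bounded continuous functions.\<close>

lemma integrable_of_weighted:
  fixes g :: "'a::euclidean_space \<Rightarrow> complex"
  assumes q: "real q > real DIM('a) / 2" and g: "square_integrable (bessel_weight q g)"
  shows "integrable lborel g" "(LINT x|lborel. cmod (g x)) \<le> weight_const q TYPE('a) * L2_norm (bessel_weight q g)"
proof -
  have eq: "complex_of_real (inverse (japanese_bracket \<xi> ^ q)) * bessel_weight q g \<xi> = g \<xi>" for \<xi>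
  proof -
    have "japanese_bracket \<xi> > 0" by (simp add: add_pos_nonneg)
    hence "inverse (japanese_bracket \<xi> ^ q) * japanese_bracket \<xi> ^ q = 1" by simp
    thus ?thesis
      unfolding bessel_weight_def mult.assoc[symmetric] of_real_mult[symmetric] by simp
  qed
  show "integrable lborel g"
    using integrable_mult_square_integrable(1)[OF square_integrable_inverse_bracket[OF q] g] by (simp only: eq)
  show "(LINT x|lborel. cmod (g x)) \<le> weight_const q TYPE('a) * L2_norm (bessel_weight q g)"
    using integrable_mult_square_integrable(2)[OF square_integrable_inverse_bracket[OF q] g]
    by (simp only: eq weight_const_def)
qed

text \<open>Young's inequality for L2 and L1: weighted Cauchy-Schwarz in the inner integral with
  density \<open>b\<close>, then Tonelli.\<close>

lemma nn_integral_convolution_square_le: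
  fixes a b :: "'a::euclidean_space \<Rightarrow> ennreal"
  assumes [measurable]: "a \<in> borel_measurable borel" "b \<in> borel_measurable borel"
  shows "(\<integral>\<^sup>+x. (\<integral>\<^sup>+y. a (x - y) * b y \<partial>lborel)\<^sup>2 \<partial>lborel) \<le> (\<integral>\<^sup>+x. (a x)\<^sup>2 \<partial>lborel) * (\<integral>\<^sup>+y. b y \<partial>lborel)\<^sup>2"
proof -
  have "(\<integral>\<^sup>+x. (\<integral>\<^sup>+y. a (x - y) * b y \<partial>lborel)\<^sup>2 \<partial>lborel) \<le>
      (\<integral>\<^sup>+x. (\<integral>\<^sup>+y. (a (x - y))\<^sup>2 * b y \<partial>lborel) * (\<integral>\<^sup>+y. b y \<partial>lborel) \<partial>lborel)"
    by (intro nn_integral_mono nn_integral_Cauchy_Schwarz_weighted lborel.sigma_finite_measure_axioms) measurable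
  also have "\<dots> = (\<integral>\<^sup>+x. \<integral>\<^sup>+y. (a (x - y))\<^sup>2 * b y \<partial>lborel \<partial>lborel) * (\<integral>\<^sup>+y. b y \<partial>lborel)"
    by (rule nn_integral_multc) measurable
  also have "\<dots> = (\<integral>\<^sup>+x. (a x)\<^sup>2 \<partial>lborel) * (\<integral>\<^sup>+y. b y \<partial>lborel) * (\<integral>\<^sup>+y. b y \<partial>lborel)"
    by (subst nn_integral_convolution[of "\<lambda>x. (a x)\<^sup>2"]) auto
  finally show ?thesis by (simp add: power2_eq_square mult.assoc)
qed

lemma nn_integral_convolution_commute:
  fixes a b :: "'a::euclidean_space \<Rightarrow> ennreal"
  assumes [measurable]: "a \<in> borel_measurable borel" "b \<in> borel_measurable borel"
  shows "(\<integral>\<^sup>+y. a (x - y) * b y \<partial>lborel) = (\<integral>\<^sup>+y. b (x - y) * a y \<partial>lborel)"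
proof -
  have "(\<integral>\<^sup>+y. b (x - y) * a y \<partial>lborel) = (\<integral>\<^sup>+y. b (x - (y + x)) * a (y + x) \<partial>lborel)"
    by (rule nn_integral_lborel_translate[symmetric]) measurable
  also have "\<dots> = (\<integral>\<^sup>+y. b (x - (- y + x)) * a (- y + x) \<partial>lborel)"
    by (rule nn_integral_lborel_reflect[symmetric]) measurable
  finally show ?thesis by (simp add: mult.commute)
qed

text \<open>Subadditivity lets the weight fall on one factor at a time, which is then in L2, while
  the other factor is in L1. In \<open>B\<close> the factor 2^q comes from
  \<open>power_add_le_two_power\<close>. The factor 2 is the square root of 4, since (I + J)^2 <= 2
  I^2 + 2 J^2 and the integrals of I^2 and J^2 have the same bound.\<close>

lemma bessel_weight_convolution:
  fixes F G :: "'a::euclidean_space \<Rightarrow> complex"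
  assumes q: "real q > real DIM('a) / 2"
    and F: "square_integrable (bessel_weight q F)" and G: "square_integrable (bessel_weight q G)"
    and Fm: "F \<in> borel_measurable borel" and Gm: "G \<in> borel_measurable borel"
  defines "B \<equiv> 2 ^ q * 2 * weight_const q TYPE('a) * L2_norm (bessel_weight q F) * L2_norm (bessel_weight q G)"
  shows "square_integrable (bessel_weight q (convolution F G))"
    and "L2_norm (bessel_weight q (convolution F G)) \<le> B"
proof -
  note [measurable] = Fm Gm borel_measurable_bessel_weight[OF Fm] borel_measurable_bessel_weight[OF Gm]
  note F1 = integrable_of_weighted[OF q F] and G1 = integrable_of_weighted[OF q G]
  have [measurable]: "convolution F G \<in> borel_measurable borel"
    using borel_measurable_integrable[OF integrable_convolution[OF F1(1) G1(1)]] by simp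
  let ?f = "\<lambda>x. ennreal (cmod (F x))" and ?g = "\<lambda>x. ennreal (cmod (G x))"
  let ?wf = "\<lambda>x. ennreal (cmod (bessel_weight q F x))" and ?wg = "\<lambda>x. ennreal (cmod (bessel_weight q G x))"
  let ?I = "\<lambda>x. \<integral>\<^sup>+y. ?wf (x - y) * ?g y \<partial>lborel" and ?J = "\<lambda>x. \<integral>\<^sup>+y. ?wg (x - y) * ?f y \<partial>lborel"
  have pt: "ennreal (cmod (bessel_weight q (convolution F G) x)) \<le> 2 ^ q * (?I x + ?J x)" for x
  proof -
    \<comment> \<open>Where the convolution integral does not converge absolutely, its value is 0 by
      convention and the bound is trivial.\<close>
    have "ennreal (cmod (convolution F G x)) \<le> (\<integral>\<^sup>+y. ennreal (cmod (F (x - y) * G y)) \<partial>lborel)"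
      unfolding convolution_def
      by (cases "integrable lborel (\<lambda>y. F (x - y) * G y)")
        (auto simp: not_integrable_integral_eq intro: integral_norm_bound_ennreal)
    hence "ennreal (cmod (bessel_weight q (convolution F G) x)) \<le>
        ennreal (japanese_bracket x ^ q) * (\<integral>\<^sup>+y. ennreal (cmod (F (x - y) * G y)) \<partial>lborel)"
      by (simp add: norm_bessel_weight ennreal_mult mult_left_mono)
    also have "\<dots> = (\<integral>\<^sup>+y. ennreal (japanese_bracket x ^ q) * ennreal (cmod (F (x - y) * G y)) \<partial>lborel)"
      by (rule nn_integral_cmult[symmetric]) measurable
    also have "\<dots> \<le> (\<integral>\<^sup>+y. 2 ^ q * (?wf (x - y) * ?g y + ?f (x - y) * ?wg y) \<partial>lborel)"
    proof (rule nn_integral_mono)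
      fix y
      have "japanese_bracket x ^ q \<le> (japanese_bracket (x - y) + japanese_bracket y) ^ q"
        using japanese_bracket_add[of "x - y" y] by (intro power_mono) auto
      also have "\<dots> \<le> 2 ^ q * (japanese_bracket (x - y) ^ q + japanese_bracket y ^ q)"
        by (rule power_add_le_two_power) auto
      finally have "japanese_bracket x ^ q * cmod (F (x - y) * G y) \<le>
          2 ^ q * (japanese_bracket (x - y) ^ q + japanese_bracket y ^ q) * cmod (F (x - y) * G y)"
        by (rule mult_right_mono) simp
      also have "\<dots> = 2 ^ q * (cmod (bessel_weight q F (x - y)) * cmod (G y) + cmod (F (x - y)) * cmod (bessel_weight q G y))"
        by (simp add: norm_bessel_weight norm_mult algebra_simps)
      finally have "ennreal (japanese_bracket x ^ q * cmod (F (x - y) * G y)) \<le>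
        ennreal (2 ^ q * (cmod (bessel_weight q F (x - y)) * cmod (G y) + cmod (F (x - y)) * cmod (bessel_weight q G y)))"
        by (rule ennreal_leI)
      thus "ennreal (japanese_bracket x ^ q) * ennreal (cmod (F (x - y) * G y)) \<le>
          2 ^ q * (?wf (x - y) * ?g y + ?f (x - y) * ?wg y)"
        by (simp add: ennreal_mult ennreal_power[symmetric])
    qed
    also have "\<dots> = 2 ^ q * (?I x + (\<integral>\<^sup>+y. ?f (x - y) * ?wg y \<partial>lborel))"
      by (simp add: nn_integral_cmult nn_integral_add)
    also have "(\<integral>\<^sup>+y. ?f (x - y) * ?wg y \<partial>lborel) = ?J x"
      by (rule nn_integral_convolution_commute) measurable
    finally show ?thesis .
  qed
  let ?P = "L2_norm (bessel_weight q F) * (weight_const q TYPE('a) * L2_norm (bessel_weight q G))"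
  have Young: "(\<integral>\<^sup>+x. (\<integral>\<^sup>+y. ennreal (cmod (bessel_weight q U (x - y))) * ennreal (cmod (V y)) \<partial>lborel)\<^sup>2 \<partial>lborel) \<le>
      ennreal ((L2_norm (bessel_weight q U) * (weight_const q TYPE('a) * L2_norm (bessel_weight q V)))\<^sup>2)"
    if "U \<in> borel_measurable borel" "V \<in> borel_measurable borel"
      "square_integrable (bessel_weight q U)" "square_integrable (bessel_weight q V)"
    for U V :: "'a \<Rightarrow> complex"
  proof -
    note [measurable] = that(1,2) borel_measurable_bessel_weight[OF that(1)]
    have V1: "(\<integral>\<^sup>+y. ennreal (cmod (V y)) \<partial>lborel) \<le> ennreal (weight_const q TYPE('a) * L2_norm (bessel_weight q V))"
      using integrable_of_weighted[OF q that(4)] by (subst nn_integral_eq_integral) (auto intro: ennreal_leI)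
    have "(\<integral>\<^sup>+x. (\<integral>\<^sup>+y. ennreal (cmod (bessel_weight q U (x - y))) * ennreal (cmod (V y)) \<partial>lborel)\<^sup>2 \<partial>lborel) \<le>
        (\<integral>\<^sup>+x. (ennreal (cmod (bessel_weight q U x)))\<^sup>2 \<partial>lborel) * (\<integral>\<^sup>+y. ennreal (cmod (V y)) \<partial>lborel)\<^sup>2"
      by (rule nn_integral_convolution_square_le) measurable
    also have "\<dots> \<le> ennreal ((L2_norm (bessel_weight q U))\<^sup>2) *
        (ennreal (weight_const q TYPE('a) * L2_norm (bessel_weight q V)))\<^sup>2"
      using L2_sq_eq[OF that(3)] V1 by (intro mult_mono power_mono) (auto simp: L2_sq_def ennreal_power)
    also have "\<dots> = ennreal ((L2_norm (bessel_weight q U) * (weight_const q TYPE('a) * L2_norm (bessel_weight q V)))\<^sup>2)"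
      by (simp add: ennreal_power weight_const_def power_mult_distrib flip: ennreal_mult)
    finally show ?thesis .
  qed
  have B: "B \<ge> 0" by (simp add: B_def weight_const_def)
  have "L2_sq (bessel_weight q (convolution F G)) \<le> (\<integral>\<^sup>+x. (2 ^ q)\<^sup>2 * (2 * (?I x)\<^sup>2 + 2 * (?J x)\<^sup>2) \<partial>lborel)"
    unfolding L2_sq_def
  proof (rule nn_integral_mono)
    fix x
    have "ennreal ((cmod (bessel_weight q (convolution F G) x))\<^sup>2) = (ennreal (cmod (bessel_weight q (convolution F G) x)))\<^sup>2"
      by (simp add: ennreal_power)
    also have "\<dots> \<le> (2 ^ q * (?I x + ?J x))\<^sup>2"
      by (intro power_mono pt) simp
    also have "\<dots> = (2 ^ q)\<^sup>2 * (?I x + ?J x)\<^sup>2"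
      by (rule power_mult_distrib)
    also have "\<dots> \<le> (2 ^ q)\<^sup>2 * (2 * (?I x)\<^sup>2 + 2 * (?J x)\<^sup>2)"
    proof (rule mult_left_mono)
      have "(?I x + ?J x)\<^sup>2 = ((?I x)\<^sup>2 + (?J x)\<^sup>2) + 2 * (?I x * ?J x)"
        by (simp add: power2_eq_square algebra_simps mult_2)
      also have "\<dots> \<le> ((?I x)\<^sup>2 + (?J x)\<^sup>2) + ((?I x)\<^sup>2 + (?J x)\<^sup>2)"
        by (intro add_left_mono ennreal_two_mult_le)
      finally show "(?I x + ?J x)\<^sup>2 \<le> 2 * (?I x)\<^sup>2 + 2 * (?J x)\<^sup>2"
        by (simp add: mult_2 ac_simps)
    qed simp
    finally show "ennreal ((cmod (bessel_weight q (convolution F G) x))\<^sup>2) \<le> (2 ^ q)\<^sup>2 * (2 * (?I x)\<^sup>2 + 2 * (?J x)\<^sup>2)" .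
  qed
  also have "\<dots> = (2 ^ q)\<^sup>2 * (2 * (\<integral>\<^sup>+x. (?I x)\<^sup>2 \<partial>lborel) + 2 * (\<integral>\<^sup>+x. (?J x)\<^sup>2 \<partial>lborel))"
    by (simp add: nn_integral_cmult nn_integral_add)
  also have "\<dots> \<le> (2 ^ q)\<^sup>2 * (2 * ennreal (?P\<^sup>2) + 2 * ennreal (?P\<^sup>2))"
    using Young[OF Fm Gm F G] Young[OF Gm Fm G F]
    by (intro mult_left_mono add_mono) (auto simp: ac_simps)
  also have "\<dots> = ennreal (B\<^sup>2)"
  proof -
    have "(2 ^ q)\<^sup>2 * (2 * ennreal (?P\<^sup>2) + 2 * ennreal (?P\<^sup>2)) = ennreal ((2 ^ q)\<^sup>2 * (2 * ?P\<^sup>2 + 2 * ?P\<^sup>2))"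
    proof -
      have two: "2 * ennreal p = ennreal (2 * p)" if "p \<ge> 0" for p
        using that by (simp add: ennreal_mult)
      have pow: "((2::ennreal) ^ q)\<^sup>2 = ennreal ((2 ^ q)\<^sup>2)"
        by (simp add: ennreal_power[symmetric])
      show ?thesis
        by (simp add: two pow ennreal_mult[symmetric] flip: ennreal_plus)
    qed
    also have "(2 ^ q)\<^sup>2 * (2 * ?P\<^sup>2 + 2 * ?P\<^sup>2) = B\<^sup>2"
      by (simp add: B_def power_mult_distrib)
    finally show ?thesis .
  qed
  finally have *: "L2_sq (bessel_weight q (convolution F G)) \<le> ennreal (B\<^sup>2)" .
  show si: "square_integrable (bessel_weight q (convolution F G))"
    using le_less_trans[OF * ennreal_less_top]
    by (simp add: square_integrable_iff borel_measurable_bessel_weight)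
  show "L2_norm (bessel_weight q (convolution F G)) \<le> B"
    by (rule power2_le_imp_le) (use * B in \<open>simp_all add: L2_sq_eq[OF si]\<close>)
qed

text \<open>Since F and G are integrable, f and g agree almost everywhere with explicit inverse
  integrals. The convolution theorem identifies the product of these with a multiple of the inverse
  integral of the convolution, and inversion applies because the convolution lies in L1 and in
  L2.\<close>

lemma has_fourier_mult:
  fixes f g F G :: "'a::euclidean_space \<Rightarrow> complex"
  assumes q: "real q > real DIM('a) / 2"
    and f: "has_fourier f F" "square_integrable (bessel_weight q F)"
    and g: "has_fourier g G" "square_integrable (bessel_weight q G)"
  shows "has_fourier (\<lambda>x. f x * g x)
    (\<lambda>\<xi>. complex_of_real ((2 * pi) powr (- real DIM('a) / 2)) * convolution F G \<xi>)"
proof -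
  let ?c = "complex_of_real ((2 * pi) powr (- real DIM('a) / 2))"
  note si = has_fourier_square_integrable[OF f(1)] has_fourier_square_integrable[OF g(1)]
  note [measurable] = square_integrableD(1)[OF si(1)] square_integrableD(1)[OF si(2)]
    square_integrableD(1)[OF si(3)] square_integrableD(1)[OF si(4)]
  note F1 = integrable_of_weighted(1)[OF q f(2)] and G1 = integrable_of_weighted(1)[OF q g(2)]
  have H1: "integrable lborel (convolution F G)"
    by (rule integrable_convolution[OF F1 G1])
  have H2: "square_integrable (convolution F G)"
    using borel_measurable_integrable[OF H1] norm_le_norm_bessel_weight
    by (intro square_integrable_bound[OF _ bessel_weight_convolution(1)[OF q f(2) g(2)]]) auto
  have "has_fourier (\<lambda>x. ?c * fourier_L1 (convolution F G) (- x)) (\<lambda>\<xi>. ?c * convolution F G \<xi>)"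
    by (rule has_fourier_cmult[OF has_fourier_inverse_L1[OF H1 H2]])
  moreover have "?c * fourier_L1 (convolution F G) (- x) = fourier_L1 F (- x) * fourier_L1 G (- x)" for x
  proof -
    have "?c * complex_of_real ((2 * pi) powr (real DIM('a) / 2)) = 1"
      unfolding of_real_mult[symmetric] powr_add[symmetric] by simp
    thus ?thesis
      unfolding fourier_L1_convolution[OF F1 G1] mult.assoc[symmetric] by simp
  qed
  ultimately have H: "has_fourier (\<lambda>x. fourier_L1 F (- x) * fourier_L1 G (- x)) (\<lambda>\<xi>. ?c * convolution F G \<xi>)"
    by simp
  have "AE x in lborel. f x = fourier_L1 F (- x)" "AE x in lborel. g x = fourier_L1 G (- x)"
    using has_fourier_inj[OF f(1) has_fourier_inverse_L1[OF F1 si(2)]]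
      has_fourier_inj[OF g(1) has_fourier_inverse_L1[OF G1 si(4)]] by auto
  hence eq: "AE x in lborel. f x * g x = fourier_L1 F (- x) * fourier_L1 G (- x)"
    by eventually_elim simp
  have "square_integrable (\<lambda>x. f x * g x)"
    using square_integrable_cong_AE[OF _ _ eq] has_fourier_square_integrable(1)[OF H]
      square_integrableD(1)[OF has_fourier_square_integrable(1)[OF H]] by auto
  from has_fourier_cong_AE[OF this has_fourier_square_integrable(1)[OF H] eq] H show ?thesis by simp
qed

lemma L2_norm_le_bessel_weight:
  assumes "square_integrable (bessel_weight q F)" "F \<in> borel_measurable borel"
  shows "square_integrable F" "L2_norm F \<le> L2_norm (bessel_weight q F)"
  using norm_le_norm_bessel_weight[of F _ q] assms
  by (auto intro!: square_integrable_bound[OF _ assms(1)] L2_norm_mono)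

lemma sobolev_norm_eq:
  assumes "has_fourier f F" "square_integrable (bessel_weight q F)"
  shows "in_sobolev q f" "sobolev_norm q f = sqrt ((L2_norm F)\<^sup>2 + (L2_norm (bessel_weight q F))\<^sup>2)"
proof -
  show "in_sobolev q f" using assms by (auto simp: in_sobolev_def)
  thus "sobolev_norm q f = sqrt ((L2_norm F)\<^sup>2 + (L2_norm (bessel_weight q F))\<^sup>2)"
    using Plancherel[OF assms(1)] L2_norm_bessel_fourier[OF _ assms(1), of q] by (simp add: sobolev_norm_def)
qed

text \<open>The norm also contains the plain L2 norm, which the weighted one dominates. This is the
  origin of the factor 2.\<close>

lemma sobolev_norm_bounds:
  assumes "has_fourier f F" "square_integrable (bessel_weight q F)"
  shows "L2_norm (bessel_weight q F) \<le> sobolev_norm q f" "sobolev_norm q f \<le> 2 * L2_norm (bessel_weight q F)"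
proof -
  show "L2_norm (bessel_weight q F) \<le> sobolev_norm q f"
    unfolding sobolev_norm_eq(2)[OF assms] by (rule real_le_rsqrt) simp
  have "sobolev_norm q f \<le> L2_norm F + L2_norm (bessel_weight q F)"
    unfolding sobolev_norm_eq(2)[OF assms] by (rule sqrt_sum_squares_le_sum) auto
  thus "sobolev_norm q f \<le> 2 * L2_norm (bessel_weight q F)"
    using L2_norm_le_bessel_weight(2)[OF assms(2) has_fourier_borel_measurable(2)[OF assms(1)]] by linarith
qed

text \<open>The leading 2 stems from \<open>sobolev_norm_bounds\<close>, the power of 2 pi from the
  normalisation in \<open>has_fourier_mult\<close>, and the rest from
  \<open>bessel_weight_convolution\<close>.\<close>

definition algebra_const :: "nat \<Rightarrow> 'a::euclidean_space itself \<Rightarrow> real" where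
  "algebra_const q _ = 2 * ((2 * pi) powr (- real DIM('a) / 2) * (2 ^ q * 2 * weight_const q TYPE('a)))"

theorem sobolev_algebra:
  fixes f g :: "'a::euclidean_space \<Rightarrow> complex"
  assumes q: "real q > real DIM('a) / 2" and f: "in_sobolev q f" and g: "in_sobolev q g"
  shows "in_sobolev q (\<lambda>x. f x * g x)"
    and "sobolev_norm q (\<lambda>x. f x * g x) \<le> algebra_const q TYPE('a) * (sobolev_norm q f * sobolev_norm q g)"
proof -
  let ?c = "(2 * pi) powr (- real DIM('a) / 2)"
  let ?F = "fourier_L2 f" and ?G = "fourier_L2 g"
  note F = in_sobolev_fourier_L2[OF f] and G = in_sobolev_fourier_L2[OF g]
  note Fm = has_fourier_borel_measurable(2)[OF F(1)] and Gm = has_fourier_borel_measurable(2)[OF G(1)]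
  note conv = bessel_weight_convolution[OF q F(2) G(2) Fm Gm]
  let ?H = "\<lambda>\<xi>. complex_of_real ?c * convolution ?F ?G \<xi>"
  have H: "has_fourier (\<lambda>x. f x * g x) ?H"
    by (rule has_fourier_mult[OF q F G])
  have wH: "square_integrable (bessel_weight q ?H)"
    unfolding bessel_weight_cmult by (rule square_integrable_cmult[OF conv(1)])
  show "in_sobolev q (\<lambda>x. f x * g x)"
    using H wH by (auto simp: in_sobolev_def)
  have W: "weight_const q TYPE('a) \<ge> 0" by (simp add: weight_const_def)
  have "sobolev_norm q (\<lambda>x. f x * g x) \<le> 2 * L2_norm (bessel_weight q ?H)"
    by (rule sobolev_norm_bounds(2)[OF H wH])
  also have "L2_norm (bessel_weight q ?H) = ?c * L2_norm (bessel_weight q (convolution ?F ?G))"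
    unfolding bessel_weight_cmult L2_norm_cmult by simp
  also have "2 * (?c * L2_norm (bessel_weight q (convolution ?F ?G))) \<le>
      2 * (?c * (2 ^ q * 2 * weight_const q TYPE('a) * L2_norm (bessel_weight q ?F) * L2_norm (bessel_weight q ?G)))"
    using conv(2) by (intro mult_left_mono) auto
  also have "\<dots> = algebra_const q TYPE('a) * (L2_norm (bessel_weight q ?F) * L2_norm (bessel_weight q ?G))"
    by (simp add: algebra_const_def)
  also have "\<dots> \<le> algebra_const q TYPE('a) * (sobolev_norm q f * sobolev_norm q g)"
    using sobolev_norm_bounds(1)[OF F] sobolev_norm_bounds(1)[OF G] W
    by (intro mult_left_mono mult_mono) (auto simp: algebra_const_def intro: order_trans[OF L2_norm_nonneg])
  finally show "sobolev_norm q (\<lambda>x. f x * g x) \<le> algebra_const q TYPE('a) * (sobolev_norm q f * sobolev_norm q g)" .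
qed

text \<open>Conjugation of f conjugates and reflects its transform, and the weight is even.\<close>

lemma sobolev_cnj:
  assumes f: "in_sobolev q f"
  shows "in_sobolev q (\<lambda>x. cnj (f x))" "sobolev_norm q (\<lambda>x. cnj (f x)) = sobolev_norm q f"
proof -
  note F = in_sobolev_fourier_L2[OF f]
  note si = has_fourier_square_integrable[OF F(1)]
  let ?G = "\<lambda>\<xi>. cnj (fourier_L2 f (- \<xi>))"
  have G: "has_fourier (\<lambda>x. cnj (f x)) ?G"
    by (rule has_fourier_cnj[OF F(1)])
  have eq: "bessel_weight q ?G = (\<lambda>\<xi>. cnj (bessel_weight q (fourier_L2 f) (- \<xi>)))"
    by (simp add: bessel_weight_def fun_eq_iff)
  have wG: "square_integrable (bessel_weight q ?G)"
    unfolding eq by (intro square_integrable_cnj L2_reflect F(2))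
  show "in_sobolev q (\<lambda>x. cnj (f x))"
    by (rule sobolev_norm_eq(1)[OF G wG])
  show "sobolev_norm q (\<lambda>x. cnj (f x)) = sobolev_norm q f"
    unfolding sobolev_norm_eq(2)[OF G wG] sobolev_norm_eq(2)[OF F]
    by (simp add: eq L2_norm_cnj L2_reflect(2)[OF F(2)] L2_reflect(2)[OF si(2)])
qed


section \<open>The Banach space \<open>H\<^sup>q\<close>\<close>

lemma in_sobolev_rep: "in_sobolev LENGTH('q) (rep_sobolev (u :: ('q::len0, 'n::finite) sobolev))"
  using Quotient_rep_reflp[OF Quotient_sobolev, of u] by (simp add: sobolev_rel_refl)

lemma abs_sobolev_rep: "abs_sobolev (rep_sobolev (u :: ('q::len0, 'n::finite) sobolev)) = u"
  by (rule Quotient_abs_rep[OF Quotient_sobolev])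

lemma rep_abs_sobolev:
  fixes f :: "real^'n::finite \<Rightarrow> complex"
  assumes "in_sobolev LENGTH('q::len0) f"
  shows "AE x in lborel. rep_sobolev (abs_sobolev f :: ('q, 'n) sobolev) x = f x"
proof -
  have "sobolev_rel TYPE('q) (rep_sobolev (abs_sobolev f :: ('q, 'n) sobolev)) f"
    by (rule Quotient_rep_abs[OF Quotient_sobolev]) (simp add: sobolev_rel_refl assms)
  thus ?thesis by (simp add: sobolev_rel_def)
qed

lemma sobolev_eqI:
  fixes u v :: "('q::len0, 'n::finite) sobolev"
  assumes "AE x in lborel. rep_sobolev u x = rep_sobolev v x"
  shows "u = v"
proof -
  have "sobolev_rel TYPE('q) (rep_sobolev u) (rep_sobolev v)"
    using assms by (simp add: sobolev_rel_def in_sobolev_rep)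
  thus ?thesis
    using Quotient_rel_rep[OF Quotient_sobolev] by blast
qed

lemma norm_sobolev_eq: "norm (u :: ('q::len0, 'n::finite) sobolev) = sobolev_norm LENGTH('q) (rep_sobolev u)"
proof -
  have "norm (abs_sobolev (rep_sobolev u) :: ('q, 'n) sobolev) = sobolev_norm LENGTH('q) (rep_sobolev u)"
    by (rule norm_sobolev.abs_eq) (simp add: sobolev_rel_refl in_sobolev_rep)
  thus ?thesis by (simp add: abs_sobolev_rep)
qed

lemma norm_abs_sobolev:
  fixes f :: "real^'n::finite \<Rightarrow> complex"
  assumes "in_sobolev LENGTH('q::len0) f"
  shows "norm (abs_sobolev f :: ('q, 'n) sobolev) = sobolev_norm LENGTH('q) f"
  using assms by (simp add: norm_sobolev.abs_eq sobolev_rel_refl)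

lemma abs_sobolev_add:
  fixes f g :: "real^'n::finite \<Rightarrow> complex"
  assumes "in_sobolev LENGTH('q::len0) f" "in_sobolev LENGTH('q) g"
  shows "(abs_sobolev f :: ('q, 'n) sobolev) + abs_sobolev g = abs_sobolev (\<lambda>x. f x + g x)"
  using assms by (simp add: plus_sobolev.abs_eq sobolev_rel_refl)

lemma rep_sobolev_add: "AE x in lborel. rep_sobolev (u + v) x = rep_sobolev u x + rep_sobolev v x"
  for u v :: "('q::len0, 'n::finite) sobolev"
  using rep_abs_sobolev[OF in_sobolev_add[OF in_sobolev_rep[of u] in_sobolev_rep[of v]]]
  by (simp add: abs_sobolev_add[OF in_sobolev_rep in_sobolev_rep, symmetric] abs_sobolev_rep)

lemma rep_sobolev_scaleC: "AE x in lborel. rep_sobolev (c *\<^sub>C u) x = c * rep_sobolev u x"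
  for u :: "('q::len0, 'n::finite) sobolev"
proof -
  have "c *\<^sub>C abs_sobolev (rep_sobolev u) = (abs_sobolev (\<lambda>x. c * rep_sobolev u x) :: ('q, 'n) sobolev)"
    using in_sobolev_rep[of u] by (simp add: scaleC.abs_eq sobolev_rel_refl)
  thus ?thesis
    using rep_abs_sobolev[OF in_sobolev_cmult[OF in_sobolev_rep[of u], of c]] by (simp add: abs_sobolev_rep)
qed

lemma rep_sobolev_diff: "AE x in lborel. rep_sobolev (u - v) x = rep_sobolev u x - rep_sobolev v x"
  for u v :: "('q::len0, 'n::finite) sobolev"
  using rep_sobolev_add[of u "- v"] rep_sobolev_scaleC[of "-1" v]
  unfolding minus_sobolev_def uminus_sobolev_def by eventually_elim simp

lemma rep_sobolev_scaleR: "AE x in lborel. rep_sobolev (r *\<^sub>R u) x = complex_of_real r * rep_sobolev u x"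
  for u :: "('q::len0, 'n::finite) sobolev"
  unfolding scaleR_sobolev_def by (rule rep_sobolev_scaleC)

definition sobolev_fourier :: "('q::len0, 'n::finite) sobolev \<Rightarrow> real^'n \<Rightarrow> complex" where
  "sobolev_fourier u = fourier_L2 (rep_sobolev u)"

lemma sobolev_fourier:
  fixes u :: "('q::len0, 'n::finite) sobolev"
  shows "has_fourier (rep_sobolev u) (sobolev_fourier u)"
    and "square_integrable (bessel_weight LENGTH('q) (sobolev_fourier u))"
  using in_sobolev_fourier_L2[OF in_sobolev_rep[of u]] by (simp_all add: sobolev_fourier_def)

lemma has_fourier_rep_cong:
  fixes u :: "('q::len0, 'n::finite) sobolev"
  assumes "has_fourier f F" "AE x in lborel. rep_sobolev u x = f x"
  shows "has_fourier (rep_sobolev u) F"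
  using has_fourier_cong_AE[OF _ _ assms(2)] has_fourier_square_integrable(1)[OF assms(1)]
    has_fourier_square_integrable(1)[OF sobolev_fourier(1)[of u]] assms(1) by simp

text \<open>Formulated with arbitrary transforms, because the chosen transform of a sum need only
  agree almost everywhere with the sum of the chosen ones.\<close>

lemma has_fourier_rep_linear:
  fixes u v :: "('q::len0, 'n::finite) sobolev"
  assumes "has_fourier (rep_sobolev u) F" "has_fourier (rep_sobolev v) G"
  shows "has_fourier (rep_sobolev (u + v)) (\<lambda>\<xi>. F \<xi> + G \<xi>)"
    and "has_fourier (rep_sobolev (u - v)) (\<lambda>\<xi>. F \<xi> - G \<xi>)"
    and "has_fourier (rep_sobolev (c *\<^sub>C u)) (\<lambda>\<xi>. c * F \<xi>)"
  by (rule has_fourier_rep_cong[OF has_fourier_add[OF assms] rep_sobolev_add]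
      has_fourier_rep_cong[OF has_fourier_diff[OF assms] rep_sobolev_diff]
      has_fourier_rep_cong[OF has_fourier_cmult[OF assms(1)] rep_sobolev_scaleC])+

lemma has_fourier_rep_weighted:
  fixes u :: "('q::len0, 'n::finite) sobolev"
  assumes "has_fourier (rep_sobolev u) F"
  shows "square_integrable (bessel_weight LENGTH('q) F)"
proof -
  note [measurable] = has_fourier_borel_measurable(2)[OF assms] has_fourier_borel_measurable(2)[OF sobolev_fourier(1)[of u]]
  have "AE \<xi> in lborel. bessel_weight LENGTH('q) F \<xi> = bessel_weight LENGTH('q) (sobolev_fourier u) \<xi>"
    using has_fourier_unique[OF assms sobolev_fourier(1)] by eventually_elim (simp add: bessel_weight_def)
  thus ?thesis
    using sobolev_fourier(2)[of u] square_integrable_cong_AE borel_measurable_bessel_weight assms sobolev_fourier(1)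
      has_fourier_borel_measurable(2) by blast
qed

lemma norm_sobolev_fourier:
  fixes u :: "('q::len0, 'n::finite) sobolev"
  assumes "has_fourier (rep_sobolev u) F"
  shows "norm u = sqrt ((L2_norm F)\<^sup>2 + (L2_norm (bessel_weight LENGTH('q) F))\<^sup>2)"
    and "L2_norm (bessel_weight LENGTH('q) F) \<le> norm u"
    and "norm u \<le> 2 * L2_norm (bessel_weight LENGTH('q) F)"
  unfolding norm_sobolev_eq
  by (rule sobolev_norm_eq[OF assms has_fourier_rep_weighted[OF assms]]
      sobolev_norm_bounds[OF assms has_fourier_rep_weighted[OF assms]])+

lemma sobolev_eqI_fourier:
  assumes "has_fourier (rep_sobolev u) F" "has_fourier (rep_sobolev v) F"
  shows "u = v"
  by (rule sobolev_eqI[OF has_fourier_inj[OF assms]])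

text \<open>Surjectivity and injectivity of the transform on L2. This is what gives the definite
  description in \<open>schroedinger_group\<close> its meaning.\<close>

lemma sobolev_of_fourier_exists:
  fixes G :: "real^'n::finite \<Rightarrow> complex"
  assumes "square_integrable (bessel_weight LENGTH('q::len0) G)" "G \<in> borel_measurable borel"
  shows "\<exists>!u :: ('q, 'n) sobolev. has_fourier (rep_sobolev u) G"
proof (rule ex_ex1I)
  obtain f where f: "has_fourier f G"
    by (rule has_fourier_surj[OF L2_norm_le_bessel_weight(1)[OF assms]])
  have "in_sobolev LENGTH('q) f" by (rule sobolev_norm_eq(1)[OF f assms(1)])
  thus "\<exists>u :: ('q, 'n) sobolev. has_fourier (rep_sobolev u) G"
    using has_fourier_rep_cong[OF f rep_abs_sobolev] by blast
qed (rule sobolev_eqI_fourier)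

text \<open>The weighted transform maps H^q onto L2 and is bounded in both directions, so
  completeness of L2 carries over. Dividing the L2 limit \<open>P\<close> by the weight gives the
  transform of the limit in H^q.\<close>

instance sobolev :: (len0, finite) banach
proof
  fix X :: "nat \<Rightarrow> ('a, 'b) sobolev"
  assume X: "Cauchy X"
  let ?w = "\<lambda>F. bessel_weight LENGTH('a) F"
  let ?F = "\<lambda>n. sobolev_fourier (X n)"
  have diff: "?w (\<lambda>\<xi>. f \<xi> - g \<xi>) = (\<lambda>\<xi>. ?w f \<xi> - ?w g \<xi>)" for f g :: "real^'b \<Rightarrow> complex"
    by (simp add: bessel_weight_def fun_eq_iff algebra_simps)
  have "\<exists>M. \<forall>m\<ge>M. \<forall>n\<ge>M. L2_norm (\<lambda>\<xi>. ?w (?F m) \<xi> - ?w (?F n) \<xi>) < e" if "e > 0" for e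
  proof -
    obtain M where M: "\<And>m n. m \<ge> M \<Longrightarrow> n \<ge> M \<Longrightarrow> norm (X m - X n) < e"
      using X \<open>e > 0\<close> unfolding Cauchy_iff by blast
    have "L2_norm (\<lambda>\<xi>. ?w (?F m) \<xi> - ?w (?F n) \<xi>) \<le> norm (X m - X n)" for m n
      using norm_sobolev_fourier(2)[OF has_fourier_rep_linear(2)[OF sobolev_fourier(1)[of "X m"] sobolev_fourier(1)[of "X n"]]]
      by (simp add: diff)
    thus ?thesis using M le_less_trans by blast
  qed
  from L2_complete[OF sobolev_fourier(2)[of "X _"] this]
  obtain P where P: "square_integrable P" "(\<lambda>n. L2_norm (\<lambda>\<xi>. ?w (?F n) \<xi> - P \<xi>)) \<longlonglongrightarrow> 0" by blast
  define G where "G \<xi> = complex_of_real (inverse (japanese_bracket \<xi> ^ LENGTH('a))) * P \<xi>" for \<xi>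
  have [measurable]: "P \<in> borel_measurable borel" by (rule square_integrableD(1)[OF P(1)])
  have G: "G \<in> borel_measurable borel" unfolding G_def[abs_def] by measurable
  have wG: "?w G = P"
  proof
    fix \<xi> :: "real^'b"
    have "japanese_bracket \<xi> > 0" by (simp add: add_pos_nonneg)
    hence "japanese_bracket \<xi> ^ LENGTH('a) * inverse (japanese_bracket \<xi> ^ LENGTH('a)) = 1" by simp
    thus "?w G \<xi> = P \<xi>"
      unfolding bessel_weight_def G_def mult.assoc[symmetric] of_real_mult[symmetric] by simp
  qed
  obtain u :: "('a, 'b) sobolev" where u: "has_fourier (rep_sobolev u) G"
    using sobolev_of_fourier_exists[where 'q = 'a, of G] P(1) G by (auto simp: wG)
  have "norm (X n - u) \<le> 2 * L2_norm (\<lambda>\<xi>. ?w (?F n) \<xi> - P \<xi>)" for n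
    using norm_sobolev_fourier(3)[OF has_fourier_rep_linear(2)[OF sobolev_fourier(1)[of "X n"] u]]
    by (simp add: diff wG)
  moreover have "(\<lambda>n. 2 * L2_norm (\<lambda>\<xi>. ?w (?F n) \<xi> - P \<xi>)) \<longlonglongrightarrow> 0"
    using tendsto_mult_right_zero[OF P(2)] by simp
  ultimately have "(\<lambda>n. X n - u) \<longlonglongrightarrow> 0"
    by (rule Lim_null_comparison[OF always_eventually[OF allI]])
  hence "X \<longlonglongrightarrow> u" by (simp add: LIM_zero_iff)
  thus "convergent X" by (rule convergentI)
qed

section \<open>The nonlinearity and the propagator on \<open>H\<^sup>q\<close>\<close>

text \<open>The constant depends on the radius only. Closed balls of H^q are not compact, so
  neighbourhoodwise Lipschitz bounds would not give this uniformity, which the choice of the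
  existence time relies on.\<close>

definition lipschitz_on_balls :: "('a::real_normed_vector \<Rightarrow> 'b::real_normed_vector) \<Rightarrow> bool" where
  "lipschitz_on_balls F \<longleftrightarrow>
    (\<forall>R. \<exists>L\<ge>0. \<forall>u v. norm u \<le> R \<longrightarrow> norm v \<le> R \<longrightarrow> norm (F u - F v) \<le> L * norm (u - v))"

lemma lipschitz_on_ballsE:
  assumes "lipschitz_on_balls F"
  obtains L where "L \<ge> 0" "\<And>u v. norm u \<le> R \<Longrightarrow> norm v \<le> R \<Longrightarrow> norm (F u - F v) \<le> L * norm (u - v)"
  using assms unfolding lipschitz_on_balls_def by blast

lemma lipschitz_on_balls_bounded:
  assumes "lipschitz_on_balls F"
  obtains M where "M \<ge> 0" "\<And>u. norm u \<le> R \<Longrightarrow> norm (F u) \<le> M"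
proof -
  obtain L where L: "L \<ge> 0" "\<And>u v. norm u \<le> R \<Longrightarrow> norm v \<le> R \<Longrightarrow> norm (F u - F v) \<le> L * norm (u - v)"
    using lipschitz_on_ballsE[OF assms, of R] by blast
  have "norm (F u) \<le> norm (F 0) + L * \<bar>R\<bar>" if u: "norm u \<le> R" for u
  proof -
    have "R \<ge> 0" using u norm_ge_zero[of u] by linarith
    hence "norm (F u - F 0) \<le> L * norm u" using L(2)[OF u, of 0] by simp
    also have "\<dots> \<le> L * \<bar>R\<bar>" using u L(1) by (intro mult_left_mono) auto
    finally show ?thesis using norm_triangle_sub[of "F u" "F 0"] by linarith
  qed
  thus ?thesis using L(1) by (intro that[of "norm (F 0) + L * \<bar>R\<bar>"]) auto
qed

lemma lipschitz_on_balls_isometry: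
  assumes "\<And>u v. norm (F u - F v) = norm (u - v)"
  shows "lipschitz_on_balls F"
  unfolding lipschitz_on_balls_def by (intro allI exI[of _ 1]) (simp add: assms)

lemma lipschitz_on_balls_bilinear:
  assumes B: "bounded_bilinear B" and F: "lipschitz_on_balls F" and G: "lipschitz_on_balls G"
  shows "lipschitz_on_balls (\<lambda>u. B (F u) (G u))"
  unfolding lipschitz_on_balls_def
proof
  fix R
  interpret bounded_bilinear B by (rule B)
  obtain K where K: "K \<ge> 0" "\<And>a b. norm (B a b) \<le> norm a * norm b * K"
    using nonneg_bounded by blast
  obtain L1 where L1: "L1 \<ge> 0" "\<And>u v. norm u \<le> R \<Longrightarrow> norm v \<le> R \<Longrightarrow> norm (F u - F v) \<le> L1 * norm (u - v)"
    using lipschitz_on_ballsE[OF F, of R] by blast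
  obtain L2 where L2: "L2 \<ge> 0" "\<And>u v. norm u \<le> R \<Longrightarrow> norm v \<le> R \<Longrightarrow> norm (G u - G v) \<le> L2 * norm (u - v)"
    using lipschitz_on_ballsE[OF G, of R] by blast
  obtain M1 where M1: "M1 \<ge> 0" "\<And>u. norm u \<le> R \<Longrightarrow> norm (F u) \<le> M1"
    using lipschitz_on_balls_bounded[OF F, of R] by blast
  obtain M2 where M2: "M2 \<ge> 0" "\<And>u. norm u \<le> R \<Longrightarrow> norm (G u) \<le> M2"
    using lipschitz_on_balls_bounded[OF G, of R] by blast
  have "norm (B (F u) (G u) - B (F v) (G v)) \<le> (L1 * M2 * K + M1 * L2 * K) * norm (u - v)"
    if u: "norm u \<le> R" and v: "norm v \<le> R" for u v
  proof -
    have "B (F u) (G u) - B (F v) (G v) = B (F u - F v) (G u) + B (F v) (G u - G v)"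
      by (simp add: diff_left diff_right)
    hence "norm (B (F u) (G u) - B (F v) (G v)) \<le> norm (B (F u - F v) (G u)) + norm (B (F v) (G u - G v))"
      by (simp add: norm_triangle_ineq)
    also have "\<dots> \<le> norm (F u - F v) * norm (G u) * K + norm (F v) * norm (G u - G v) * K"
      by (intro add_mono K)
    also have "\<dots> \<le> (L1 * norm (u - v)) * M2 * K + M1 * (L2 * norm (u - v)) * K"
      using L1 L2 M1 M2 K(1) u v by (intro add_mono mult_mono) auto
    finally show ?thesis by (simp add: algebra_simps)
  qed
  thus "\<exists>L\<ge>0. \<forall>u v. norm u \<le> R \<longrightarrow> norm v \<le> R \<longrightarrow>
      norm (B (F u) (G u) - B (F v) (G v)) \<le> L * norm (u - v)"
    using L1(1) L2(1) M1(1) M2(1) K(1) by (intro exI[of _ "L1 * M2 * K + M1 * L2 * K"]) auto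
qed

text \<open>Outside an algebra the product may leave H^q, and \<open>abs_sobolev\<close> is then
  unspecified; the facts about this product therefore assume q > N/2.\<close>

definition sobolev_mult :: "('q::len0, 'n::finite) sobolev \<Rightarrow> ('q, 'n) sobolev \<Rightarrow> ('q, 'n) sobolev" where
  "sobolev_mult u v = abs_sobolev (\<lambda>x. rep_sobolev u x * rep_sobolev v x)"

definition sobolev_conj :: "('q::len0, 'n::finite) sobolev \<Rightarrow> ('q, 'n) sobolev" where
  "sobolev_conj u = abs_sobolev (\<lambda>x. cnj (rep_sobolev u x))"

lemma in_sobolev_mult:
  fixes f g :: "real^'n::finite \<Rightarrow> complex"
  assumes "real q > real CARD('n) / 2" "in_sobolev q f" "in_sobolev q g"
  shows "in_sobolev q (\<lambda>x. f x * g x)"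
  using sobolev_algebra(1)[of q f g] assms by simp

lemma rep_sobolev_mult:
  fixes u v :: "('q::len0, 'n::finite) sobolev"
  assumes "real LENGTH('q) > real CARD('n) / 2"
  shows "AE x in lborel. rep_sobolev (sobolev_mult u v) x = rep_sobolev u x * rep_sobolev v x"
  unfolding sobolev_mult_def
  by (rule rep_abs_sobolev[OF in_sobolev_mult[OF assms in_sobolev_rep in_sobolev_rep]])

lemma rep_sobolev_conj: "AE x in lborel. rep_sobolev (sobolev_conj u) x = cnj (rep_sobolev u x)"
  for u :: "('q::len0, 'n::finite) sobolev"
  unfolding sobolev_conj_def by (rule rep_abs_sobolev[OF sobolev_cnj(1)[OF in_sobolev_rep]])

lemma bounded_bilinear_sobolev_mult:
  assumes q: "real LENGTH('q) > real CARD('n) / 2"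
  shows "bounded_bilinear (sobolev_mult :: ('q::len0, 'n::finite) sobolev \<Rightarrow> _)"
proof
  fix u v w :: "('q, 'n) sobolev" and r :: real
  note m = rep_sobolev_mult[OF q]
  show "sobolev_mult (u + v) w = sobolev_mult u w + sobolev_mult v w"
    using m[of "u + v" w] rep_sobolev_add[of u v] m[of u w] m[of v w]
      rep_sobolev_add[of "sobolev_mult u w" "sobolev_mult v w"]
    by (intro sobolev_eqI, eventually_elim) (simp add: distrib_right)
  show "sobolev_mult w (u + v) = sobolev_mult w u + sobolev_mult w v"
    using m[of w "u + v"] rep_sobolev_add[of u v] m[of w u] m[of w v]
      rep_sobolev_add[of "sobolev_mult w u" "sobolev_mult w v"]
    by (intro sobolev_eqI, eventually_elim) (simp add: distrib_left)
  show "sobolev_mult (r *\<^sub>R u) v = r *\<^sub>R sobolev_mult u v"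
    using m[of "r *\<^sub>R u" v] rep_sobolev_scaleR[of r u] m[of u v] rep_sobolev_scaleR[of r "sobolev_mult u v"]
    by (intro sobolev_eqI, eventually_elim) simp
  show "sobolev_mult u (r *\<^sub>R v) = r *\<^sub>R sobolev_mult u v"
    using m[of u "r *\<^sub>R v"] rep_sobolev_scaleR[of r v] m[of u v] rep_sobolev_scaleR[of r "sobolev_mult u v"]
    by (intro sobolev_eqI, eventually_elim) simp
next
  let ?K = "algebra_const LENGTH('q) TYPE(real^'n)"
  have "norm (sobolev_mult u v) \<le> norm u * norm v * ?K" for u v :: "('q, 'n) sobolev"
  proof -
    have "norm (sobolev_mult u v) = sobolev_norm LENGTH('q) (\<lambda>x. rep_sobolev u x * rep_sobolev v x)"
      unfolding sobolev_mult_def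
      by (rule norm_abs_sobolev[OF in_sobolev_mult[OF q in_sobolev_rep in_sobolev_rep]])
    also have "\<dots> \<le> ?K * (norm u * norm v)"
      unfolding norm_sobolev_eq using q by (intro sobolev_algebra(2) in_sobolev_rep) simp
    finally show ?thesis by (simp add: mult.commute)
  qed
  thus "\<exists>K. \<forall>u v :: ('q, 'n) sobolev. norm (sobolev_mult u v) \<le> norm u * norm v * K" by blast
qed

lemma norm_sobolev_conj: "norm (sobolev_conj u) = norm u"
  for u :: "('q::len0, 'n::finite) sobolev"
  unfolding sobolev_conj_def norm_abs_sobolev[OF sobolev_cnj(1)[OF in_sobolev_rep]]
  by (simp add: sobolev_cnj(2) in_sobolev_rep norm_sobolev_eq)

lemma sobolev_conj_diff: "sobolev_conj (u - v) = sobolev_conj u - sobolev_conj v"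
  for u v :: "('q::len0, 'n::finite) sobolev"
  using rep_sobolev_conj[of "u - v"] rep_sobolev_diff[of u v] rep_sobolev_conj[of u] rep_sobolev_conj[of v]
    rep_sobolev_diff[of "sobolev_conj u" "sobolev_conj v"]
  by (intro sobolev_eqI, eventually_elim) simp

section \<open>The power nonlinearity as a polynomial in u and its conjugate\<close>

lemma power_nonlinearity_Suc:
  "power_nonlinearity (Suc k) z = (z * cnj z) * power_nonlinearity k z"
  by (simp add: power_nonlinearity_def complex_norm_square[symmetric] power2_eq_square mult.assoc)

lemma in_sobolev_power_nonlinearity:
  fixes f :: "real^'n::finite \<Rightarrow> complex"
  assumes q: "real q > real CARD('n) / 2" and f: "in_sobolev q f"
  shows "in_sobolev q (\<lambda>x. power_nonlinearity k (f x))"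
proof (induction k)
  case 0
  thus ?case using f by (simp add: power_nonlinearity_def)
next
  case (Suc k)
  show ?case
    unfolding power_nonlinearity_Suc by (intro in_sobolev_mult q f Suc.IH sobolev_cnj(1))
qed

text \<open>Induction from the identity map at exponent 0, each step multiplying by u times its
  conjugate. Conjugation is isometric, and bounded bilinear maps preserve
  \<open>lipschitz_on_balls\<close>.\<close>

lemma lipschitz_on_balls_sobolev_nonlinearity:
  assumes q: "real LENGTH('q) > real CARD('n) / 2"
  shows "lipschitz_on_balls (sobolev_nonlinearity k :: ('q::len0, 'n::finite) sobolev \<Rightarrow> _)"
proof (induction k)
  case 0
  have "sobolev_nonlinearity 0 u = u" for u :: "('q, 'n) sobolev"
    by (simp add: sobolev_nonlinearity_def power_nonlinearity_def abs_sobolev_rep)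
  thus ?case by (intro lipschitz_on_balls_isometry) simp
next
  case (Suc k)
  have "sobolev_nonlinearity (Suc k) u = sobolev_mult (sobolev_mult u (sobolev_conj u)) (sobolev_nonlinearity k u)"
    for u :: "('q, 'n) sobolev"
  proof (rule sobolev_eqI)
    have rep: "AE x in lborel. rep_sobolev (sobolev_nonlinearity j u) x = power_nonlinearity j (rep_sobolev u x)" for j
      unfolding sobolev_nonlinearity_def
      by (rule rep_abs_sobolev[OF in_sobolev_power_nonlinearity[OF q in_sobolev_rep]])
    show "AE x in lborel. rep_sobolev (sobolev_nonlinearity (Suc k) u) x =
        rep_sobolev (sobolev_mult (sobolev_mult u (sobolev_conj u)) (sobolev_nonlinearity k u)) x"
      using rep[of "Suc k"] rep[of k] rep_sobolev_conj[of u] rep_sobolev_mult[OF q, of u "sobolev_conj u"]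
        rep_sobolev_mult[OF q, of "sobolev_mult u (sobolev_conj u)" "sobolev_nonlinearity k u"]
      by eventually_elim (simp add: power_nonlinearity_Suc)
  qed
  hence eq: "sobolev_nonlinearity (Suc k) =
      (\<lambda>u :: ('q, 'n) sobolev. sobolev_mult (sobolev_mult u (sobolev_conj u)) (sobolev_nonlinearity k u))"
    by (rule ext)
  have conj: "lipschitz_on_balls (sobolev_conj :: ('q, 'n) sobolev \<Rightarrow> _)"
    by (rule lipschitz_on_balls_isometry) (simp add: sobolev_conj_diff[symmetric] norm_sobolev_conj)
  show ?case
    unfolding eq
    by (intro lipschitz_on_balls_bilinear[OF bounded_bilinear_sobolev_mult[OF q]] Suc.IH conj
        lipschitz_on_balls_isometry refl)
qed

section \<open>The Schroedinger group on H^q\<close>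

lemma has_fourier_schroedinger_group:
  fixes u :: "('q::len0, 'n::finite) sobolev"
  assumes "has_fourier (rep_sobolev u) F"
  shows "has_fourier (rep_sobolev (schroedinger_group t u)) (\<lambda>\<xi>. cis (- (t * (norm \<xi>)\<^sup>2)) * F \<xi>)"
proof -
  have [measurable]: "(\<lambda>\<xi>::real^'n. cis (- (t * (norm \<xi>)\<^sup>2))) \<in> borel_measurable borel"
    by (intro borel_measurable_continuous_onI continuous_intros)
  note [measurable] = has_fourier_borel_measurable(2)[OF assms] has_fourier_borel_measurable(2)[OF sobolev_fourier(1)[of u]]
  let ?G = "\<lambda>\<xi>. cis (- (t * (norm \<xi>)\<^sup>2)) * fourier_L2 (rep_sobolev u) \<xi>"
  have G: "?G \<in> borel_measurable borel"
    using has_fourier_borel_measurable(2)[OF sobolev_fourier(1)[of u]] by (simp add: sobolev_fourier_def)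
  \<comment> \<open>The multiplier has modulus one, so the weighted transform stays in L2 and the
    definite description denotes an element of H^q.\<close>
  have "square_integrable (bessel_weight LENGTH('q) ?G)"
    by (rule square_integrable_bound[OF _ sobolev_fourier(2)[of u]])
      (simp_all add: borel_measurable_bessel_weight G norm_bessel_weight norm_mult sobolev_fourier_def)
  from theI'[OF sobolev_of_fourier_exists[OF this G]]
  have S: "has_fourier (rep_sobolev (schroedinger_group t u)) ?G"
    by (simp add: schroedinger_group_def)
  \<comment> \<open>Passing from the chosen transform to an arbitrary \<open>F\<close> allows the
    rule to be iterated, as the group law requires.\<close>
  show ?thesis
  proof (rule has_fourier_cong_AE_right[OF S])
    show "square_integrable (\<lambda>\<xi>. cis (- (t * (norm \<xi>)\<^sup>2)) * F \<xi>)"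
      by (rule square_integrable_bound[OF _ has_fourier_square_integrable(2)[OF assms]]) (simp_all add: norm_mult)
    show "AE \<xi> in lborel. ?G \<xi> = cis (- (t * (norm \<xi>)\<^sup>2)) * F \<xi>"
      using has_fourier_unique[OF sobolev_fourier(1)[of u] assms]
      by eventually_elim (simp add: sobolev_fourier_def)
  qed
qed

lemma schroedinger_group_0: "schroedinger_group 0 u = u"
  by (rule sobolev_eqI_fourier[OF _ sobolev_fourier(1)])
    (use has_fourier_schroedinger_group[OF sobolev_fourier(1)[of u], of 0] in simp)

lemma schroedinger_group_add: "schroedinger_group s (schroedinger_group t u) = schroedinger_group (s + t) u"
proof (rule sobolev_eqI_fourier)
  show "has_fourier (rep_sobolev (schroedinger_group (s + t) u)) (\<lambda>\<xi>. cis (- ((s + t) * (norm \<xi>)\<^sup>2)) * sobolev_fourier u \<xi>)"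
    by (rule has_fourier_schroedinger_group[OF sobolev_fourier(1)])
  have eq: "cis (- ((s + t) * r)) * z = cis (- (s * r)) * (cis (- (t * r)) * z)" for r z
    by (simp add: cis_mult algebra_simps mult.assoc[symmetric] del: mult.assoc)
  show "has_fourier (rep_sobolev (schroedinger_group s (schroedinger_group t u)))
      (\<lambda>\<xi>. cis (- ((s + t) * (norm \<xi>)\<^sup>2)) * sobolev_fourier u \<xi>)"
    unfolding eq by (intro has_fourier_schroedinger_group sobolev_fourier(1))
qed

lemma norm_schroedinger_group: "norm (schroedinger_group t u) = norm u"
  for u :: "('q::len0, 'n::finite) sobolev"
proof -
  note S = has_fourier_schroedinger_group[OF sobolev_fourier(1)[of u], of t]
  have "L2_norm (\<lambda>\<xi>. cis (- (t * (norm \<xi>)\<^sup>2)) * sobolev_fourier u \<xi>) = L2_norm (sobolev_fourier u)"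
    "L2_norm (bessel_weight LENGTH('q) (\<lambda>\<xi>. cis (- (t * (norm \<xi>)\<^sup>2)) * sobolev_fourier u \<xi>)) =
      L2_norm (bessel_weight LENGTH('q) (sobolev_fourier u))"
    by (simp_all add: L2_norm_def norm_bessel_weight norm_mult)
  thus ?thesis
    unfolding norm_sobolev_fourier(1)[OF S] norm_sobolev_fourier(1)[OF sobolev_fourier(1)[of u]] by simp
qed

lemma schroedinger_group_plus: "schroedinger_group t (u + v) = schroedinger_group t u + schroedinger_group t v"
proof (rule sobolev_eqI_fourier)
  note u = sobolev_fourier(1)[of u] and v = sobolev_fourier(1)[of v]
  show "has_fourier (rep_sobolev (schroedinger_group t (u + v)))
      (\<lambda>\<xi>. cis (- (t * (norm \<xi>)\<^sup>2)) * (sobolev_fourier u \<xi> + sobolev_fourier v \<xi>))"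
    by (intro has_fourier_schroedinger_group has_fourier_rep_linear(1) u v)
  show "has_fourier (rep_sobolev (schroedinger_group t u + schroedinger_group t v))
      (\<lambda>\<xi>. cis (- (t * (norm \<xi>)\<^sup>2)) * (sobolev_fourier u \<xi> + sobolev_fourier v \<xi>))"
    unfolding distrib_left by (intro has_fourier_schroedinger_group has_fourier_rep_linear(1) u v)
qed

lemma schroedinger_group_scaleC: "schroedinger_group t (c *\<^sub>C u) = c *\<^sub>C schroedinger_group t u"
proof (rule sobolev_eqI_fourier)
  note u = sobolev_fourier(1)[of u]
  show "has_fourier (rep_sobolev (schroedinger_group t (c *\<^sub>C u)))
      (\<lambda>\<xi>. cis (- (t * (norm \<xi>)\<^sup>2)) * (c * sobolev_fourier u \<xi>))"
    by (intro has_fourier_schroedinger_group has_fourier_rep_linear(3)[OF u u])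
  show "has_fourier (rep_sobolev (c *\<^sub>C schroedinger_group t u))
      (\<lambda>\<xi>. cis (- (t * (norm \<xi>)\<^sup>2)) * (c * sobolev_fourier u \<xi>))"
    unfolding mult.left_commute[of _ c]
    by (rule has_fourier_rep_linear(3)[OF has_fourier_schroedinger_group[OF u] u])
qed

lemma bounded_linear_schroedinger_group: "bounded_linear (schroedinger_group t)"
  by (rule bounded_linear_intro[where K = 1])
    (simp_all add: schroedinger_group_plus scaleR_sobolev_def schroedinger_group_scaleC norm_schroedinger_group)

lemma bounded_linear_scaleC: "bounded_linear (scaleC c :: ('q::len0, 'n::finite) sobolev \<Rightarrow> _)"
proof (rule bounded_linear_intro[where K = "cmod c"])
  fix u v :: "('q, 'n) sobolev" and r :: real
  show "c *\<^sub>C (u + v) = c *\<^sub>C u + c *\<^sub>C v"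
    using rep_sobolev_scaleC[of c "u + v"] rep_sobolev_add[of u v] rep_sobolev_scaleC[of c u] rep_sobolev_scaleC[of c v]
      rep_sobolev_add[of "c *\<^sub>C u" "c *\<^sub>C v"]
    by (intro sobolev_eqI, eventually_elim) (simp add: distrib_left)
  show "c *\<^sub>C (r *\<^sub>R u) = r *\<^sub>R (c *\<^sub>C u)"
    using rep_sobolev_scaleC[of c "r *\<^sub>R u"] rep_sobolev_scaleR[of r u] rep_sobolev_scaleC[of c u]
      rep_sobolev_scaleR[of r "c *\<^sub>C u"]
    by (intro sobolev_eqI, eventually_elim) simp
  have "norm (c *\<^sub>C u) = cmod c * norm u"
  proof -
    have eq: "c *\<^sub>C u = abs_sobolev (\<lambda>x. c * rep_sobolev u x)"
      using rep_sobolev_scaleC[of c u] rep_abs_sobolev[OF in_sobolev_cmult[OF in_sobolev_rep[of u], of c]]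
      by (intro sobolev_eqI, eventually_elim) simp
    show ?thesis
      unfolding eq norm_abs_sobolev[OF in_sobolev_cmult[OF in_sobolev_rep[of u]]]
      by (simp add: sobolev_norm_cmult in_sobolev_rep norm_sobolev_eq)
  qed
  thus "norm (c *\<^sub>C u) \<le> norm u * cmod c" by simp
qed

text \<open>Dominated convergence for the weighted transform of the fixed element u: the difference
  of two characters tends to 0 at every frequency and is bounded by 2.\<close>

lemma continuous_on_schroedinger_group:
  fixes u :: "('q::len0, 'n::finite) sobolev"
  shows "continuous_on UNIV (\<lambda>t. schroedinger_group t u)"
  unfolding continuous_on_sequentially
proof (intro allI ballI impI, elim conjE)
  fix s :: "nat \<Rightarrow> real" and t assume s: "s \<longlonglongrightarrow> t"
  let ?w = "bessel_weight LENGTH('q)" and ?F = "sobolev_fourier u"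
  define d where "d n \<xi> = (cis (- (s n * (norm \<xi>)\<^sup>2)) - cis (- (t * (norm \<xi>)\<^sup>2))) * ?w ?F \<xi>" for n and \<xi> :: "real^'n"
  have w: "square_integrable (?w ?F)" by (rule sobolev_fourier(2))
  note [measurable] = square_integrableD(1)[OF w]
  have [measurable]: "(\<lambda>\<xi>::real^'n. cis (- (r * (norm \<xi>)\<^sup>2))) \<in> borel_measurable borel" for r
    by (intro borel_measurable_continuous_onI continuous_intros)
  have d_lim: "(\<lambda>n. L2_norm (d n)) \<longlonglongrightarrow> 0"
  proof (rule L2_dominated_convergence(2)[where w = "\<lambda>\<xi>. 2 * cmod (?w ?F \<xi>)"])
    show "d n \<in> borel_measurable borel" for n
      unfolding d_def[abs_def] by measurable
    show "integrable lborel (\<lambda>\<xi>. (2 * cmod (?w ?F \<xi>))\<^sup>2)"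
      using square_integrableD(2)[OF w] by (simp add: power_mult_distrib)
    have "cmod (cis a - cis b) \<le> 2" for a b
      using norm_triangle_ineq4[of "cis a" "cis b"] by simp
    thus "AE \<xi> in lborel. cmod (d n \<xi>) \<le> 2 * cmod (?w ?F \<xi>)" for n
      by (intro AE_I2) (auto simp: d_def norm_mult intro: mult_right_mono)
    have "(\<lambda>n. d n \<xi>) \<longlonglongrightarrow> (cis (- (t * (norm \<xi>)\<^sup>2)) - cis (- (t * (norm \<xi>)\<^sup>2))) * ?w ?F \<xi>" for \<xi>
      unfolding d_def by (intro tendsto_intros s)
    thus "AE \<xi> in lborel. (\<lambda>n. d n \<xi>) \<longlonglongrightarrow> 0" by simp
  qed measurable
  have "norm (schroedinger_group (s n) u - schroedinger_group t u) \<le> 2 * L2_norm (d n)" for n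
  proof -
    note S = has_fourier_schroedinger_group[OF sobolev_fourier(1)[of u]]
    have "?w (\<lambda>\<xi>. cis (- (s n * (norm \<xi>)\<^sup>2)) * ?F \<xi> - cis (- (t * (norm \<xi>)\<^sup>2)) * ?F \<xi>) = d n"
      by (simp add: bessel_weight_def d_def fun_eq_iff algebra_simps)
    thus ?thesis
      using norm_sobolev_fourier(3)[OF has_fourier_rep_linear(2)[OF S[of "s n"] S[of t]]] by simp
  qed
  moreover have "(\<lambda>n. 2 * L2_norm (d n)) \<longlonglongrightarrow> 0"
    using tendsto_mult_right_zero[OF d_lim] by simp
  ultimately have "(\<lambda>n. schroedinger_group (s n) u - schroedinger_group t u) \<longlonglongrightarrow> 0"
    by (rule Lim_null_comparison[OF always_eventually[OF allI]])
  thus "((\<lambda>t. schroedinger_group t u) \<circ> s) \<longlonglongrightarrow> schroedinger_group t u"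
    by (simp add: LIM_zero_iff comp_def)
qed

section \<open>Local well-posedness of semilinear equations\<close>

text \<open>Continuity is required along continuous curves, which is what integrability of the
  right-hand side takes. The constants of the other two conditions are uniform in time, so a
  solution can be started at any time with a step length governed by the norm of its initial
  value.\<close>

locale locally_lipschitz_field =
  fixes g :: "real \<Rightarrow> 'b::banach \<Rightarrow> 'b"
  assumes cont: "continuous_on A v \<Longrightarrow> continuous_on A (\<lambda>t. g t (v t))"
    and lipschitz: "\<exists>L\<ge>0. \<forall>t u v. norm u \<le> R \<longrightarrow> norm v \<le> R \<longrightarrow> norm (g t u - g t v) \<le> L * norm (u - v)"
    and bounded: "\<exists>M\<ge>0. \<forall>t u. norm u \<le> R \<longrightarrow> norm (g t u) \<le> M"
begin

definition solves :: "'b \<Rightarrow> real \<Rightarrow> real \<Rightarrow> (real \<Rightarrow> 'b) \<Rightarrow> bool" where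
  "solves x a b v \<longleftrightarrow> continuous_on {a..b} v \<and>
     (\<forall>t\<in>{a..b}. ((\<lambda>\<nu>. g \<nu> (v \<nu>)) has_integral (v t - x)) {a..t})"

lemma solves_initial:
  assumes "solves x a b v" "a \<le> b"
  shows "v a = x"
proof -
  have "((\<lambda>\<nu>. g \<nu> (v \<nu>)) has_integral (v a - x)) {a..a}"
    using assms(1)[unfolded solves_def, THEN conjunct2, rule_format, of a] assms(2) by simp
  moreover have "((\<lambda>\<nu>. g \<nu> (v \<nu>)) has_integral 0) {a..a}"
    using has_integral_refl(2)[of "\<lambda>\<nu>. g \<nu> (v \<nu>)" a] by simp
  ultimately have "v a - x = 0" by (rule has_integral_unique)
  thus ?thesis by simp
qed

text \<open>Banach's theorem is applied in a closed ball of the complete space of bounded continuous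
  functions on the whole line, whose elements are then restricted to the short interval.\<close>

lemma local_solution:
  obtains \<tau> v where "\<tau> > 0" "solves x a (a + \<tau>) v"
proof -
  define R where "R = norm x + 1"
  obtain L where L: "L \<ge> 0" "\<And>t u v. norm u \<le> R \<Longrightarrow> norm v \<le> R \<Longrightarrow> norm (g t u - g t v) \<le> L * norm (u - v)"
    using lipschitz[of R] by blast
  obtain M where M: "M \<ge> 0" "\<And>t u. norm u \<le> R \<Longrightarrow> norm (g t u) \<le> M"
    using bounded[of R] by blast
  \<comment> \<open>\<open>M * \<tau> \<le> 1\<close> fits the margin 1 in \<open>R\<close>, so the
    ball is mapped into itself, and \<open>L * \<tau> \<le> 1 / 2\<close> makes the map a
    contraction. The summand 1 keeps the denominator positive when \<open>M\<close> and
    \<open>L\<close> vanish.\<close>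
  define \<tau> where "\<tau> = 1 / (M + 2 * L + 1)"
  have \<tau>: "\<tau> > 0" "M * \<tau> \<le> 1" "L * \<tau> \<le> 1 / 2"
    using L(1) M(1) by (auto simp: \<tau>_def field_simps)
  \<comment> \<open>Clamping extends functions by constants from the interval to the line. The
    values of \<open>\<Phi> w\<close> then come from a compact interval, which gives the boundedness
    needed for \<open>Bcontfun\<close>.\<close>
  define clamp where "clamp t = max a (min t (a + \<tau>))" for t
  have clamp: "clamp t \<in> {a..a + \<tau>}" "t \<in> {a..a + \<tau>} \<Longrightarrow> clamp t = t" for t
    using \<tau>(1) by (auto simp: clamp_def)
  have clamp_cont: "continuous_on UNIV clamp"
    unfolding clamp_def by (intro continuous_intros)
  define J where "J w s = integral {a..s} (\<lambda>\<nu>. g \<nu> (apply_bcontfun w \<nu>))" for w :: "real \<Rightarrow>\<^sub>C 'b" and s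
  have h_cont: "continuous_on S (\<lambda>\<nu>. g \<nu> (apply_bcontfun w \<nu>))" for S and w :: "real \<Rightarrow>\<^sub>C 'b"
    by (rule cont) simp
  note h_int = integrable_continuous_interval[OF h_cont]
  have J_cont: "continuous_on {a..a + \<tau>} (J w)" for w
    unfolding J_def by (rule indefinite_integral_continuous_1[OF h_int])
  define \<Phi> where "\<Phi> w = Bcontfun (\<lambda>t. x + J w (clamp t))" for w
  have \<Phi>: "apply_bcontfun (\<Phi> w) t = x + J w (clamp t)" for w t
  proof -
    have "continuous_on UNIV (\<lambda>t. x + J w (clamp t))"
      using clamp(1) by (intro continuous_on_add continuous_on_const continuous_on_compose2[OF J_cont clamp_cont]) auto
    moreover have "bounded (range (\<lambda>t. x + J w (clamp t)))"
    proof (rule bounded_subset)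
      show "bounded ((\<lambda>s. x + J w s) ` {a..a + \<tau>})"
        by (intro compact_imp_bounded compact_continuous_image continuous_on_add continuous_on_const J_cont) auto
      show "range (\<lambda>t. x + J w (clamp t)) \<subseteq> (\<lambda>s. x + J w s) ` {a..a + \<tau>}"
        using clamp(1) by blast
    qed
    ultimately show ?thesis
      unfolding \<Phi>_def by (subst Bcontfun_inverse) (auto simp: bcontfun_def)
  qed
  have in_ball: "norm (apply_bcontfun w t) \<le> R" if "w \<in> cball 0 R" for w :: "real \<Rightarrow>\<^sub>C 'b" and t
    using norm_bounded[of w t] that by simp
  have "\<exists>!w. w \<in> cball 0 R \<and> \<Phi> w = w"
  proof (rule Banach_fix[where c = "1/2"])
    show "complete (cball (0 :: real \<Rightarrow>\<^sub>C 'b) R)"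
      by (simp add: complete_eq_closed)
    show "cball (0 :: real \<Rightarrow>\<^sub>C 'b) R \<noteq> {}"
      by (simp add: R_def not_less add_nonneg_nonneg)
    show "\<Phi> ` cball 0 R \<subseteq> cball 0 R"
    proof
      fix w' assume "w' \<in> \<Phi> ` cball 0 R"
      then obtain w where w: "w \<in> cball 0 R" "w' = \<Phi> w" by blast
      have "norm (apply_bcontfun (\<Phi> w) t) \<le> R" for t
      proof -
        have "norm (J w (clamp t)) \<le> M * (clamp t - a)"
          unfolding J_def using clamp(1)[of t] M(2)[OF in_ball[OF w(1)]] by (intro integral_bound h_cont) auto
        also have "\<dots> \<le> M * \<tau>"
          using clamp(1)[of t] M(1) by (intro mult_left_mono) auto
        finally show ?thesis
          using \<tau>(2) norm_triangle_ineq[of x "J w (clamp t)"] by (simp add: \<Phi> R_def)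
      qed
      thus "w' \<in> cball 0 R" by (simp add: w norm_bound)
    qed
    fix w w' :: "real \<Rightarrow>\<^sub>C 'b"
    assume ww: "w \<in> cball 0 R" "w' \<in> cball 0 R"
    show "dist (\<Phi> w) (\<Phi> w') \<le> 1 / 2 * dist w w'"
    proof (rule dist_bound)
      fix t
      have "dist (apply_bcontfun (\<Phi> w) t) (apply_bcontfun (\<Phi> w') t) =
          norm (integral {a..clamp t} (\<lambda>\<nu>. g \<nu> (apply_bcontfun w \<nu>) - g \<nu> (apply_bcontfun w' \<nu>)))"
        by (simp add: \<Phi> dist_norm J_def integral_diff h_int)
      also have "\<dots> \<le> (L * dist w w') * (clamp t - a)"
      proof (rule integral_bound)
        show "continuous_on {a..clamp t} (\<lambda>\<nu>. g \<nu> (apply_bcontfun w \<nu>) - g \<nu> (apply_bcontfun w' \<nu>))"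
          by (intro continuous_on_diff h_cont)
        fix \<nu>
        have "norm (g \<nu> (apply_bcontfun w \<nu>) - g \<nu> (apply_bcontfun w' \<nu>)) \<le>
            L * norm (apply_bcontfun w \<nu> - apply_bcontfun w' \<nu>)"
          using ww by (intro L(2) in_ball)
        also have "\<dots> \<le> L * dist w w'"
          using dist_bounded[of w \<nu> w'] L(1) by (intro mult_left_mono) (auto simp: dist_norm)
        finally show "norm (g \<nu> (apply_bcontfun w \<nu>) - g \<nu> (apply_bcontfun w' \<nu>)) \<le> L * dist w w'" .
      qed (use clamp(1)[of t] in auto)
      also have "\<dots> \<le> (L * dist w w') * \<tau>"
        using clamp(1)[of t] L(1) by (intro mult_left_mono) auto
      also have "\<dots> \<le> 1 / 2 * dist w w'"
        using mult_right_mono[OF \<tau>(3), of "dist w w'"] by (simp add: ac_simps)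
      finally show "dist (apply_bcontfun (\<Phi> w) t) (apply_bcontfun (\<Phi> w') t) \<le> 1 / 2 * dist w w'" .
    qed
  qed auto
  then obtain w where w: "\<Phi> w = w" by blast
  have "solves x a (a + \<tau>) (apply_bcontfun w)"
    unfolding solves_def
  proof (intro conjI ballI)
    fix t assume t: "t \<in> {a..a + \<tau>}"
    have "apply_bcontfun w t = x + J w t"
      using \<Phi>[of w t] clamp(2)[OF t] by (simp add: w)
    thus "((\<lambda>\<nu>. g \<nu> (apply_bcontfun w \<nu>)) has_integral (apply_bcontfun w t - x)) {a..t}"
      using integrable_integral[OF h_int] by (simp add: J_def)
  qed simp
  with \<tau>(1) show ?thesis by (rule that)
qed

text \<open>The distance of two solutions is compared with \<open>exp (2 * L * (t - a))\<close>, which turns the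
  Lipschitz estimate into a contraction on the whole interval.\<close>

lemma solution_unique:
  assumes v: "solves x a b v" and w: "solves x a b w" and t: "t \<in> {a..b}"
  shows "v t = w t"
proof -
  have vc: "continuous_on {a..b} v" and wc: "continuous_on {a..b} w"
    using v w by (auto simp: solves_def)
  obtain R1 where "\<forall>y\<in>v ` {a..b}. norm y \<le> R1"
    using compact_imp_bounded[OF compact_continuous_image[OF vc compact_Icc]] unfolding bounded_iff by blast
  hence R1: "norm (v s) \<le> R1" if "s \<in> {a..b}" for s using that by blast
  obtain R2 where "\<forall>y\<in>w ` {a..b}. norm y \<le> R2"
    using compact_imp_bounded[OF compact_continuous_image[OF wc compact_Icc]] unfolding bounded_iff by blast
  hence R2: "norm (w s) \<le> R2" if "s \<in> {a..b}" for s using that by blast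
  obtain L0 where L0: "L0 \<ge> 0" "\<And>s u u'. norm u \<le> max R1 R2 \<Longrightarrow> norm u' \<le> max R1 R2 \<Longrightarrow>
      norm (g s u - g s u') \<le> L0 * norm (u - u')"
    using lipschitz[of "max R1 R2"] by blast
  define L where "L = L0 + 1"
  have L: "L > 0" using L0(1) by (simp add: L_def)
  have lip: "norm (g s (v s) - g s (w s)) \<le> L * norm (v s - w s)" if "s \<in> {a..b}" for s
  proof -
    have "norm (g s (v s) - g s (w s)) \<le> L0 * norm (v s - w s)"
      using R1[OF that] R2[OF that] by (intro L0(2)) auto
    also have "\<dots> \<le> L * norm (v s - w s)"
      by (intro mult_right_mono) (auto simp: L_def)
    finally show ?thesis .
  qed
  define h where "h s = norm (v s - w s) * exp (- 2 * L * (s - a))" for s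
  have "continuous_on {a..b} h"
    unfolding h_def by (intro continuous_intros vc wc)
  then obtain s0 where s0: "s0 \<in> {a..b}" "\<And>s. s \<in> {a..b} \<Longrightarrow> h s \<le> h s0"
    using continuous_attains_sup[of "{a..b}" h] t by auto
  define m where "m = h s0"
  have m: "m \<ge> 0" by (simp add: m_def h_def)
  have le: "norm (v s - w s) \<le> m * exp (2 * L * (s - a))" if "s \<in> {a..b}" for s
  proof -
    have "norm (v s - w s) = h s * exp (2 * L * (s - a))"
      by (simp add: h_def mult.assoc flip: exp_add)
    also have "\<dots> \<le> m * exp (2 * L * (s - a))"
      unfolding m_def by (intro mult_right_mono s0(2) that) simp
    finally show ?thesis .
  qed
  \<comment> \<open>Integrating \<open>L * m * exp (2 * L * (\<nu> - a))\<close> divides by 2 L: the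
    exponent 2 L, instead of L, produces the factor 1/2. At the maximum point \<open>s0\<close> this
    says m <= m/2.\<close>
  have "h s \<le> m / 2" if s: "s \<in> {a..b}" for s
  proof -
    have sub: "{a..s} \<subseteq> {a..b}" using s by auto
    have "((\<lambda>\<nu>. g \<nu> (v \<nu>) - g \<nu> (w \<nu>)) has_integral ((v s - x) - (w s - x))) {a..s}"
      using v w s by (intro has_integral_diff) (auto simp: solves_def)
    hence I: "((\<lambda>\<nu>. g \<nu> (v \<nu>) - g \<nu> (w \<nu>)) has_integral (v s - w s)) {a..s}" by simp
    have "((\<lambda>\<nu>. L * m * exp (2 * L * (\<nu> - a))) has_integral
        (m / 2 * exp (2 * L * (s - a)) - m / 2 * exp (2 * L * (a - a)))) {a..s}"
      using s L by (intro fundamental_theorem_of_calculus)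
        (auto intro!: derivative_eq_intros simp: has_real_derivative_iff_has_vector_derivative[symmetric])
    hence E: "((\<lambda>\<nu>. L * m * exp (2 * L * (\<nu> - a))) has_integral (m / 2 * exp (2 * L * (s - a)) - m / 2)) {a..s}"
      by simp
    have "norm (integral {a..s} (\<lambda>\<nu>. g \<nu> (v \<nu>) - g \<nu> (w \<nu>))) \<le> integral {a..s} (\<lambda>\<nu>. L * m * exp (2 * L * (\<nu> - a)))"
    proof (rule Henstock_Kurzweil_Integration.integral_norm_bound_integral)
      fix \<nu> assume "\<nu> \<in> {a..s}"
      hence \<nu>: "\<nu> \<in> {a..b}" using sub by auto
      show "norm (g \<nu> (v \<nu>) - g \<nu> (w \<nu>)) \<le> L * m * exp (2 * L * (\<nu> - a))"
        using order_trans[OF lip[OF \<nu>] mult_left_mono[OF le[OF \<nu>] less_imp_le[OF L]]] by (simp only: mult.assoc)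
    qed (use I E in \<open>auto simp: integrable_on_def\<close>)
    hence "norm (v s - w s) \<le> m / 2 * exp (2 * L * (s - a)) - m / 2"
      using integral_unique[OF I] integral_unique[OF E] by simp
    also have "\<dots> \<le> m / 2 * exp (2 * L * (s - a))" using m by simp
    finally have "h s \<le> m / 2 * exp (2 * L * (s - a)) * exp (- 2 * L * (s - a))"
      unfolding h_def by (intro mult_right_mono) auto
    also have "\<dots> = m / 2" by (simp add: exp_minus)
    finally show ?thesis .
  qed
  from this[OF s0(1)] have "m \<le> 0" by (simp add: m_def[symmetric])
  hence "norm (v t - w t) \<le> 0"
    using le[OF t] m by simp
  thus ?thesis by simp
qed

text \<open>The second piece solves the equation from time b with value \<open>v b\<close>. As the
  integrand does not involve the upper limit, the two integrals add up and \<open>v b\<close>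
  cancels.\<close>

lemma solution_extends:
  assumes v: "solves x a b v" and "a \<le> b"
  obtains c w where "c > b" "solves x a c w" "\<And>t. t \<in> {a..b} \<Longrightarrow> w t = v t"
proof -
  obtain \<tau> u where \<tau>: "\<tau> > 0" and u: "solves (v b) b (b + \<tau>) u"
    by (rule local_solution)
  define w where "w t = (if t \<le> b then v t else u t)" for t
  \<comment> \<open>The pieces agree at b, so each formula holds on a closed interval and continuity
    can be pasted.\<close>
  have ub: "u b = v b" using solves_initial[OF u] \<tau> by simp
  have wv: "w t = v t" if "t \<in> {a..b}" for t using that by (simp add: w_def)
  have wu: "w t = u t" if "t \<in> {b..b + \<tau>}" for t
    using that ub by (cases "t = b") (auto simp: w_def)
  have "continuous_on ({a..b} \<union> {b..b + \<tau>}) w"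
  proof (rule continuous_on_closed_Un)
    show "continuous_on {a..b} w"
      using v by (intro continuous_on_eq[of _ v w]) (simp_all add: solves_def wv)
    show "continuous_on {b..b + \<tau>} w"
      using u by (intro continuous_on_eq[of _ u w]) (simp_all add: solves_def wu)
  qed auto
  also have "{a..b} \<union> {b..b + \<tau>} = {a..b + \<tau>}"
    using assms(2) \<tau> by auto
  finally have wc: "continuous_on {a..b + \<tau>} w" .
  have wv_int: "((\<lambda>\<nu>. g \<nu> (w \<nu>)) has_integral (v t - x)) {a..t}" if "t \<in> {a..b}" for t
  proof (rule has_integral_eq[of _ "\<lambda>\<nu>. g \<nu> (v \<nu>)"])
    show "((\<lambda>\<nu>. g \<nu> (v \<nu>)) has_integral (v t - x)) {a..t}" using v that by (simp add: solves_def)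
  qed (use that in \<open>simp add: w_def\<close>)
  have wu_int: "((\<lambda>\<nu>. g \<nu> (w \<nu>)) has_integral (u t - v b)) {b..t}" if "t \<in> {b..b + \<tau>}" for t
  proof (rule has_integral_eq[of _ "\<lambda>\<nu>. g \<nu> (u \<nu>)"])
    show "((\<lambda>\<nu>. g \<nu> (u \<nu>)) has_integral (u t - v b)) {b..t}" using u that by (simp add: solves_def)
  qed (use that wu in auto)
  have "((\<lambda>\<nu>. g \<nu> (w \<nu>)) has_integral (w t - x)) {a..t}" if t: "t \<in> {a..b + \<tau>}" for t
  proof (cases "t \<le> b")
    case True
    thus ?thesis using wv_int[of t] t by (simp add: w_def)
  next
    case False
    hence "((\<lambda>\<nu>. g \<nu> (w \<nu>)) has_integral ((v b - x) + (u t - v b))) {a..t}"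
      using t assms(2) by (intro has_integral_combine[of a b t] wv_int wu_int) auto
    thus ?thesis using False by (simp add: w_def)
  qed
  hence "solves x a (b + \<tau>) w" using wc by (simp add: solves_def)
  thus ?thesis using \<tau> wv by (intro that[of "b + \<tau>" w]) auto
qed

end

section \<open>The Schroedinger equation in the interaction picture\<close>

text \<open>The right-hand side that results formally from differentiating v(t) = S(-t) psi(t),
  where the Laplacian terms cancel.\<close>

definition interaction_field ::
    "complex \<Rightarrow> nat \<Rightarrow> real \<Rightarrow> ('q::len0, 'n::finite) sobolev \<Rightarrow> ('q, 'n) sobolev" where
  "interaction_field lam \<eta> t v =
     schroedinger_group (- t) ((- (\<i> * lam)) *\<^sub>C sobolev_nonlinearity \<eta> (schroedinger_group t v))"

text \<open>With v(t) split as v(a) + (v(t) - v(a)), the first part converges by strong continuity,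
  and the second tends to 0 because the group preserves its norm.\<close>

lemma continuous_on_schroedinger_group_apply:
  fixes v :: "real \<Rightarrow> ('q::len0, 'n::finite) sobolev"
  assumes h: "continuous_on A h" and v: "continuous_on A v"
  shows "continuous_on A (\<lambda>t. schroedinger_group (h t) (v t))"
  unfolding continuous_on_def
proof
  fix a assume a: "a \<in> A"
  interpret S: bounded_linear "schroedinger_group t :: ('q, 'n) sobolev \<Rightarrow> _" for t
    by (rule bounded_linear_schroedinger_group)
  have "((\<lambda>t. schroedinger_group (h t) (v a)) \<longlongrightarrow> schroedinger_group (h a) (v a)) (at a within A)"
    using continuous_on_compose2[OF continuous_on_schroedinger_group h] a by (auto simp: continuous_on_def)
  moreover have "((\<lambda>t. schroedinger_group (h t) (v t - v a)) \<longlongrightarrow> 0) (at a within A)"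
  proof (rule tendsto_norm_zero_cancel)
    have "((\<lambda>t. v t - v a) \<longlongrightarrow> v a - v a) (at a within A)"
      using v a by (intro tendsto_diff tendsto_const) (auto simp: continuous_on_def)
    thus "((\<lambda>t. norm (schroedinger_group (h t) (v t - v a))) \<longlongrightarrow> 0) (at a within A)"
      by (simp add: norm_schroedinger_group tendsto_norm_zero)
  qed
  ultimately have "((\<lambda>t. schroedinger_group (h t) (v a) + schroedinger_group (h t) (v t - v a)) \<longlongrightarrow>
      schroedinger_group (h a) (v a) + 0) (at a within A)"
    by (rule tendsto_add)
  thus "((\<lambda>t. schroedinger_group (h t) (v t)) \<longlongrightarrow> schroedinger_group (h a) (v a)) (at a within A)"
    by (simp add: S.diff)
qed

lemma lipschitz_on_balls_continuous:
  fixes F :: "'a::real_normed_vector \<Rightarrow> 'b::real_normed_vector"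
  assumes F: "lipschitz_on_balls F"
  shows "continuous_on UNIV F"
  unfolding continuous_on_sequentially
proof (intro allI ballI impI, elim conjE)
  fix X :: "nat \<Rightarrow> 'a" and a assume X: "X \<longlonglongrightarrow> a"
  obtain K where K: "\<And>n. norm (X n) \<le> K"
    using convergent_imp_Bseq[OF convergentI[OF X]] by (auto simp: Bseq_def)
  obtain L where L: "L \<ge> 0" "\<And>u v. norm u \<le> max K (norm a) \<Longrightarrow> norm v \<le> max K (norm a) \<Longrightarrow>
      norm (F u - F v) \<le> L * norm (u - v)"
    using lipschitz_on_ballsE[OF F, of "max K (norm a)"] by blast
  have le: "norm (F (X n) - F a) \<le> L * norm (X n - a)" for n
    using K[of n] by (intro L(2)) auto
  have "(\<lambda>n. L * norm (X n - a)) \<longlonglongrightarrow> 0"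
    using X by (intro tendsto_mult_right_zero tendsto_norm_zero) (simp add: LIM_zero_iff)
  hence "(\<lambda>n. F (X n) - F a) \<longlonglongrightarrow> 0"
    by (rule Lim_null_comparison[OF always_eventually[OF allI[OF le]]])
  thus "(F \<circ> X) \<longlonglongrightarrow> F a" by (simp add: LIM_zero_iff comp_def)
qed

lemma lipschitz_on_balls_forcing:
  assumes q: "real LENGTH('q) > real CARD('n) / 2"
  shows "lipschitz_on_balls (\<lambda>u :: ('q::len0, 'n::finite) sobolev. c *\<^sub>C sobolev_nonlinearity \<eta> u)"
  unfolding lipschitz_on_balls_def
proof
  fix R
  interpret C: bounded_linear "scaleC c :: ('q, 'n) sobolev \<Rightarrow> _" by (rule bounded_linear_scaleC)
  obtain K where K: "K \<ge> 0" "\<And>u. norm (c *\<^sub>C u :: ('q, 'n) sobolev) \<le> norm u * K"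
    using C.nonneg_bounded by blast
  obtain L where L: "L \<ge> 0" "\<And>u v :: ('q, 'n) sobolev. norm u \<le> R \<Longrightarrow> norm v \<le> R \<Longrightarrow>
      norm (sobolev_nonlinearity \<eta> u - sobolev_nonlinearity \<eta> v) \<le> L * norm (u - v)"
    using lipschitz_on_ballsE[OF lipschitz_on_balls_sobolev_nonlinearity[OF q], of R \<eta>] by blast
  have "norm (c *\<^sub>C sobolev_nonlinearity \<eta> u - c *\<^sub>C sobolev_nonlinearity \<eta> v) \<le> (L * K) * norm (u - v)"
    if "norm u \<le> R" "norm v \<le> R" for u v :: "('q, 'n) sobolev"
  proof -
    have "norm (c *\<^sub>C sobolev_nonlinearity \<eta> u - c *\<^sub>C sobolev_nonlinearity \<eta> v) \<le>
        norm (sobolev_nonlinearity \<eta> u - sobolev_nonlinearity \<eta> v) * K"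
      unfolding C.diff[symmetric] by (rule K)
    also have "\<dots> \<le> (L * norm (u - v)) * K"
      using L(2)[OF that] K(1) by (rule mult_right_mono)
    finally show ?thesis by (simp add: ac_simps)
  qed
  thus "\<exists>L\<ge>0. \<forall>u v :: ('q, 'n) sobolev. norm u \<le> R \<longrightarrow> norm v \<le> R \<longrightarrow>
      norm (c *\<^sub>C sobolev_nonlinearity \<eta> u - c *\<^sub>C sobolev_nonlinearity \<eta> v) \<le> L * norm (u - v)"
    using L(1) K(1) by (intro exI[of _ "L * K"]) auto
qed

text \<open>The propagator preserves balls and distances, so the constants of the autonomous term
  serve for every t.\<close>

lemma locally_lipschitz_interaction_field:
  assumes q: "real LENGTH('q) > real CARD('n) / 2"
  shows "locally_lipschitz_field (interaction_field lam \<eta> :: real \<Rightarrow> ('q::len0, 'n::finite) sobolev \<Rightarrow> _)"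
proof
  let ?F = "\<lambda>u :: ('q, 'n) sobolev. (- (\<i> * lam)) *\<^sub>C sobolev_nonlinearity \<eta> u"
  interpret S: bounded_linear "schroedinger_group t :: ('q, 'n) sobolev \<Rightarrow> _" for t
    by (rule bounded_linear_schroedinger_group)
  note F = lipschitz_on_balls_forcing[OF q, of "- (\<i> * lam)" \<eta>]
  fix R :: real
  show "continuous_on A (\<lambda>t. interaction_field lam \<eta> t (v t))"
    if v: "continuous_on A v" for A and v :: "real \<Rightarrow> ('q, 'n) sobolev"
    unfolding interaction_field_def
    by (intro continuous_on_schroedinger_group_apply continuous_on_compose2[OF lipschitz_on_balls_continuous[OF F]]
        continuous_on_minus continuous_on_id v) auto
  obtain L where L: "L \<ge> 0" "\<And>u v. norm u \<le> R \<Longrightarrow> norm v \<le> R \<Longrightarrow> norm (?F u - ?F v) \<le> L * norm (u - v)"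
    using lipschitz_on_ballsE[OF F, of R] by blast
  have "norm (interaction_field lam \<eta> t u - interaction_field lam \<eta> t v) \<le> L * norm (u - v)"
    if "norm u \<le> R" "norm v \<le> R" for t and u v :: "('q, 'n) sobolev"
    using L(2)[of "schroedinger_group t u" "schroedinger_group t v"] that
    by (simp add: interaction_field_def norm_schroedinger_group flip: S.diff)
  thus "\<exists>L\<ge>0. \<forall>t u v. norm u \<le> R \<longrightarrow> norm v \<le> R \<longrightarrow>
      norm (interaction_field lam \<eta> t u - interaction_field lam \<eta> t v :: ('q, 'n) sobolev) \<le> L * norm (u - v)"
    using L(1) by blast
  obtain M where M: "M \<ge> 0" "\<And>u. norm u \<le> R \<Longrightarrow> norm (?F u) \<le> M"
    using lipschitz_on_balls_bounded[OF F, of R] by blast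
  have "norm (interaction_field lam \<eta> t u) \<le> M" if "norm u \<le> R" for t and u :: "('q, 'n) sobolev"
    using M(2)[of "schroedinger_group t u"] that by (simp add: interaction_field_def norm_schroedinger_group)
  thus "\<exists>M\<ge>0. \<forall>t u. norm u \<le> R \<longrightarrow> norm (interaction_field lam \<eta> t u :: ('q, 'n) sobolev) \<le> M"
    using M(1) by blast
qed

lemma scaleC_minus: "(- c) *\<^sub>C u = - (c *\<^sub>C u)"
  for u :: "('q::len0, 'n::finite) sobolev"
  using rep_sobolev_scaleC[of "- c" u] rep_sobolev_scaleC[of c u] rep_sobolev_scaleC[of "-1" "c *\<^sub>C u"]
  unfolding uminus_sobolev_def by (intro sobolev_eqI, eventually_elim) simp

text \<open>Applying S(-t) to Duhamel's formula turns S(t - nu) into S(-nu), which frees the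
  integrand of t; S(t) leads back. Bounded linear maps commute with the integral.\<close>

lemma mild_solution_iff:
  fixes \<psi> :: "real \<Rightarrow> ('q::len0, 'n::finite) sobolev"
  assumes q: "real LENGTH('q) > real CARD('n) / 2"
  shows "mild_solution lam \<eta> \<psi>0 T \<psi> \<longleftrightarrow>
    locally_lipschitz_field.solves (interaction_field lam \<eta>) \<psi>0 0 T (\<lambda>t. schroedinger_group (- t) (\<psi> t))"
proof -
  interpret locally_lipschitz_field "interaction_field lam \<eta> :: real \<Rightarrow> ('q, 'n) sobolev \<Rightarrow> _"
    by (rule locally_lipschitz_interaction_field[OF q])
  interpret S: bounded_linear "schroedinger_group t :: ('q, 'n) sobolev \<Rightarrow> _" for t
    by (rule bounded_linear_schroedinger_group)
  let ?c = "- (\<i> * lam)"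
  let ?N = "sobolev_nonlinearity \<eta> :: ('q, 'n) sobolev \<Rightarrow> _"
  let ?v = "\<lambda>t. schroedinger_group (- t) (\<psi> t)"
  have field: "interaction_field lam \<eta> \<nu> (?v \<nu>) = schroedinger_group (- \<nu>) (?c *\<^sub>C ?N (\<psi> \<nu>))" for \<nu>
    by (simp add: interaction_field_def schroedinger_group_add schroedinger_group_0)
  have cont_iff: "continuous_on A \<psi> \<longleftrightarrow> continuous_on A ?v" for A
  proof
    assume "continuous_on A ?v"
    from continuous_on_schroedinger_group_apply[OF continuous_on_id this]
    show "continuous_on A \<psi>" by (simp add: schroedinger_group_add schroedinger_group_0)
  qed (intro continuous_on_schroedinger_group_apply continuous_on_minus continuous_on_id)
  have duhamel: "(\<exists>I. ((\<lambda>\<nu>. schroedinger_group (t - \<nu>) (?N (\<psi> \<nu>))) has_integral I) {0..t} \<and>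
        \<psi> t = schroedinger_group t \<psi>0 - (\<i> * lam) *\<^sub>C I) \<longleftrightarrow>
      ((\<lambda>\<nu>. interaction_field lam \<eta> \<nu> (?v \<nu>)) has_integral (?v t - \<psi>0)) {0..t}"
    if \<psi>: "continuous_on {0..t} \<psi>" for t
  proof
    assume "\<exists>I. ((\<lambda>\<nu>. schroedinger_group (t - \<nu>) (?N (\<psi> \<nu>))) has_integral I) {0..t} \<and>
        \<psi> t = schroedinger_group t \<psi>0 - (\<i> * lam) *\<^sub>C I"
    then obtain I where I: "((\<lambda>\<nu>. schroedinger_group (t - \<nu>) (?N (\<psi> \<nu>))) has_integral I) {0..t}"
      and eq: "\<psi> t = schroedinger_group t \<psi>0 - (\<i> * lam) *\<^sub>C I" by blast
    have "((\<lambda>\<nu>. schroedinger_group (- t) (?c *\<^sub>C schroedinger_group (t - \<nu>) (?N (\<psi> \<nu>)))) has_integral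
        schroedinger_group (- t) (?c *\<^sub>C I)) {0..t}"
      using has_integral_linear[OF has_integral_linear[OF I bounded_linear_scaleC] bounded_linear_schroedinger_group]
      by (simp add: comp_def)
    moreover have "schroedinger_group (- t) (?c *\<^sub>C schroedinger_group (t - \<nu>) (?N (\<psi> \<nu>))) =
        interaction_field lam \<eta> \<nu> (?v \<nu>)" for \<nu>
      by (simp add: field schroedinger_group_scaleC schroedinger_group_add)
    moreover have "schroedinger_group (- t) (?c *\<^sub>C I) = ?v t - \<psi>0"
      by (simp add: eq S.diff schroedinger_group_add schroedinger_group_0 scaleC_minus S.neg)
    ultimately show "((\<lambda>\<nu>. interaction_field lam \<eta> \<nu> (?v \<nu>)) has_integral (?v t - \<psi>0)) {0..t}" by simp
  next
    assume I: "((\<lambda>\<nu>. interaction_field lam \<eta> \<nu> (?v \<nu>)) has_integral (?v t - \<psi>0)) {0..t}"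
    \<comment> \<open>The Duhamel integral cannot be recovered from the given one by dividing by
      \<open>lam\<close>, which may be 0. Continuity provides it as \<open>J\<close>, and uniqueness
      of the integral identifies its multiple.\<close>
    have "continuous_on {0..t} (\<lambda>\<nu>. schroedinger_group (t - \<nu>) (?N (\<psi> \<nu>)))"
      by (intro continuous_on_schroedinger_group_apply continuous_on_diff continuous_on_const continuous_on_id
          continuous_on_compose2[OF lipschitz_on_balls_continuous[OF lipschitz_on_balls_sobolev_nonlinearity[OF q]] \<psi>]) auto
    then obtain J where J: "((\<lambda>\<nu>. schroedinger_group (t - \<nu>) (?N (\<psi> \<nu>))) has_integral J) {0..t}"
      using integrable_continuous_interval unfolding integrable_on_def by blast
    have "((\<lambda>\<nu>. ?c *\<^sub>C schroedinger_group (t - \<nu>) (?N (\<psi> \<nu>))) has_integral ?c *\<^sub>C J) {0..t}"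
      using has_integral_linear[OF J bounded_linear_scaleC] by (simp add: comp_def)
    moreover have "((\<lambda>\<nu>. schroedinger_group t (interaction_field lam \<eta> \<nu> (?v \<nu>))) has_integral
        schroedinger_group t (?v t - \<psi>0)) {0..t}"
      using has_integral_linear[OF I bounded_linear_schroedinger_group] by (simp add: comp_def)
    moreover have "schroedinger_group t (interaction_field lam \<eta> \<nu> (?v \<nu>)) =
        ?c *\<^sub>C schroedinger_group (t - \<nu>) (?N (\<psi> \<nu>))" for \<nu>
      by (simp add: field schroedinger_group_scaleC schroedinger_group_add)
    ultimately have "?c *\<^sub>C J = schroedinger_group t (?v t - \<psi>0)"
      using has_integral_unique by simp
    hence "\<psi> t = schroedinger_group t \<psi>0 - (\<i> * lam) *\<^sub>C J"
      by (simp add: S.diff schroedinger_group_add schroedinger_group_0 scaleC_minus algebra_simps)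
    with J show "\<exists>I. ((\<lambda>\<nu>. schroedinger_group (t - \<nu>) (?N (\<psi> \<nu>))) has_integral I) {0..t} \<and>
        \<psi> t = schroedinger_group t \<psi>0 - (\<i> * lam) *\<^sub>C I" by blast
  qed
  \<comment> \<open>The equivalence of the integral equations presupposes continuity of psi. Both
    sides contain it, so they fail together without it.\<close>
  show ?thesis
  proof (cases "continuous_on {0..T} \<psi>")
    case True
    hence "continuous_on {0..t} \<psi>" if "t \<in> {0..T}" for t
      using that by (auto intro: continuous_on_subset)
    thus ?thesis
      using True cont_iff[of "{0..T}"] duhamel
      by (simp add: mild_solution_def solves_def in_sobolev_power_nonlinearity[OF q in_sobolev_rep])
  next
    case False
    thus ?thesis
      using cont_iff[of "{0..T}"] by (simp add: mild_solution_def solves_def)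
  qed
qed

lemma in_Linfty_continuous:
  assumes "continuous_on {0..T} \<psi>"
  shows "in_Linfty T \<psi>"
proof -
  have "continuous_on {0<..<T} \<psi>"
    by (rule continuous_on_subset[OF assms]) auto
  hence m: "set_borel_measurable lborel {0<..<T} \<psi>"
    using borel_measurable_continuous_on_indicator[of "{0<..<T}" \<psi>] by (simp add: set_borel_measurable_def)
  obtain M where "\<forall>y\<in>\<psi> ` {0..T}. norm y \<le> M"
    using compact_imp_bounded[OF compact_continuous_image[OF assms compact_Icc]] unfolding bounded_iff by blast
  hence "AE t in lborel. t \<in> {0<..<T} \<longrightarrow> norm (\<psi> t) \<le> M"
    by (intro AE_I2) auto
  with m show ?thesis by (auto simp: in_Linfty_def)
qed

text \<open>A continuous function on a compact interval is essentially bounded, and uniqueness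
  transfers from the interaction picture because S(-t) is injective.\<close>

lemma unique_mild_solution_iff:
  fixes \<psi> :: "real \<Rightarrow> ('q::len0, 'n::finite) sobolev"
  assumes q: "real LENGTH('q) > real CARD('n) / 2"
  shows "unique_mild_solution lam \<eta> \<psi>0 T \<psi> \<longleftrightarrow> mild_solution lam \<eta> \<psi>0 T \<psi>"
proof
  interpret locally_lipschitz_field "interaction_field lam \<eta> :: real \<Rightarrow> ('q, 'n) sobolev \<Rightarrow> _"
    by (rule locally_lipschitz_interaction_field[OF q])
  assume \<psi>: "mild_solution lam \<eta> \<psi>0 T \<psi>"
  have "\<phi> t = \<psi> t" if \<phi>: "mild_solution lam \<eta> \<psi>0 T \<phi>" and t: "t \<in> {0..T}" for \<phi> t
  proof -
    have "schroedinger_group (- t) (\<phi> t) = schroedinger_group (- t) (\<psi> t)"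
      using solution_unique[OF \<phi>[unfolded mild_solution_iff[OF q]] \<psi>[unfolded mild_solution_iff[OF q]] t] .
    hence "schroedinger_group t (schroedinger_group (- t) (\<phi> t)) = schroedinger_group t (schroedinger_group (- t) (\<psi> t))"
      by simp
    thus ?thesis by (simp add: schroedinger_group_add schroedinger_group_0)
  qed
  moreover have "in_Linfty T \<psi>"
    using \<psi> by (intro in_Linfty_continuous) (simp add: mild_solution_def)
  ultimately show "unique_mild_solution lam \<eta> \<psi>0 T \<psi>"
    using \<psi> unfolding unique_mild_solution_def by blast
qed (simp add: unique_mild_solution_def)

theorem theorem1p1:
  fixes lam :: complex and \<eta> :: nat and C :: real
    and \<psi>0 :: "('q::len0, 'n::finite) sobolev"
  assumes "\<eta> \<ge> 1"
    and "real LENGTH('q) > real CARD('n) / 2"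
    and "LENGTH('q) \<ge> \<eta>"
    and H1: "\<forall>f g :: real.
               cmod (nonlinearity lam \<eta> (of_real f) - nonlinearity lam \<eta> (of_real g))
                 \<le> C * \<bar>f - g\<bar> * (\<bar>f\<bar> ^ (2 * \<eta>) + \<bar>g\<bar> ^ (2 * \<eta>))"
    and H2: "\<exists>\<sigma>::nat. \<forall>f g :: real.
               cmod (higher_deriv_real \<sigma> (\<lambda>s. nonlinearity lam \<eta> (of_real s)) f
                     - higher_deriv_real \<sigma> (\<lambda>s. nonlinearity lam \<eta> (of_real s)) g)
                 \<le> C * \<bar>f - g\<bar> *
                     (\<bar>f\<bar> powi (2 * int \<eta> - int \<sigma>) + \<bar>g\<bar> powi (2 * int \<eta> - int \<sigma>))"
  shows "(\<exists>T>0. \<exists>\<psi>. unique_mild_solution lam \<eta> \<psi>0 T \<psi>) \<and>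
         (\<forall>T>0. \<forall>\<psi>. unique_mild_solution lam \<eta> \<psi>0 T \<psi> \<longrightarrow>
            (\<exists>T'>T. \<exists>\<psi>'. is_continuation lam \<eta> \<psi>0 T \<psi> T' \<psi>' \<and>
                            unique_mild_solution lam \<eta> \<psi>0 T' \<psi>'))"
proof (intro conjI allI impI)
  note q = \<open>real LENGTH('q) > real CARD('n) / 2\<close>
  interpret locally_lipschitz_field "interaction_field lam \<eta> :: real \<Rightarrow> ('q, 'n) sobolev \<Rightarrow> _"
    by (rule locally_lipschitz_interaction_field[OF q])
  \<comment> \<open>Undoing the interaction picture: psi(t) = S(t) v(t).\<close>
  have mild: "mild_solution lam \<eta> \<psi>0 T (\<lambda>t. schroedinger_group t (v t))" if "solves \<psi>0 0 T v" for T v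
    using that by (simp add: mild_solution_iff[OF q] schroedinger_group_add schroedinger_group_0)
  show "\<exists>T>0. \<exists>\<psi>. unique_mild_solution lam \<eta> \<psi>0 T \<psi>"
  proof -
    \<comment> \<open>\<open>local_solution\<close> chooses this length from the constants of the
      field on the ball of radius one plus the norm of the initial value.\<close>
    obtain T v where "T > 0" "solves \<psi>0 0 (0 + T) v"
      by (rule local_solution)
    thus ?thesis
      using mild[of T v] by (auto simp: unique_mild_solution_iff[OF q])
  qed
  fix T :: real and \<psi>
  assume T: "T > 0" and \<psi>: "unique_mild_solution lam \<eta> \<psi>0 T \<psi>"
  have "solves \<psi>0 0 T (\<lambda>t. schroedinger_group (- t) (\<psi> t))"
    using \<psi> by (simp add: unique_mild_solution_iff[OF q] mild_solution_iff[OF q])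
  then obtain T' w where T': "T' > T" and w: "solves \<psi>0 0 T' w"
    and eq: "\<And>t. t \<in> {0..T} \<Longrightarrow> w t = schroedinger_group (- t) (\<psi> t)"
    by (rule solution_extends) (use T in auto)
  let ?\<phi> = "\<lambda>t. schroedinger_group t (w t)"
  have \<phi>: "mild_solution lam \<eta> \<psi>0 T' ?\<phi>"
    by (rule mild[OF w])
  have "?\<phi> t = \<psi> t" if "t \<in> {0..T}" for t
    by (simp add: eq[OF that] schroedinger_group_add schroedinger_group_0)
  moreover have "in_Linfty T' ?\<phi>"
    using \<phi> by (intro in_Linfty_continuous) (simp add: mild_solution_def)
  ultimately show "\<exists>T'>T. \<exists>\<psi>'. is_continuation lam \<eta> \<psi>0 T \<psi> T' \<psi>' \<and> unique_mild_solution lam \<eta> \<psi>0 T' \<psi>'"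
    using T' \<phi> by (intro exI[of _ T'] conjI exI[of _ ?\<phi>]) (auto simp: is_continuation_def unique_mild_solution_iff[OF q])
qed

end
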